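(* Let $n\ge1$ be an integer. If $k=1,2,\ldots$, then, as elements of $A_{k+1}(n)$, $$M_{k+\frac12}=L_{k+\frac12}\qquad\text{and}\qquad M_{k+1}=L_{k+1},$$ where $M_{k+\frac12}=Z_{k+\frac12}-Z_k$ and $M_{k+1}=Z_{k+1}-Z_{k+\frac12}$ are the Jucys--Murphy elements of Halverson and Ram, and $L_{k+\frac12},L_{k+1}$ are the recursively defined elements (specialized at $z=n$).
   Context: Partition algebras. For an integer $k\ge1$ let $A_k$ be the set of all set partitions of $\{1,\ldots,k,1',\ldots,k'\}$, and let $A_{k-\frac12}\subseteq A_k$ be the subset of those in which $k$ and $k'$ lie in the same block. A partition is drawn as a graph with top vertices $1,\ldots,k$ and bottom vertices $1',\ldots,k'$, whose connected components are the blocks. For $\rho_1,\rho_2\in A_k$, $\rho_1\circ\rho_2\in A_k$ is obtained by placing $\rho_1$ above $\rho_2$, identifying the bottom row of $\rho_1$ with the top row of $\rho_2$, and deleting components contained entirely in the middle row. Let $R=\mathbb{Z}[z]$, $z$ an indeterminate. $\mathcal{A}_k(z)$ is the free $R$-module on $A_k$ with product $\rho_1\rho_2=z^{\ell}\,\rho_1\circ\rho_2$, where $\ell$ is the number of components deleted from the middle row; $\mathcal{A}_{k-\frac12}(z)$ is the subalgebra generated by $A_{k-\frac12}$, and $\mathcal{A}_0(z)=R$. Adding the block $\{k+1,(k+1)'\}$ embeds $\mathcal{A}_k(z)$ in $\mathcal{A}_{k+\frac12}(z)\subseteq\mathcal{A}_{k+1}(z)$. For an integer $n\ge 1$, $A_r(n)=\mathcal{A}_r(z)\otimes_{\mathbb{Z}[z]}\mathbb{C}$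 with $z$ acting on $\mathbb{C}$ as $n$ (for $r$ an integer or half-integer). Elements: $s_i$ ($i\ge1$) has blocks $\{i,(i+1)'\},\{i+1,i'\}$ and $\{m,m'\}$ for $m\ne i,i+1$; $p_j$ ($j\ge1$) has blocks $\{j\},\{j'\}$ and $\{m,m'\}$ for $m\ne j$; $p_{i+\frac12}$ ($i\ge1$) has blocks $\{i,i+1,i',(i+1)'\}$ and $\{m,m'\}$ for $m\neq i,i+1$. Recursive definitions. $L_0=0$, $L_1=p_1$, $\sigma_1=1$, $\sigma_2=s_1$, and $L_{i+1}=-s_iL_ip_{i+\frac12}-p_{i+\frac12}L_is_i+p_{i+\frac12}L_ip_{i+1}p_{i+\frac12}+s_iL_is_i+\sigma_{i+1}$ for $i\ge1$, where for $i\ge2$ $\sigma_{i+1}=s_{i-1}s_i\sigma_is_is_{i-1}+s_ip_{i-\frac12}L_{i-1}s_ip_{i-\frac12}s_i+p_{i-\frac12}L_{i-1}s_ip_{i-\frac12}-s_ip_{i-\frac12}L_{i-1}s_{i-1}p_{i+\frac12}p_ip_{i-\frac12}-p_{i-\frac12}p_ip_{i+\frac12}s_{i-1}L_{i-1}p_{i-\frac12}s_i.$ Also $L_{\frac12}=0$, $\sigma_{\frac12}=1$, $\sigma_{1+\frac12}=1$, and $L_{i+\frac12}=-L_ip_{i+\frac12}-p_{i+\frac12}L_i+p_{i+\frac12}L_ip_ip_{i+\frac12}+s_iL_{i-\frac12}s_i+\sigma_{i+\frac12}$ for $i\ge1$, where for $i\ge2$ $\sigma_{i+\frac12}=s_{i-1}s_i\sigma_{i-\frac12}s_is_{i-1}+p_{i-\frac12}L_{i-1}s_ip_{i-\frac12}s_i+s_ip_{i-\frac12}L_{i-1}s_ip_{i-\frac12}-p_{i-\frac12}L_{i-1}s_{i-1}p_{i+\frac12}p_ip_{i-\frac12}-s_ip_{i-\frac12}p_ip_{i+\frac12}s_{i-1}L_{i-1}p_{i-\frac12}s_i.$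 The Halverson--Ram elements. For a finite set $S$ of positive integers write $S'=\{\ell':\ell\in S\}$, and for $I\subseteq S\cup S'$ write $I^c=(S\cup S')\setminus I$. Let $b_S$ be the partition with blocks $S\cup S'$ and $\{\ell,\ell'\}$ for $\ell\notin S$, and, for $I\neq\emptyset, S\cup S'$, let $d_{I\subseteq S}$ be the partition with blocks $I$, $I^c$ and $\{\ell,\ell'\}$ for $\ell\notin S$. Put $\varepsilon(I,S)=(-1)^{\#\{\ell\in S:\{\ell,\ell'\}\subseteq I\}+\#\{\ell\in S:\{\ell,\ell'\}\subseteq I^c\}}$. For $\emptyset\ne S\subseteq\{1,\ldots,k\}$ let $p_S=\sum_I\frac12\varepsilon(I,S)\,d_{I\subseteq S}$, summed over $I\subseteq S\cup S'$ with $I\ne\emptyset$, $I\neq S\cup S'$, and $I\ne\{\ell,\ell'\}$, $I\neq\{\ell,\ell'\}^c$ for all $\ell\in S$. For $S\subseteq\{1,\ldots,k+1\}$ with $k+1\in S$ and $|S|\ge2$ let $\tilde p_S=\sum_I\frac12\varepsilon(I,S)\,d_{I\subseteq S}$, summed over $I\subseteq S\cup S'$ such that $\{k+1,(k+1)'\}\subseteq I$ or $\{k+1,(k+1)'\}\subseteq I^c$, with $I\ne\emptyset$, $I\ne S\cup S'$, and $I\ne\{\ell,\ell'\}$, $I\neq\{\ell,\ell'\}^c$ for all $\ell\in S\setminus\{k+1\}$. For $k\ge1$, $$Z_k=\binom k2+\sum_{\substack{S\subseteq\{1,\ldots,k\}\\|S|\ge1}}p_S+\sum_{\substack{S\subseteq\{1,\ldots,k\}\\|S|\ge2}}(n-k+|S|)(-1)^{|S|}b_S\in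 A_k(n),$$ $$Z_{k+\frac12}=k+Z_k+\sum_{\substack{S\subseteq\{1,\ldots,k+1\}\\ k+1\in S,\ |S|\ge2}}\Big(\tilde p_S+(n-(k+1)+|S|)(-1)^{|S|}b_S\Big)\in A_{k+\frac12}(n)\subseteq A_{k+1}(n).$$ *)

theory Defs
  imports
    Complex_Main
    "HOL-Library.Disjoint_Sets"
    "HOL-Library.Poly_Mapping"
    "HOL-Computational_Algebra.Polynomial"
begin

section \<open>Partition diagrams\<close>

text \<open>\<open>Top i\<close> is the vertex $i$ and \<open>Bot i\<close> is the vertex $i'$.\<close>

datatype vertex = Top nat | Bot nat

type_synonym diagram = "vertex set set"

definition vertices :: "nat set \<Rightarrow> vertex set" where
  "vertices S = Top ` S \<union> Bot ` S"

definition diagrams :: "nat \<Rightarrow> diagram set" where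
  "diagrams K = {\<rho>. partition_on (vertices {1..K}) \<rho>}"

subsection \<open>Composition\<close>

text \<open>The graph obtained by placing one diagram above another has three rows of vertices.\<close>

datatype stack_vertex = Upper nat | Middle nat | Lower nat

primrec place_above :: "vertex \<Rightarrow> stack_vertex" where
  "place_above (Top i) = Upper i"
| "place_above (Bot i) = Middle i"

primrec place_below :: "vertex \<Rightarrow> stack_vertex" where
  "place_below (Top i) = Middle i"
| "place_below (Bot i) = Lower i"

primrec outer :: "vertex \<Rightarrow> stack_vertex" where
  "outer (Top i) = Upper i"
| "outer (Bot i) = Lower i"

definition stack :: "diagram \<Rightarrow> diagram \<Rightarrow> stack_vertex set set" where
  "stack \<rho> \<tau> = (\<lambda>B. place_above ` B) ` \<rho> \<union> (\<lambda>B. place_below ` B) ` \<tau>"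

definition components :: "diagram \<Rightarrow> diagram \<Rightarrow> stack_vertex set set" where
  "components \<rho> \<tau> = \<Union>(stack \<rho> \<tau>) // (\<Union>B\<in>stack \<rho> \<tau>. B \<times> B)\<^sup>+"

definition compose :: "diagram \<Rightarrow> diagram \<Rightarrow> diagram" where
  "compose \<rho> \<tau> = {outer -` C | C. C \<in> components \<rho> \<tau> \<and> \<not> C \<subseteq> range Middle}"

definition deleted :: "diagram \<Rightarrow> diagram \<Rightarrow> nat" where
  "deleted \<rho> \<tau> = card {C \<in> components \<rho> \<tau>. C \<subseteq> range Middle}"

subsection \<open>Particular diagrams in \<open>diagrams K\<close>\<close>

text \<open>The blocks $\{m, m'\}$ for $m \in \{1, \dots, K\} \setminus S$, which complete a
  partition of $S \cup S'$ to a partition of $\{1, \dots, K, 1', \dots, K'\}$.\<close>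

definition verticals :: "nat \<Rightarrow> nat set \<Rightarrow> diagram" where
  "verticals K S = (\<lambda>m. {Top m, Bot m}) ` ({1..K} - S)"

definition id_diag :: "nat \<Rightarrow> diagram" where
  "id_diag K = verticals K {}"

definition s_diag :: "nat \<Rightarrow> nat \<Rightarrow> diagram" where
  "s_diag K i = {{Top i, Bot (i + 1)}, {Top (i + 1), Bot i}} \<union> verticals K {i, i + 1}"

definition p_diag :: "nat \<Rightarrow> nat \<Rightarrow> diagram" where
  "p_diag K j = {{Top j}, {Bot j}} \<union> verticals K {j}"

text \<open>The diagram of $p_{i+1/2}$.\<close>

definition p_half_diag :: "nat \<Rightarrow> nat \<Rightarrow> diagram" where
  "p_half_diag K i =
     {{Top i, Top (i + 1), Bot i, Bot (i + 1)}} \<union> verticals K {i, i + 1}"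

definition b_diag :: "nat \<Rightarrow> nat set \<Rightarrow> diagram" where
  "b_diag K S = {vertices S} \<union> verticals K S"

definition d_diag :: "nat \<Rightarrow> vertex set \<Rightarrow> nat set \<Rightarrow> diagram" where
  "d_diag K I S = {I, vertices S - I} \<union> verticals K S"


section \<open>The recursively defined elements\<close>

text \<open>The free module on the diagrams is the type \<open>diagram \<Rightarrow>\<^sub>0 'a\<close>, with basis elements
  \<open>Poly_Mapping.single \<rho> 1\<close>. The algebra on \<open>diagrams K\<close> over the coefficient ring
  \<open>'a\<close>, with parameter \<open>\<delta>\<close>, consists of the elements supported in \<open>diagrams K\<close>.
  It is $\mathcal{A}_K(z)$ for \<open>\<delta> = z\<close> in $\mathbb{Z}[z]$ and $A_K(n)$ for
  \<open>\<delta> = n\<close> in $\mathbb{C}$.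

  The embeddings of the smaller algebras are given by adding the blocks $\{m, m'\}$, so an
  element of level at most \<open>K\<close> is defined directly as an element of the algebra on
  \<open>diagrams K\<close>. The indices of \<open>s\<close> and \<open>p_half\<close> are meant to be at most
  \<open>K - 1\<close>, and those of \<open>p\<close>, \<open>L\<close> and \<open>\<sigma>\<close> at most \<open>K\<close>.\<close>

locale partition_algebra =
  fixes K :: nat and \<delta> :: "'a :: comm_ring_1"
begin

definition times :: "(diagram \<Rightarrow>\<^sub>0 'a) \<Rightarrow> (diagram \<Rightarrow>\<^sub>0 'a) \<Rightarrow> (diagram \<Rightarrow>\<^sub>0 'a)"
    (infixl "\<star>" 70) where
  "x \<star> y = (\<Sum>\<rho>\<in>diagrams K. \<Sum>\<tau>\<in>diagrams K.
     Poly_Mapping.single (compose \<rho> \<tau>)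
       (\<delta> ^ deleted \<rho> \<tau> * Poly_Mapping.lookup x \<rho> * Poly_Mapping.lookup y \<tau>))"

definition id_elt :: "diagram \<Rightarrow>\<^sub>0 'a" where
  "id_elt = Poly_Mapping.single (id_diag K) 1"

definition s :: "nat \<Rightarrow> diagram \<Rightarrow>\<^sub>0 'a" where
  "s i = Poly_Mapping.single (s_diag K i) 1"

definition p :: "nat \<Rightarrow> diagram \<Rightarrow>\<^sub>0 'a" where
  "p j = Poly_Mapping.single (p_diag K j) 1"

definition p_half :: "nat \<Rightarrow> diagram \<Rightarrow>\<^sub>0 'a" where
  "p_half i = Poly_Mapping.single (p_half_diag K i) 1"

text \<open>\<open>\<sigma> 0\<close> is a dummy value that is never used.\<close>

function L :: "nat \<Rightarrow> diagram \<Rightarrow>\<^sub>0 'a" and \<sigma> :: "nat \<Rightarrow> diagram \<Rightarrow>\<^sub>0 'a" where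
  "L 0 = 0"
| "L (Suc i) = (if i = 0 then p 1 else
     - (s i \<star> L i \<star> p_half i) - p_half i \<star> L i \<star> s i
     + p_half i \<star> L i \<star> p (i + 1) \<star> p_half i + s i \<star> L i \<star> s i + \<sigma> (Suc i))"
| "\<sigma> 0 = 0"
| "\<sigma> (Suc i) = (if i = 0 then id_elt else if i = 1 then s 1 else
     s (i - 1) \<star> s i \<star> \<sigma> i \<star> s i \<star> s (i - 1)
     + s i \<star> p_half (i - 1) \<star> L (i - 1) \<star> s i \<star> p_half (i - 1) \<star> s i
     + p_half (i - 1) \<star> L (i - 1) \<star> s i \<star> p_half (i - 1)
     - s i \<star> p_half (i - 1) \<star> L (i - 1) \<star> s (i - 1) \<star> p_half i \<star> p i \<star> p_half (i - 1)
     - p_half (i - 1) \<star> p i \<star> p_half i \<star> s (i - 1) \<star> L (i - 1) \<star> p_half (i - 1) \<star> s i)"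
  by pat_completeness auto
termination
  by (relation "measure (case_sum (\<lambda>i. 2 * i + 1) (\<lambda>i. 2 * i))") auto

text \<open>\<open>\<sigma>_half i\<close> and \<open>L_half i\<close> are $\sigma_{i+1/2}$ and $L_{i+1/2}$; thus
  $p_{i-1/2}$ is \<open>p_half (i - 1)\<close>.\<close>

fun \<sigma>_half :: "nat \<Rightarrow> diagram \<Rightarrow>\<^sub>0 'a" where
  "\<sigma>_half 0 = id_elt"
| "\<sigma>_half (Suc j) = (if j = 0 then id_elt else let i = Suc j in
     s (i - 1) \<star> s i \<star> \<sigma>_half j \<star> s i \<star> s (i - 1)
     + p_half (i - 1) \<star> L (i - 1) \<star> s i \<star> p_half (i - 1) \<star> s i
     + s i \<star> p_half (i - 1) \<star> L (i - 1) \<star> s i \<star> p_half (i - 1)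
     - p_half (i - 1) \<star> L (i - 1) \<star> s (i - 1) \<star> p_half i \<star> p i \<star> p_half (i - 1)
     - s i \<star> p_half (i - 1) \<star> p i \<star> p_half i \<star> s (i - 1) \<star> L (i - 1) \<star> p_half (i - 1) \<star> s i)"

fun L_half :: "nat \<Rightarrow> diagram \<Rightarrow>\<^sub>0 'a" where
  "L_half 0 = 0"
| "L_half (Suc j) = (let i = Suc j in
     - (L i \<star> p_half i) - p_half i \<star> L i
     + p_half i \<star> L i \<star> p i \<star> p_half i + s i \<star> L_half j \<star> s i + \<sigma>_half i)"

end

text \<open>The map $x \mapsto x \otimes 1$ from $\mathcal{A}_K(z)$ to
  $A_K(n) = \mathcal{A}_K(z) \otimes_{\mathbb{Z}[z]} \mathbb{C}$, where $z$ is the polynomial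
  \<open>[:0, 1:]\<close>.\<close>

definition specialize :: "nat \<Rightarrow> (diagram \<Rightarrow>\<^sub>0 int poly) \<Rightarrow> (diagram \<Rightarrow>\<^sub>0 complex)" where
  "specialize n x = Poly_Mapping.map (\<lambda>q. poly (map_poly of_int q) (of_nat n)) x"


section \<open>The Halverson--Ram elements\<close>

definition eps :: "vertex set \<Rightarrow> nat set \<Rightarrow> complex" where
  "eps I S = (-1) ^ (card {l \<in> S. {Top l, Bot l} \<subseteq> I}
                   + card {l \<in> S. {Top l, Bot l} \<subseteq> vertices S - I})"

definition p_set :: "nat \<Rightarrow> nat set \<Rightarrow> diagram \<Rightarrow>\<^sub>0 complex" where
  "p_set K S =
     (\<Sum>I | I \<subseteq> vertices S \<and> I \<noteq> {} \<and> I \<noteq> vertices S \<and>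
          (\<forall>l\<in>S. I \<noteq> {Top l, Bot l} \<and> I \<noteq> vertices S - {Top l, Bot l}).
        Poly_Mapping.single (d_diag K I S) (1 / 2 * eps I S))"

text \<open>In \<open>p_tilde\<close> the argument \<open>r\<close> is the distinguished index $k + 1$ in $S$.\<close>

definition p_tilde :: "nat \<Rightarrow> nat \<Rightarrow> nat set \<Rightarrow> diagram \<Rightarrow>\<^sub>0 complex" where
  "p_tilde K r S =
     (\<Sum>I | I \<subseteq> vertices S \<and> ({Top r, Bot r} \<subseteq> I \<or> {Top r, Bot r} \<subseteq> vertices S - I) \<and>
          I \<noteq> {} \<and> I \<noteq> vertices S \<and>
          (\<forall>l\<in>S - {r}. I \<noteq> {Top l, Bot l} \<and> I \<noteq> vertices S - {Top l, Bot l}).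
        Poly_Mapping.single (d_diag K I S) (1 / 2 * eps I S))"

text \<open>\<open>HR_Z n K k\<close> and \<open>HR_Z_half n K k\<close> are $Z_k$ and $Z_{k+1/2}$, and
  \<open>HR_M n K k\<close> and \<open>HR_M_half n K k\<close> are $M_k$ and $M_{k+1/2}$, all viewed as elements of
  $A_K(n)$.\<close>

definition HR_Z :: "nat \<Rightarrow> nat \<Rightarrow> nat \<Rightarrow> diagram \<Rightarrow>\<^sub>0 complex" where
  "HR_Z n K k =
     Poly_Mapping.single (id_diag K) (of_nat (k choose 2))
     + (\<Sum>S | S \<subseteq> {1..k} \<and> card S \<ge> 1. p_set K S)
     + (\<Sum>S | S \<subseteq> {1..k} \<and> card S \<ge> 2.
          Poly_Mapping.single (b_diag K S)
            ((of_nat n - of_nat k + of_nat (card S)) * (-1) ^ card S))"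

definition HR_Z_half :: "nat \<Rightarrow> nat \<Rightarrow> nat \<Rightarrow> diagram \<Rightarrow>\<^sub>0 complex" where
  "HR_Z_half n K k =
     Poly_Mapping.single (id_diag K) (of_nat k) + HR_Z n K k
     + (\<Sum>S | S \<subseteq> {1..k + 1} \<and> k + 1 \<in> S \<and> card S \<ge> 2.
          p_tilde K (k + 1) S
          + Poly_Mapping.single (b_diag K S)
              ((of_nat n - of_nat (k + 1) + of_nat (card S)) * (-1) ^ card S))"

definition HR_M_half :: "nat \<Rightarrow> nat \<Rightarrow> nat \<Rightarrow> diagram \<Rightarrow>\<^sub>0 complex" where
  "HR_M_half n K k = HR_Z_half n K k - HR_Z n K k"

definition HR_M :: "nat \<Rightarrow> nat \<Rightarrow> nat \<Rightarrow> diagram \<Rightarrow>\<^sub>0 complex" where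
  "HR_M n K k = HR_Z n K k - HR_Z_half n K (k - 1)"

end

theory Submission
  imports Defs "HOL-Combinatorics.Transposition"
begin

text \<open>The two sides are compared through Schur--Weyl duality. A word \<open>f\<close> of length
  $K$ in the letters $0, \dots, n - 1$ stands for a basis vector of the $K$-th tensor power of
  $\mathbb{C}^n$. A diagram gives a 0/1 matrix indexed by pairs of words: its entry at \<open>f\<close>,
  \<open>h\<close> is 1 iff writing \<open>f\<close> along the top row and \<open>h\<close> along the bottom
  row labels every block by a single letter. At parameter $n$ this is multiplicative, because in a
  stack of two diagrams each deleted component can be labelled in $n$ ways (\<open>card_middle_words\<close>).

  In this representation all elements in question have a short description. Write
  \<open>swap_labels k a b f\<close> for the word obtained from \<open>f\<close> by exchanging the letters
  $a$ and $b$ in the first $k$ positions. Acting on a function $\varphi$ of words,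
  $\sigma_{i+1}$ and $\sigma_{i+1/2}$ evaluate $\varphi$ after exchanging the letters $f_i$ and
  $f_{i+1}$ in the first $i + 1$, respectively $i - 1$, positions; $L_i$ sums over all letters $b$
  the values of $\varphi$ after exchanging $b$ and $f_i$ in the first $i$ positions; and
  $L_{i+1/2}$ is $n$ minus the sum over all $b$ of the exchanges of $b$ and $f_{i+1}$ in the first
  $i$ positions. Apart from such exchanges in earlier positions, the factors in
  the recursions touch only two or three adjacent letters, and each recursion becomes a case distinction on which of these letters coincide
  (\<open>acts_as_L_step\<close>, \<open>acts_as_\<sigma>_step\<close>, \<open>acts_as_\<sigma>_half_step\<close>,
  \<open>acts_as_L_half\<close>).

  On the other side, $Z_k$ is, up to adding a scalar, the sum of all transpositions of letters applied to
  the first $k$ positions. To see this, write the indicator that \<open>h\<close> arises from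
  \<open>f\<close> by the transposition $(a\,b)$ as a product over the positions, and each factor as
  the indicator of $h_l = f_l$ plus a correction which is a signed sum over the four ways to label
  $l$ and $l'$ by $a$ and $b$. Expanding the product gives a sum over the set $S$ of positions
  where the correction is taken and over the set $I$ of vertices labelled $a$; summing over
  $a \neq b$ turns the labellings into the diagrams $d_{I \subseteq S}$ and $b_S$
  (\<open>sum_pairs_prod_factor\<close>, \<open>entry_HR_Z\<close>). The same expansion, restricted to
  transpositions that move the letter $f_{k+1}$, yields $M_{k+1/2}$
  (\<open>entry_HR_M_half\<close>), and $M_{k+1}$ follows by subtraction (\<open>entry_HR_M\<close>).

  Hence both sides of each equation have the same matrix for every $n$. If $n \ge 2K$, the matrix
  determines the coefficients (\<open>coefficients_determined_by_entries\<close>), since there are enough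
  letters to label all blocks of a diagram differently. For smaller $n$ the representation need not
  be faithful; but all coefficients are polynomials in $n$, and so equality for large $n$ gives
  equality for all $n$.\<close>

section \<open>Words and the composition of diagrams\<close>

definition words :: "nat \<Rightarrow> nat \<Rightarrow> (nat \<Rightarrow> nat) set" where
  "words n K = {1..K} \<rightarrow>\<^sub>E {..<n}"

definition constant_on_blocks :: "('v \<Rightarrow> nat) \<Rightarrow> 'v set set \<Rightarrow> bool" where
  "constant_on_blocks w P \<longleftrightarrow> (\<forall>B\<in>P. \<forall>x\<in>B. \<forall>y\<in>B. w x = w y)"

lemma constant_on_blocksI:
  "(\<And>B x y. B \<in> P \<Longrightarrow> x \<in> B \<Longrightarrow> y \<in> B \<Longrightarrow> w x = w y) \<Longrightarrow> constant_on_blocks w P"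
  unfolding constant_on_blocks_def by blast

lemma constant_on_blocksD:
  "constant_on_blocks w P \<Longrightarrow> B \<in> P \<Longrightarrow> x \<in> B \<Longrightarrow> y \<in> B \<Longrightarrow> w x = w y"
  unfolding constant_on_blocks_def by blast

definition compatible :: "diagram \<Rightarrow> (nat \<Rightarrow> nat) \<Rightarrow> (nat \<Rightarrow> nat) \<Rightarrow> bool" where
  "compatible \<rho> f h = constant_on_blocks (case_vertex f h) \<rho>"

lemma finite_words [simp]: "finite (words n K)"
  by (simp add: words_def finite_PiE)

lemma wordsD: "f \<in> words n K \<Longrightarrow> i \<in> {1..K} \<Longrightarrow> f i < n"
  by (auto simp: words_def)

lemma finite_vertices [simp]: "finite S \<Longrightarrow> finite (vertices S)"
  by (simp add: vertices_def)

lemma finite_diagrams [simp]: "finite (diagrams K)"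
proof (rule finite_subset)
  show "diagrams K \<subseteq> Pow (Pow (vertices {1..K}))"
    by (auto simp: diagrams_def dest: partition_onD1)
qed simp

lemma equiv_connected:
  "equiv (\<Union>E) ((\<Union>B\<in>E. B \<times> B)\<^sup>+)"
proof (rule equivI)
  let ?R = "\<Union>B\<in>E. B \<times> B"
  have "?R \<subseteq> \<Union>E \<times> \<Union>E" by blast
  then show "?R\<^sup>+ \<subseteq> \<Union>E \<times> \<Union>E" by (rule trancl_subset_Sigma)
  show "refl_on (\<Union>E) (?R\<^sup>+)" by (rule refl_onI) blast
  show "sym (?R\<^sup>+)" by (rule sym_trancl) (auto simp: sym_def)
qed (rule trans_trancl)

text \<open>Equality of labels is an equivalence relation, so it passes from the edges of a graph to its
  connected components.\<close>

lemma constant_on_components: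
  fixes w :: "'v \<Rightarrow> nat"
  shows "constant_on_blocks w (\<Union>E // (\<Union>B\<in>E. B \<times> B)\<^sup>+) \<longleftrightarrow> constant_on_blocks w E"
proof -
  let ?R = "\<Union>B\<in>E. B \<times> B"
  have eq: "w x = w y" if "(x, y) \<in> ?R\<^sup>+" "constant_on_blocks w E" for x y
    using that(1)
  proof (induction rule: trancl_induct)
    case (base y)
    then obtain B where "B \<in> E" "x \<in> B" "y \<in> B" by blast
    then show ?case using constant_on_blocksD[OF that(2)] by blast
  next
    case (step y z)
    then obtain B where "B \<in> E" "y \<in> B" "z \<in> B" by blast
    then have "w y = w z" using constant_on_blocksD[OF that(2)] by blast
    then show ?case using step.IH by simp
  qed
  show ?thesis
  proof
    assume l: "constant_on_blocks w (\<Union>E // ?R\<^sup>+)"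
    show "constant_on_blocks w E"
    proof (rule constant_on_blocksI)
      fix B x y assume "B \<in> E" "x \<in> B" "y \<in> B"
      then have xy: "(x, x) \<in> ?R\<^sup>+" "(x, y) \<in> ?R\<^sup>+" and x: "x \<in> \<Union>E" by blast+
      show "w x = w y"
        using constant_on_blocksD[OF l quotientI[OF x], of x y] xy by blast
    qed
  next
    assume r: "constant_on_blocks w E"
    show "constant_on_blocks w (\<Union>E // ?R\<^sup>+)"
    proof (rule constant_on_blocksI)
      fix C x y assume "C \<in> \<Union>E // ?R\<^sup>+" "x \<in> C" "y \<in> C"
      then obtain z where "(z, x) \<in> ?R\<^sup>+" "(z, y) \<in> ?R\<^sup>+"
        by (auto elim!: quotientE)
      then show "w x = w y" using eq[of z x] eq[of z y] r by simp
    qed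
  qed
qed

definition stack_vertices :: "nat set \<Rightarrow> stack_vertex set" where
  "stack_vertices A = Upper ` A \<union> Middle ` A \<union> Lower ` A"

lemma Union_stack:
  assumes "\<rho> \<in> diagrams K" "\<tau> \<in> diagrams K"
  shows "\<Union>(stack \<rho> \<tau>) = stack_vertices {1..K}"
proof -
  have "\<Union>\<rho> = vertices {1..K}" "\<Union>\<tau> = vertices {1..K}"
    using assms by (auto simp: diagrams_def dest: partition_onD1)
  moreover have "\<Union>(stack \<rho> \<tau>) = place_above ` \<Union>\<rho> \<union> place_below ` \<Union>\<tau>"
    by (auto simp: stack_def)
  ultimately show ?thesis
    by (auto simp: stack_vertices_def vertices_def image_Un image_image)
qed

lemma partition_on_components:
  assumes "\<rho> \<in> diagrams K" "\<tau> \<in> diagrams K"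
  shows "partition_on (stack_vertices {1..K}) (components \<rho> \<tau>)"
  using partition_on_quotient[OF equiv_connected[of "stack \<rho> \<tau>"]]
  by (simp add: components_def Union_stack[OF assms])

lemma outer_vimage_empty: "outer -` C = {} \<longleftrightarrow> C \<subseteq> range Middle"
proof -
  have "outer v \<notin> range Middle" for v by (cases v) auto
  moreover have "x \<in> range outer" if "x \<notin> range Middle" for x
  proof (cases x)
    case (Upper i) then have "x = outer (Top i)" by simp
    then show ?thesis by blast
  next
    case (Middle i) then show ?thesis using that by blast
  next
    case (Lower i) then have "x = outer (Bot i)" by simp
    then show ?thesis by blast
  qed
  ultimately show ?thesis by blast
qed

lemma compose_in_diagrams:
  assumes "\<rho> \<in> diagrams K" "\<tau> \<in> diagrams K"
  shows "compose \<rho> \<tau> \<in> diagrams K"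
proof -
  have "compose \<rho> \<tau> = {outer -` C | C. C \<in> components \<rho> \<tau> \<and> outer -` C \<noteq> {}}"
    by (simp only: compose_def outer_vimage_empty)
  then have "compose \<rho> \<tau> = (-`) outer ` components \<rho> \<tau> - {{}}" by blast
  moreover have "outer -` stack_vertices {1..K} = vertices {1..K}"
  proof (rule set_eqI)
    fix v show "v \<in> outer -` stack_vertices {1..K} \<longleftrightarrow> v \<in> vertices {1..K}"
      by (cases v) (auto simp: stack_vertices_def vertices_def)
  qed
  ultimately show ?thesis
    using partition_on_vimage[OF partition_on_components[OF assms], of outer]
    by (simp add: diagrams_def)
qed

lemma compatible_stack:
  "compatible \<rho> f h \<and> compatible \<tau> h g \<longleftrightarrow>
    constant_on_blocks (case_stack_vertex f h g) (components \<rho> \<tau>)"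
proof -
  have a: "case_stack_vertex f h g (place_above v) = case_vertex f h v"
    and b: "case_stack_vertex f h g (place_below v) = case_vertex h g v" for v
    by (cases v; simp)+
  have "constant_on_blocks (case_stack_vertex f h g) (stack \<rho> \<tau>) \<longleftrightarrow> compatible \<rho> f h \<and> compatible \<tau> h g"
    unfolding stack_def compatible_def constant_on_blocks_def
    by (simp only: ball_Un ball_simps a b)
  then show ?thesis
    by (simp add: components_def constant_on_components)
qed

text \<open>Only outer vertices are compared, so the middle row may carry any label.\<close>

lemma compatible_compose:
  "compatible (compose \<rho> \<tau>) f g \<longleftrightarrow>
    (\<forall>C\<in>components \<rho> \<tau>. \<forall>x\<in>C - range Middle. \<forall>y\<in>C - range Middle.
       case_stack_vertex f undefined g x = case_stack_vertex f undefined g y)" (is "?l \<longleftrightarrow> ?r")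
proof -
  let ?w = "case_stack_vertex f undefined g"
  have o: "?w (outer v) = case_vertex f g v" for v by (cases v; simp)
  have rng: "x \<in> outer ` (outer -` C)" if "x \<in> C - range Middle" for x C
    using that outer_vimage_empty[of "{x}"] by auto
  have nm: "outer v \<notin> range Middle" for v by (cases v) auto
  show ?thesis
  proof
    assume l: ?l
    show ?r
    proof (intro ballI)
      fix C x y assume C: "C \<in> components \<rho> \<tau>" "x \<in> C - range Middle" "y \<in> C - range Middle"
      then obtain u v where uv: "x = outer u" "y = outer v" "u \<in> outer -` C" "v \<in> outer -` C"
        using rng by (meson imageE)
      moreover have "outer -` C \<in> compose \<rho> \<tau>" using C by (auto simp: compose_def)
      ultimately have "case_vertex f g u = case_vertex f g v"
        by (intro constant_on_blocksD[OF l[unfolded compatible_def] _ uv(3,4)])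
      then show "?w x = ?w y" by (simp only: uv(1,2) o)
    qed
  next
    assume r: ?r
    show ?l unfolding compatible_def
    proof (rule constant_on_blocksI)
      fix B x y assume "B \<in> compose \<rho> \<tau>" "x \<in> B" "y \<in> B"
      then obtain C where "C \<in> components \<rho> \<tau>" "outer x \<in> C" "outer y \<in> C"
        by (auto simp: compose_def)
      then have "?w (outer x) = ?w (outer y)"
        using r nm by blast
      then show "case_vertex f g x = case_vertex f g y" by (simp add: o)
    qed
  qed
qed

text \<open>This is the reason why the matrices of diagrams multiply like the diagrams themselves. A word
  \<open>h\<close> on the middle row fits both diagrams iff the labelling of the three rows is constant
  on the components of the stack. So on a component that reaches an outer row, \<open>h\<close> is
  forced by \<open>f\<close> and \<open>g\<close>, which must agree there, while on each deleted
  component one letter can be chosen freely.\<close>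

lemma card_middle_words:
  assumes \<rho>: "\<rho> \<in> diagrams K" and \<tau>: "\<tau> \<in> diagrams K"
    and f: "f \<in> words n K" and g: "g \<in> words n K"
  shows "card {h \<in> words n K. compatible \<rho> f h \<and> compatible \<tau> h g} =
    (if compatible (compose \<rho> \<tau>) f g then n ^ deleted \<rho> \<tau> else 0)"
proof -
  let ?P = "components \<rho> \<tau>" and ?U = "stack_vertices {1..K}"
  define D where "D = {C \<in> ?P. C \<subseteq> range Middle}"
  note part = partition_on_components[OF \<rho> \<tau>]
  have U: "\<Union>?P = ?U" using part by (auto dest: partition_onD1)
  have finP: "finite ?P"
    using finite_elements[OF _ part] by (simp add: stack_vertices_def)
  have ne: "C \<noteq> {}" if "C \<in> ?P" for C using part that by (auto dest: partition_onD3)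
  have uniq: "C = C'" if "C \<in> ?P" "C' \<in> ?P" "x \<in> C" "x \<in> C'" for C C' x
    using partition_onD2[OF part] that by (auto simp: disjoint_def)
  define W where "W h = case_stack_vertex f h g" for h
  define H where "H = {h \<in> words n K. constant_on_blocks (W h) ?P}"
  have H: "{h \<in> words n K. compatible \<rho> f h \<and> compatible \<tau> h g} = H"
    by (simp add: H_def W_def compatible_stack)
  have Wout: "W h x = case_stack_vertex f undefined g x" if "x \<notin> range Middle" for x h
    using that by (cases x) (auto simp: W_def)
  have Wlt: "W h x < n" if "h \<in> words n K" "x \<in> ?U" for h x
    using that f g by (auto simp: W_def stack_vertices_def words_def)
  show ?thesis
  proof (cases "compatible (compose \<rho> \<tau>) f g")
    case False
    have "H = {}"
    proof (rule ccontr)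
      assume "H \<noteq> {}"
      then obtain h where h: "constant_on_blocks (W h) ?P" by (auto simp: H_def)
      have "compatible (compose \<rho> \<tau>) f g"
        unfolding compatible_compose
      proof (intro ballI)
        fix C x y
        assume "C \<in> ?P" and xy: "x \<in> C - range Middle" "y \<in> C - range Middle"
        then have "W h x = W h y" using constant_on_blocksD[OF h, of C x y] by simp
        then show "case_stack_vertex f undefined g x = case_stack_vertex f undefined g y"
          using xy by (simp add: Wout)
      qed
      then show False using False by simp
    qed
    then show ?thesis using False H by simp
  next
    case cc: True
    \<comment> \<open>A vertex of \<open>C\<close>, in an outer row if possible: there its label is known from
      \<open>f\<close> and \<open>g\<close>.\<close>
    define rep where "rep C = (if C \<subseteq> range Middle then SOME x. x \<in> C else SOME x. x \<in> C - range Middle)"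
      for C :: "stack_vertex set"
    have rep: "rep C \<in> C" if "C \<in> ?P" for C
      using ne[OF that] unfolding rep_def
      by (smt (verit) DiffD1 DiffI ex_in_conv someI_ex subsetI)
    have repo: "rep C \<notin> range Middle" if "C \<in> ?P - D" for C
      using that unfolding rep_def D_def
      by (smt (verit, best) DiffE DiffI mem_Collect_eq someI_ex subsetI)
    define blk where "blk x = (THE C. C \<in> ?P \<and> x \<in> C)" for x
    have blk: "blk x = C" if "C \<in> ?P" "x \<in> C" for C x
      unfolding blk_def using that uniq by (intro the_equality) blast+
    \<comment> \<open>\<open>\<Phi>\<close> reads off the letters on the deleted components; \<open>\<Psi>\<close> rebuilds
      the middle word from them.\<close>
    define \<Phi> where "\<Phi> h = (\<lambda>C\<in>D. W h (rep C))" for h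
    define \<Psi> where "\<Psi> c = (\<lambda>i\<in>{1..K}. let C = blk (Middle i) in
        if C \<in> D then c C else case_stack_vertex f undefined g (rep C))" for c
    have blkM: "blk (Middle i) \<in> ?P" "Middle i \<in> blk (Middle i)" if "i \<in> {1..K}" for i
    proof -
      have "Middle i \<in> \<Union>?P" using that by (simp add: U stack_vertices_def)
      then show "blk (Middle i) \<in> ?P" "Middle i \<in> blk (Middle i)"
        using blk by auto
    qed
    have \<Psi>W: "W (\<Psi> c) x = (if C \<in> D then c C else case_stack_vertex f undefined g (rep C))"
      if C: "C \<in> ?P" "x \<in> C" for c C x
    proof (cases "x \<in> range Middle")
      case True
      then obtain i where i: "x = Middle i" by blast
      then have "i \<in> {1..K}" using C U by (auto simp: stack_vertices_def)
      then show ?thesis using blk[OF C] by (simp add: W_def i \<Psi>_def)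
    next
      case False
      then have CD: "C \<notin> D" using C by (auto simp: D_def)
      then have "case_stack_vertex f undefined g x = case_stack_vertex f undefined g (rep C)"
        using C False rep[of C] repo[of C]
        by (intro cc[unfolded compatible_compose, rule_format, OF C(1)]) auto
      then show ?thesis using CD False by (simp add: Wout)
    qed
    have "bij_betw \<Phi> H (D \<rightarrow>\<^sub>E {..<n})"
    proof (rule bij_betw_byWitness[where f' = \<Psi>])
      show "\<forall>h\<in>H. \<Psi> (\<Phi> h) = h"
      proof
        fix h assume h: "h \<in> H"
        show "\<Psi> (\<Phi> h) = h"
        proof
          fix i
          show "\<Psi> (\<Phi> h) i = h i"
          proof (cases "i \<in> {1..K}")
            case False
            then show ?thesis using h by (auto simp: \<Psi>_def H_def words_def)
          next
            case True
            let ?C = "blk (Middle i)"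
            have C: "?C \<in> ?P" "Middle i \<in> ?C" using blkM[OF True] by auto
            have "W h (Middle i) = W h (rep ?C)"
              using constant_on_blocksD[OF _ C rep[OF C(1)], of "W h"] h by (simp add: H_def)
            moreover have "W h (rep ?C) = case_stack_vertex f undefined g (rep ?C)" if "?C \<notin> D"
              using that C repo by (intro Wout) auto
            ultimately show ?thesis using True by (auto simp: \<Psi>_def \<Phi>_def W_def Let_def)
          qed
        qed
      qed
      show "\<forall>c\<in>D \<rightarrow>\<^sub>E {..<n}. \<Phi> (\<Psi> c) = c"
      proof
        fix c assume c: "c \<in> D \<rightarrow>\<^sub>E {..<n}"
        show "\<Phi> (\<Psi> c) = c"
        proof
          fix C show "\<Phi> (\<Psi> c) C = c C"
            using c \<Psi>W[of C "rep C" c] rep[of C]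
            by (cases "C \<in> D") (auto simp: \<Phi>_def D_def PiE_def extensional_def)
        qed
      qed
      show "\<Phi> ` H \<subseteq> D \<rightarrow>\<^sub>E {..<n}"
      proof -
        have "W h (rep C) < n" if "h \<in> H" "C \<in> D" for h C
          using that rep[of C] U by (intro Wlt) (auto simp: H_def D_def)
        then show ?thesis by (auto simp: \<Phi>_def)
      qed
      show "\<Psi> ` (D \<rightarrow>\<^sub>E {..<n}) \<subseteq> H"
      proof
        fix h assume "h \<in> \<Psi> ` (D \<rightarrow>\<^sub>E {..<n})"
        then obtain c where c: "c \<in> D \<rightarrow>\<^sub>E {..<n}" "h = \<Psi> c" by blast
        have "constant_on_blocks (W (\<Psi> c)) ?P"
          by (rule constant_on_blocksI) (simp only: \<Psi>W)
        moreover have "\<Psi> c \<in> words n K"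
        proof -
          have "\<Psi> c i < n" if i: "i \<in> {1..K}" for i
          proof (cases "blk (Middle i) \<in> D")
            case True then show ?thesis using i c by (auto simp: \<Psi>_def Let_def)
          next
            case False
            have "f \<in> words n K" by (rule f)
            then have "W f (rep (blk (Middle i))) < n"
              using blkM[OF i] rep U by (intro Wlt) auto
            then show ?thesis
              using False i blkM[OF i] repo[of "blk (Middle i)"] by (simp add: \<Psi>_def Let_def Wout)
          qed
          then show ?thesis by (auto simp: words_def \<Psi>_def)
        qed
        ultimately show "h \<in> H" by (simp add: H_def c)
      qed
    qed
    then have "card H = card (D \<rightarrow>\<^sub>E {..<n})" by (rule bij_betw_same_card)
    also have "\<dots> = n ^ card D"
      using finP by (subst card_PiE) (auto simp: D_def)
    finally show ?thesis using cc H by (simp add: D_def deleted_def)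
  qed
qed

section \<open>The action of the partition algebra on functions of words\<close>

lemma compatible_Un_verticals:
  "compatible (P \<union> verticals K S) f h \<longleftrightarrow> compatible P f h \<and> (\<forall>m\<in>{1..K} - S. f m = h m)"
  by (auto simp: compatible_def constant_on_blocks_def verticals_def ball_Un)

lemma compatible_block:
  "x \<in> B \<Longrightarrow> compatible {B} f h \<longleftrightarrow> (\<forall>y\<in>B. case_vertex f h y = case_vertex f h x)"
  unfolding compatible_def constant_on_blocks_def by simp metis

lemma vertices_Un: "vertices (S \<union> T) = vertices S \<union> vertices T"
  by (auto simp: vertices_def)

lemma Un_verticals_in_diagrams:
  assumes P: "partition_on (vertices S) P" and S: "S \<subseteq> {1..K}"
  shows "P \<union> verticals K S \<in> diagrams K"
proof -
  have "vertices {1..K} = vertices S \<union> vertices ({1..K} - S)"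
    using S by (simp add: vertices_Un[symmetric] Un_absorb1)
  moreover have U: "\<Union>(verticals K S) = vertices ({1..K} - S)"
    by (auto simp: verticals_def vertices_def)
  moreover have "\<Union>P = vertices S" using P by (auto dest: partition_onD1)
  moreover have "disjoint (P \<union> verticals K S)"
  proof (rule disjoint_union)
    show "disjoint P" using P by (rule partition_onD2)
    show "disjoint (verticals K S)" by (auto simp: verticals_def disjoint_def)
    show "\<Union>P \<inter> \<Union>(verticals K S) = {}"
      unfolding U \<open>\<Union>P = vertices S\<close> by (auto simp: vertices_def)
  qed
  moreover have "{} \<notin> P \<union> verticals K S"
    using partition_onD3[OF P] by (auto simp: verticals_def)
  ultimately show ?thesis by (simp add: diagrams_def partition_on_def)
qed

lemma id_diag_in_diagrams [simp]: "id_diag K \<in> diagrams K"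
  using Un_verticals_in_diagrams[of "{}" "{}" K]
  by (simp add: id_diag_def vertices_def partition_on_def)

lemma s_diag_in_diagrams [simp]: "1 \<le> i \<Longrightarrow> i < K \<Longrightarrow> s_diag K i \<in> diagrams K"
  unfolding s_diag_def
  by (rule Un_verticals_in_diagrams)
     (auto simp: partition_on_def disjoint_def vertices_def)

lemma p_diag_in_diagrams [simp]: "1 \<le> j \<Longrightarrow> j \<le> K \<Longrightarrow> p_diag K j \<in> diagrams K"
  unfolding p_diag_def
  by (rule Un_verticals_in_diagrams)
     (auto simp: partition_on_def disjoint_def vertices_def)

lemma p_half_diag_in_diagrams [simp]: "1 \<le> i \<Longrightarrow> i < K \<Longrightarrow> p_half_diag K i \<in> diagrams K"
  unfolding p_half_diag_def
  by (rule Un_verticals_in_diagrams)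
     (auto simp: partition_on_def disjoint_def vertices_def)

lemma b_diag_in_diagrams: "S \<noteq> {} \<Longrightarrow> S \<subseteq> {1..K} \<Longrightarrow> b_diag K S \<in> diagrams K"
  unfolding b_diag_def
  by (rule Un_verticals_in_diagrams) (auto simp: partition_on_def vertices_def)

lemma d_diag_in_diagrams:
  "I \<subseteq> vertices S \<Longrightarrow> I \<noteq> {} \<Longrightarrow> I \<noteq> vertices S \<Longrightarrow> S \<subseteq> {1..K} \<Longrightarrow> d_diag K I S \<in> diagrams K"
  unfolding d_diag_def
  by (rule Un_verticals_in_diagrams) (auto simp: partition_on_def disjoint_def)

lemma words_eqI:
  assumes "f \<in> words n K" "h \<in> words n K" "\<And>m. m \<in> {1..K} \<Longrightarrow> f m = h m"
  shows "f = h"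
  using assms unfolding words_def by (rule PiE_ext)

lemma fun_upd_in_words: "f \<in> words n K \<Longrightarrow> j \<in> {1..K} \<Longrightarrow> b < n \<Longrightarrow> f(j := b) \<in> words n K"
  by (auto simp: words_def PiE_def extensional_def)

lemma compatible_id_diag:
  assumes "f \<in> words n K" "h \<in> words n K"
  shows "compatible (id_diag K) f h \<longleftrightarrow> h = f"
proof -
  have "compatible (id_diag K) f h \<longleftrightarrow> (\<forall>m\<in>{1..K}. f m = h m)"
    using compatible_Un_verticals[of "{}" K "{}"]
    by (simp add: id_diag_def compatible_def constant_on_blocks_def)
  then show ?thesis using words_eqI[OF assms] by auto
qed

lemma compatible_s_diag:
  assumes "f \<in> words n K" "h \<in> words n K" "1 \<le> i" "i < K"
  shows "compatible (s_diag K i) f h \<longleftrightarrow> h = f(i := f (i + 1), i + 1 := f i)"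
proof -
  let ?g = "f(i := f (i + 1), i + 1 := f i)"
  have g: "?g \<in> words n K"
    using assms by (intro fun_upd_in_words) (auto simp: wordsD)
  have split: "(\<forall>m\<in>{1..K}. Q m) \<longleftrightarrow> Q i \<and> Q (i + 1) \<and> (\<forall>m\<in>{1..K} - {i, i + 1}. Q m)" for Q
    using assms(3,4) by auto
  have "compatible {{Top i, Bot (i + 1)}, {Top (i + 1), Bot i}} f h \<longleftrightarrow> h i = f (i + 1) \<and> h (i + 1) = f i"
    unfolding compatible_def constant_on_blocks_def by simp metis
  then have "compatible (s_diag K i) f h \<longleftrightarrow> h i = ?g i \<and> h (i + 1) = ?g (i + 1) \<and> (\<forall>m\<in>{1..K} - {i, i + 1}. f m = h m)"
    unfolding s_diag_def compatible_Un_verticals by simp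
  also have "\<dots> \<longleftrightarrow> (\<forall>m\<in>{1..K}. h m = ?g m)"
    unfolding split[of "\<lambda>m. h m = ?g m"] by (intro conj_cong ball_cong) auto
  also have "\<dots> \<longleftrightarrow> h = ?g"
    using words_eqI[OF assms(2) g] by metis
  finally show ?thesis .
qed

lemma compatible_p_half_diag:
  assumes "f \<in> words n K" "h \<in> words n K" "1 \<le> i" "i < K"
  shows "compatible (p_half_diag K i) f h \<longleftrightarrow> h = f \<and> f i = f (i + 1)"
proof -
  have split: "(\<forall>m\<in>{1..K}. Q m) \<longleftrightarrow> Q i \<and> Q (i + 1) \<and> (\<forall>m\<in>{1..K} - {i, i + 1}. Q m)" for Q
    using assms(3,4) by auto
  have "compatible (p_half_diag K i) f h \<longleftrightarrow>
    h i = f i \<and> h (i + 1) = f i \<and> f (i + 1) = f i \<and> (\<forall>m\<in>{1..K} - {i, i + 1}. f m = h m)"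
    unfolding p_half_diag_def compatible_Un_verticals by (simp add: compatible_block[of "Top i"] conj_ac)
  also have "\<dots> \<longleftrightarrow> (\<forall>m\<in>{1..K}. h m = f m) \<and> f i = f (i + 1)"
    unfolding split[of "\<lambda>m. h m = f m"] by metis
  also have "\<dots> \<longleftrightarrow> h = f \<and> f i = f (i + 1)"
    using words_eqI[OF assms(2,1)] by metis
  finally show ?thesis .
qed

lemma compatible_p_diag:
  assumes "f \<in> words n K" "h \<in> words n K" "1 \<le> j" "j \<le> K"
  shows "compatible (p_diag K j) f h \<longleftrightarrow> h = f(j := h j)"
proof -
  have g: "f(j := h j) \<in> words n K"
    using assms by (intro fun_upd_in_words) (auto simp: wordsD)
  have "compatible (p_diag K j) f h \<longleftrightarrow> (\<forall>m\<in>{1..K} - {j}. f m = h m)"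
    unfolding p_diag_def compatible_Un_verticals
    by (auto simp: compatible_def constant_on_blocks_def)
  also have "\<dots> \<longleftrightarrow> (\<forall>m\<in>{1..K}. h m = (f(j := h j)) m)"
    by auto
  also have "\<dots> \<longleftrightarrow> h = f(j := h j)"
    using words_eqI[OF assms(2) g] by metis
  finally show ?thesis .
qed

text \<open>The matrix entry of the linear combination of diagrams with coefficients \<open>c\<close>.\<close>

definition entry :: "nat \<Rightarrow> (diagram \<Rightarrow> complex) \<Rightarrow> (nat \<Rightarrow> nat) \<Rightarrow> (nat \<Rightarrow> nat) \<Rightarrow> complex" where
  "entry K c f h = (\<Sum>\<rho>\<in>diagrams K. c \<rho> * of_bool (compatible \<rho> f h))"

lemma of_nat_card_filter:
  "finite A \<Longrightarrow> of_nat (card {x \<in> A. P x}) = (\<Sum>x\<in>A. of_bool (P x) :: complex)"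
  by (simp add: of_bool_def sum.If_cases Int_def)

lemma sum_single_eq:
  assumes "finite A"
  shows "(\<Sum>h\<in>A. of_bool (h = a) * \<phi> h) = (if a \<in> A then \<phi> a else (0::complex))"
proof -
  have "(\<Sum>h\<in>A. of_bool (h = a) * \<phi> h) = (\<Sum>h\<in>A. if h = a then \<phi> h else 0)"
    by (rule sum.cong) auto
  then show ?thesis using assms by simp
qed

text \<open>The coefficients are first mapped to the complex numbers by a ring homomorphism sending the
  parameter to the number \<open>n\<close> of letters. For $\mathbb{Z}[z]$ this is evaluation at $n$, so
  that the elements over $\mathbb{Z}[z]$ act directly, before being specialized.\<close>

locale tensor_action = partition_algebra K \<delta> for K :: nat and \<delta> :: "'a :: comm_ring_1" +
  fixes n :: nat and ev :: "'a \<Rightarrow> complex"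
  assumes ev_add: "ev (a + b) = ev a + ev b"
    and ev_mult: "ev (a * b) = ev a * ev b"
    and ev_one [simp]: "ev 1 = 1"
    and ev_delta: "ev \<delta> = of_nat n"
begin

lemma ev_zero [simp]: "ev 0 = 0"
  using ev_add[of 0 0] by simp

lemma ev_uminus: "ev (- a) = - ev a"
  using ev_add[of a "- a"] by (simp add: eq_neg_iff_add_eq_0 add.commute)

lemma ev_power: "ev (a ^ m) = ev a ^ m"
  by (induction m) (simp_all add: ev_mult)

lemma ev_sum: "ev (\<Sum>i\<in>A. g i) = (\<Sum>i\<in>A. ev (g i))"
  by (induction A rule: infinite_finite_induct) (simp_all add: ev_add)

definition mat :: "(diagram \<Rightarrow>\<^sub>0 'a) \<Rightarrow> (nat \<Rightarrow> nat) \<Rightarrow> (nat \<Rightarrow> nat) \<Rightarrow> complex" where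
  "mat x = entry K (\<lambda>\<rho>. ev (Poly_Mapping.lookup x \<rho>))"

definition act :: "(diagram \<Rightarrow>\<^sub>0 'a) \<Rightarrow> ((nat \<Rightarrow> nat) \<Rightarrow> complex) \<Rightarrow> (nat \<Rightarrow> nat) \<Rightarrow> complex" where
  "act x \<phi> f = (\<Sum>h\<in>words n K. mat x f h * \<phi> h)"

lemma act_zero: "act 0 \<phi> f = 0"
  by (simp add: act_def mat_def entry_def)

lemma act_add: "act (x + y) \<phi> f = act x \<phi> f + act y \<phi> f"
  by (simp add: act_def mat_def entry_def lookup_add ev_add distrib_right sum.distrib)

lemma act_uminus: "act (- x) \<phi> f = - act x \<phi> f"
  by (simp add: act_def mat_def entry_def ev_uminus sum_negf)

lemma act_diff: "act (x - y) \<phi> f = act x \<phi> f - act y \<phi> f"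
  using act_add[of x "- y"] by (simp add: act_uminus)

lemma mat_single:
  assumes "\<rho> \<in> diagrams K"
  shows "mat (Poly_Mapping.single \<rho> a) f h = ev a * of_bool (compatible \<rho> f h)"
proof -
  have "mat (Poly_Mapping.single \<rho> a) f h =
      (\<Sum>\<tau>\<in>diagrams K. if \<tau> = \<rho> then ev a * of_bool (compatible \<rho> f h) else 0)"
    unfolding mat_def entry_def by (rule sum.cong) (auto simp: lookup_single when_def)
  then show ?thesis using assms by simp
qed

lemma mat_times:
  assumes f: "f \<in> words n K" and g: "g \<in> words n K"
  shows "mat (x \<star> y) f g = (\<Sum>h\<in>words n K. mat x f h * mat y h g)"
proof -
  let ?l = Poly_Mapping.lookup and ?D = "diagrams K"
  let ?c = "\<lambda>\<rho> \<tau>. \<delta> ^ deleted \<rho> \<tau> * ?l x \<rho> * ?l y \<tau>"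
  have "mat (x \<star> y) f g = (\<Sum>\<kappa>\<in>?D. \<Sum>\<rho>\<in>?D. \<Sum>\<tau>\<in>?D.
      if compose \<rho> \<tau> = \<kappa> then ev (?c \<rho> \<tau>) * of_bool (compatible \<kappa> f g) else 0)"
    unfolding mat_def entry_def times_def lookup_sum ev_sum sum_distrib_right
    by (intro sum.cong refl) (auto simp: lookup_single when_def)
  also have "\<dots> = (\<Sum>\<rho>\<in>?D. \<Sum>\<kappa>\<in>?D. \<Sum>\<tau>\<in>?D.
      if compose \<rho> \<tau> = \<kappa> then ev (?c \<rho> \<tau>) * of_bool (compatible \<kappa> f g) else 0)"
    by (rule sum.swap)
  also have "\<dots> = (\<Sum>\<rho>\<in>?D. \<Sum>\<tau>\<in>?D. \<Sum>\<kappa>\<in>?D.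
      if compose \<rho> \<tau> = \<kappa> then ev (?c \<rho> \<tau>) * of_bool (compatible \<kappa> f g) else 0)"
    by (intro sum.cong refl sum.swap)
  also have "\<dots> = (\<Sum>\<rho>\<in>?D. \<Sum>\<tau>\<in>?D. ev (?c \<rho> \<tau>) * of_bool (compatible (compose \<rho> \<tau>) f g))"
    by (intro sum.cong refl) (simp add: compose_in_diagrams)
  also have "\<dots> = (\<Sum>\<rho>\<in>?D. \<Sum>\<tau>\<in>?D. \<Sum>h\<in>words n K.
      (ev (?l x \<rho>) * of_bool (compatible \<rho> f h)) * (ev (?l y \<tau>) * of_bool (compatible \<tau> h g)))"
  proof (intro sum.cong refl)
    fix \<rho> \<tau> assume D: "\<rho> \<in> ?D" "\<tau> \<in> ?D"
    have "ev (?c \<rho> \<tau>) * of_bool (compatible (compose \<rho> \<tau>) f g) =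
        ev (?l x \<rho>) * ev (?l y \<tau>) *
          of_nat (card {h \<in> words n K. compatible \<rho> f h \<and> compatible \<tau> h g})"
      by (simp add: card_middle_words[OF D f g] ev_mult ev_power ev_delta)
    also have "\<dots> = (\<Sum>h\<in>words n K.
      (ev (?l x \<rho>) * of_bool (compatible \<rho> f h)) * (ev (?l y \<tau>) * of_bool (compatible \<tau> h g)))"
      unfolding of_nat_card_filter[OF finite_words] sum_distrib_left
      by (intro sum.cong refl) (simp add: of_bool_conj mult_ac)
    finally show "ev (?c \<rho> \<tau>) * of_bool (compatible (compose \<rho> \<tau>) f g) = \<dots>" .
  qed
  also have "\<dots> = (\<Sum>\<rho>\<in>?D. \<Sum>h\<in>words n K. \<Sum>\<tau>\<in>?D.
      (ev (?l x \<rho>) * of_bool (compatible \<rho> f h)) * (ev (?l y \<tau>) * of_bool (compatible \<tau> h g)))"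
    by (intro sum.cong refl sum.swap)
  also have "\<dots> = (\<Sum>h\<in>words n K. \<Sum>\<rho>\<in>?D. \<Sum>\<tau>\<in>?D.
      (ev (?l x \<rho>) * of_bool (compatible \<rho> f h)) * (ev (?l y \<tau>) * of_bool (compatible \<tau> h g)))"
    by (rule sum.swap)
  also have "\<dots> = (\<Sum>h\<in>words n K. mat x f h * mat y h g)"
    by (simp only: mat_def entry_def sum_product)
  finally show ?thesis .
qed

text \<open>Diagrams act on functions of words rather than on words. Then the factors of a product are
  evaluated from the left: the first factor moves the argument of the function given by the rest.\<close>

lemma act_times:
  assumes f: "f \<in> words n K"
  shows "act (x \<star> y) \<phi> f = act x (act y \<phi>) f"
proof -
  have "act (x \<star> y) \<phi> f = (\<Sum>g\<in>words n K. \<Sum>h\<in>words n K. mat x f h * (mat y h g * \<phi> g))"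
    unfolding act_def by (intro sum.cong refl) (simp add: mat_times f sum_distrib_right mult.assoc)
  also have "\<dots> = (\<Sum>h\<in>words n K. \<Sum>g\<in>words n K. mat x f h * (mat y h g * \<phi> g))"
    by (rule sum.swap)
  finally show ?thesis by (simp add: act_def sum_distrib_left)
qed

lemma act_id_elt: "f \<in> words n K \<Longrightarrow> act id_elt \<phi> f = \<phi> f"
  by (simp add: act_def id_elt_def mat_single compatible_id_diag sum_single_eq cong: sum.cong)

lemma act_s:
  assumes f: "f \<in> words n K" and i: "1 \<le> i" "i < K"
  shows "act (s i) \<phi> f = \<phi> (f(i := f (i + 1), i + 1 := f i))"
proof -
  have "f(i := f (i + 1), i + 1 := f i) \<in> words n K"
    using f i by (intro fun_upd_in_words) (auto simp: wordsD)
  then show ?thesis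
    using f i
    by (simp add: act_def s_def mat_single compatible_s_diag sum_single_eq del: fun_upd_apply cong: sum.cong)
qed

lemma act_p_half:
  assumes f: "f \<in> words n K" and i: "1 \<le> i" "i < K"
  shows "act (p_half i) \<phi> f = (if f i = f (i + 1) then \<phi> f else 0)"
  using f i
  by (simp add: act_def p_half_def mat_single compatible_p_half_diag sum_single_eq cong: sum.cong)

lemma act_p:
  assumes f: "f \<in> words n K" and j: "1 \<le> j" "j \<le> K"
  shows "act (p j) \<phi> f = (\<Sum>b<n. \<phi> (f(j := b)))"
proof -
  have "act (p j) \<phi> f = (\<Sum>h\<in>words n K. of_bool (h = f(j := h j)) * \<phi> h)"
    unfolding act_def using f j
    by (intro sum.cong refl) (simp add: p_def mat_single compatible_p_diag)
  also have "\<dots> = (\<Sum>h\<in>(\<lambda>b. f(j := b)) ` {..<n}. \<phi> h)"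
  proof (rule sum.mono_neutral_cong_right)
    show "(\<lambda>b. f(j := b)) ` {..<n} \<subseteq> words n K"
      using f j by (auto intro: fun_upd_in_words)
    show "\<forall>h\<in>words n K - (\<lambda>b. f(j := b)) ` {..<n}. of_bool (h = f(j := h j)) * \<phi> h = 0"
    proof
      fix h assume h: "h \<in> words n K - (\<lambda>b. f(j := b)) ` {..<n}"
      then have "h j < n" using j by (auto simp: wordsD)
      then have "h \<noteq> f(j := h j)" using h by blast
      then show "of_bool (h = f(j := h j)) * \<phi> h = 0" by simp
    qed
  qed auto
  also have "\<dots> = (\<Sum>b<n. \<phi> (f(j := b)))"
    by (subst sum.reindex) (auto simp: inj_on_def fun_upd_eqD)
  finally show ?thesis .
qed

lemma act_indicator:
  assumes "h \<in> words n K"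
  shows "act x (\<lambda>g. of_bool (g = h)) f = mat x f h"
  using assms sum_single_eq[of "words n K" h "mat x f"] by (simp add: act_def mult.commute)

lemma lookup_times_outside: "\<rho> \<notin> diagrams K \<Longrightarrow> Poly_Mapping.lookup (x \<star> y) \<rho> = 0"
  unfolding times_def lookup_sum
  by (intro sum.neutral ballI) (auto simp: lookup_single when_def compose_in_diagrams)

end

section \<open>The recursively defined elements as operators\<close>

text \<open>The diagonal action of the transposition of the letters \<open>a\<close> and \<open>b\<close> on the
  first \<open>k\<close> tensor factors.\<close>

definition swap_labels :: "nat \<Rightarrow> nat \<Rightarrow> nat \<Rightarrow> (nat \<Rightarrow> nat) \<Rightarrow> nat \<Rightarrow> nat" where
  "swap_labels k a b f = (\<lambda>j. if j \<in> {1..k} then transpose a b (f j) else f j)"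

lemma swap_labels_same [simp]: "swap_labels k a a f = f"
  by (simp add: swap_labels_def fun_eq_iff)

lemma swap_labels_0 [simp]: "swap_labels 0 a b f = f"
  by (simp add: swap_labels_def)

lemma swap_labels_commute: "swap_labels k a b f = swap_labels k b a f"
  by (auto simp: swap_labels_def transpose_def fun_eq_iff)

lemma swap_labels_in_words:
  assumes "f \<in> words n K" "a < n" "b < n" "k \<le> K"
  shows "swap_labels k a b f \<in> words n K"
  using assms by (auto simp: swap_labels_def words_def PiE_def extensional_def Pi_def transpose_def)

text \<open>The recursions for $L$ involve two adjacent letters, those for $\sigma$ three. Writing every
  word as \<open>put2 i g x y\<close> or \<open>put3 j g x y z\<close> keeps these letters explicit while
  the generators permute and compare them, so that simplification can follow a product of generators
  step by step.\<close>

definition put2 :: "nat \<Rightarrow> (nat \<Rightarrow> nat) \<Rightarrow> nat \<Rightarrow> nat \<Rightarrow> nat \<Rightarrow> nat" where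
  "put2 i g x y = g(i := x, Suc i := y)"

definition put3 :: "nat \<Rightarrow> (nat \<Rightarrow> nat) \<Rightarrow> nat \<Rightarrow> nat \<Rightarrow> nat \<Rightarrow> nat \<Rightarrow> nat" where
  "put3 j g x y z = g(j := x, Suc j := y, Suc (Suc j) := z)"

lemma put2_self: "put2 i f (f i) (f (Suc i)) = f"
  by (simp add: put2_def)

lemma put3_self: "put3 j f (f j) (f (Suc j)) (f (Suc (Suc j))) = f"
  by (simp add: put3_def)

lemma swap_labels_put2:
  "swap_labels i a b (put2 (Suc i) g x y) = put2 (Suc i) (swap_labels i a b g) x y"
  "swap_labels (Suc i) a b (put2 (Suc i) g x y) = put2 (Suc i) (swap_labels i a b g) (transpose a b x) y"
  "swap_labels (Suc (Suc i)) a b (put2 (Suc i) g x y) = put2 (Suc i) (swap_labels i a b g) (transpose a b x) (transpose a b y)"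
  by (auto simp: swap_labels_def put2_def fun_eq_iff)

lemma swap_labels_put3:
  "swap_labels j a b (put3 (Suc j) g x y z) = put3 (Suc j) (swap_labels j a b g) x y z"
  "swap_labels (Suc j) a b (put3 (Suc j) g x y z) = put3 (Suc j) (swap_labels j a b g) (transpose a b x) y z"
  "swap_labels (Suc (Suc j)) a b (put3 (Suc j) g x y z) = put3 (Suc j) (swap_labels j a b g) (transpose a b x) (transpose a b y) z"
  "swap_labels (Suc (Suc (Suc j))) a b (put3 (Suc j) g x y z) =
    put3 (Suc j) (swap_labels j a b g) (transpose a b x) (transpose a b y) (transpose a b z)"
  by (auto simp: swap_labels_def put3_def fun_eq_iff)

lemma put2_in_words:
  "g \<in> words n K \<Longrightarrow> x < n \<Longrightarrow> y < n \<Longrightarrow> 1 \<le> i \<Longrightarrow> i < K \<Longrightarrow> put2 i g x y \<in> words n K"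
  unfolding put2_def by (intro fun_upd_in_words) auto

lemma put3_in_words:
  "g \<in> words n K \<Longrightarrow> x < n \<Longrightarrow> y < n \<Longrightarrow> z < n \<Longrightarrow> 1 \<le> j \<Longrightarrow> Suc j < K \<Longrightarrow> put3 j g x y z \<in> words n K"
  unfolding put3_def by (intro fun_upd_in_words) auto

context tensor_action
begin

lemma act_put2:
  assumes "g \<in> words n K" "x < n" "y < n" "1 \<le> i" "i < K"
  shows "act (s i) \<psi> (put2 i g x y) = \<psi> (put2 i g y x)"
    and "act (p_half i) \<psi> (put2 i g x y) = (if x = y then \<psi> (put2 i g x y) else 0)"
    and "act (p i) \<psi> (put2 i g x y) = (\<Sum>c<n. \<psi> (put2 i g c y))"
    and "act (p (Suc i)) \<psi> (put2 i g x y) = (\<Sum>c<n. \<psi> (put2 i g x c))"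
proof -
  note w = put2_in_words[OF assms]
  have e: "(put2 i g x y)(i := (put2 i g x y) (i + 1), i + 1 := (put2 i g x y) i) = put2 i g y x"
    "(put2 i g x y)(i := c) = put2 i g c y" "(put2 i g x y)(Suc i := c) = put2 i g x c" for c
    by (auto simp: put2_def fun_eq_iff)
  show "act (s i) \<psi> (put2 i g x y) = \<psi> (put2 i g y x)"
    using act_s[OF w assms(4,5), of \<psi>] by (simp only: e(1))
  show "act (p_half i) \<psi> (put2 i g x y) = (if x = y then \<psi> (put2 i g x y) else 0)"
    using act_p_half[OF w assms(4,5), of \<psi>] by (simp add: put2_def)
  show "act (p i) \<psi> (put2 i g x y) = (\<Sum>c<n. \<psi> (put2 i g c y))"
    using act_p[OF w, of i \<psi>] assms by (simp add: e)
  show "act (p (Suc i)) \<psi> (put2 i g x y) = (\<Sum>c<n. \<psi> (put2 i g x c))"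
    using act_p[OF w, of "Suc i" \<psi>] assms by (simp add: e)
qed

lemma act_put3:
  assumes "g \<in> words n K" "x < n" "y < n" "z < n" "1 \<le> j" "Suc j < K"
  shows "act (s j) \<psi> (put3 j g x y z) = \<psi> (put3 j g y x z)"
    and "act (s (Suc j)) \<psi> (put3 j g x y z) = \<psi> (put3 j g x z y)"
    and "act (p_half j) \<psi> (put3 j g x y z) = (if x = y then \<psi> (put3 j g x y z) else 0)"
    and "act (p_half (Suc j)) \<psi> (put3 j g x y z) = (if y = z then \<psi> (put3 j g x y z) else 0)"
    and "act (p (Suc j)) \<psi> (put3 j g x y z) = (\<Sum>c<n. \<psi> (put3 j g x c z))"
proof -
  note w = put3_in_words[OF assms]
  let ?q = "put3 j g x y z"
  have e: "?q(j := ?q (j + 1), j + 1 := ?q j) = put3 j g y x z"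
    "?q(Suc j := ?q (Suc j + 1), Suc j + 1 := ?q (Suc j)) = put3 j g x z y"
    "?q(Suc j := c) = put3 j g x c z" for c
    by (auto simp: put3_def fun_eq_iff)
  have j: "1 \<le> j" "j < K" "1 \<le> Suc j" "Suc j < K" using assms by auto
  show "act (s j) \<psi> (put3 j g x y z) = \<psi> (put3 j g y x z)"
    using act_s[OF w j(1,2), of \<psi>] by (simp only: e(1))
  show "act (s (Suc j)) \<psi> (put3 j g x y z) = \<psi> (put3 j g x z y)"
    using act_s[OF w j(3,4), of \<psi>] by (simp only: e(2))
  show "act (p_half j) \<psi> (put3 j g x y z) = (if x = y then \<psi> (put3 j g x y z) else 0)"
    using act_p_half[OF w j(1,2), of \<psi>] by (simp add: put3_def)
  show "act (p_half (Suc j)) \<psi> (put3 j g x y z) = (if y = z then \<psi> (put3 j g x y z) else 0)"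
    using act_p_half[OF w j(3,4), of \<psi>] by (simp add: put3_def)
  show "act (p (Suc j)) \<psi> (put3 j g x y z) = (\<Sum>c<n. \<psi> (put3 j g x c z))"
    using act_p[OF w, of "Suc j" \<psi>] j by (simp add: e)
qed

declare L.simps [simp del] \<sigma>.simps [simp del] L_half.simps [simp del] \<sigma>_half.simps [simp del]

definition acts_as_L :: "nat \<Rightarrow> bool" where
  "acts_as_L i \<longleftrightarrow> (\<forall>\<phi>. \<forall>f\<in>words n K. act (L i) \<phi> f = (\<Sum>b<n. \<phi> (swap_labels i b (f i) f)))"

definition acts_as_\<sigma> :: "nat \<Rightarrow> bool" where
  "acts_as_\<sigma> i \<longleftrightarrow>
    (\<forall>\<phi>. \<forall>f\<in>words n K. act (\<sigma> (Suc i)) \<phi> f = \<phi> (swap_labels (Suc i) (f i) (f (Suc i)) f))"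

definition acts_as_\<sigma>_half :: "nat \<Rightarrow> bool" where
  "acts_as_\<sigma>_half i \<longleftrightarrow>
    (\<forall>\<phi>. \<forall>f\<in>words n K. act (\<sigma>_half i) \<phi> f = \<phi> (swap_labels (i - 1) (f i) (f (Suc i)) f))"

definition acts_as_L_half :: "nat \<Rightarrow> bool" where
  "acts_as_L_half i \<longleftrightarrow>
    (\<forall>\<phi>. \<forall>f\<in>words n K. act (L_half i) \<phi> f = of_nat n * \<phi> f - (\<Sum>b<n. \<phi> (swap_labels i b (f (Suc i)) f)))"

text \<open>With $x = f_i$ and $y = f_{i+1}$, the summand $s_i L_i s_i$ is the sum over all letters $b$ of the
  exchanges of $b$ and $y$, except that it leaves position $i$ alone. This is wrong only if
  $b = x \neq y$, or if $x = y$. In the first case $-s_i L_i p_{i+1/2}$ removes the wrong value and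
  $\sigma_{i+1}$ adds the right one. If $x = y$, then $-p_{i+1/2} L_i s_i$ removes the sum altogether,
  $p_{i+1/2} L_i p_{i+1} p_{i+1/2}$ supplies the right one, and the other two summands cancel.\<close>

lemma acts_as_L_step:
  assumes L: "acts_as_L (Suc i)" and \<sigma>: "acts_as_\<sigma> (Suc i)" and i: "Suc i < K"
  shows "acts_as_L (Suc (Suc i))"
  unfolding acts_as_L_def
proof (intro allI ballI)
  fix \<phi> f assume f: "f \<in> words n K"
  define x y where xy: "x = f (Suc i)" "y = f (Suc (Suc i))"
  have lt: "x < n" "y < n" using f i by (auto simp: xy wordsD)
  note act2 = act_put2[where i = "Suc i"]
  have aL: "act (L (Suc i)) \<psi> (put2 (Suc i) g u v) = (\<Sum>b<n. \<psi> (put2 (Suc i) (swap_labels i b u g) b v))"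
    if "g \<in> words n K" "u < n" "v < n" for \<psi> g u v
  proof -
    have "put2 (Suc i) g u v (Suc i) = u" by (simp add: put2_def)
    then show ?thesis
      using L put2_in_words[OF that, of "Suc i"] i by (simp add: acts_as_L_def swap_labels_put2)
  qed
  have a\<sigma>: "act (\<sigma> (Suc (Suc i))) \<phi> (put2 (Suc i) f x y) = \<phi> (put2 (Suc i) (swap_labels i x y f) y x)"
  proof -
    have "put2 (Suc i) f x y (Suc i) = x" "put2 (Suc i) f x y (Suc (Suc i)) = y"
      by (simp_all add: put2_def)
    then show ?thesis
      using \<sigma> put2_in_words[OF f lt, of "Suc i"] i by (simp add: acts_as_\<sigma>_def swap_labels_put2)
  qed
  have w: "put2 (Suc i) f x y \<in> words n K" "put2 (Suc i) f y x \<in> words n K"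
    using f lt i by (auto intro: put2_in_words)
  note rec = L.simps(2)[of "Suc i", simplified]
  let ?G = "\<lambda>b. \<phi> (put2 (Suc i) (swap_labels i b y f) x b)"
    and ?F = "\<lambda>b. \<phi> (put2 (Suc i) (swap_labels i b y f) (transpose b y x) b)"
  \<comment> \<open>The two sums differ only in the summand \<open>b = x\<close>.\<close>
  have off: "(\<Sum>b<n. ?F b) = (\<Sum>b<n. ?G b) - ?G x + \<phi> (put2 (Suc i) (swap_labels i x y f) y x)" if "x \<noteq> y"
  proof -
    have "(\<Sum>b<n. ?F b) = (\<Sum>b<n. ?G b + (if b = x then ?F x - ?G x else 0))"
      using that by (intro sum.cong) (auto simp: transpose_def)
    then show ?thesis using lt by (simp add: sum.distrib)
  qed
  have "act (L (Suc (Suc i))) \<phi> (put2 (Suc i) f x y) =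
      (\<Sum>b<n. \<phi> (swap_labels (Suc (Suc i)) b y (put2 (Suc i) f x y)))"
    using f lt i off
    by (simp add: rec w act_add act_diff act_uminus act_times act2 aL a\<sigma> swap_labels_put2 swap_labels_in_words put2_in_words
        cong: sum.cong_simp if_cong)
  then show "act (L (Suc (Suc i))) \<phi> f = (\<Sum>b<n. \<phi> (swap_labels (Suc (Suc i)) b (f (Suc (Suc i))) f))"
    using put2_self[of "Suc i" f] by (simp only: xy)
qed

text \<open>With $x, y, z = f_{i-1}, f_i, f_{i+1}$, the leading term exchanges $y$ and $z$ everywhere except at
  position $i - 1$, where it leaves $x$ in place. This can only be wrong if $x = y$ or $x = z$; the two
  positive correction terms insert the right value in these cases and the two negative ones remove the
  wrong value.\<close>

lemma acts_as_\<sigma>_step: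
  assumes L: "acts_as_L (Suc j)" and \<sigma>: "acts_as_\<sigma> (Suc j)" and j: "Suc (Suc j) < K"
  shows "acts_as_\<sigma> (Suc (Suc j))"
  unfolding acts_as_\<sigma>_def
proof (intro allI ballI)
  fix \<phi> f assume f: "f \<in> words n K"
  define x y z where xyz: "x = f (Suc j)" "y = f (Suc (Suc j))" "z = f (Suc (Suc (Suc j)))"
  have lt: "x < n" "y < n" "z < n" using f j by (auto simp: xyz wordsD)
  note act3 = act_put3[where j = "Suc j"]
  have aL: "act (L (Suc j)) \<psi> (put3 (Suc j) g u v w) = (\<Sum>b<n. \<psi> (put3 (Suc j) (swap_labels j b u g) b v w))"
    and a\<sigma>: "act (\<sigma> (Suc (Suc j))) \<psi> (put3 (Suc j) g u v w) = \<psi> (put3 (Suc j) (swap_labels j u v g) v u w)"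
    if "g \<in> words n K" "u < n" "v < n" "w < n" for \<psi> g u v w
  proof -
    have "put3 (Suc j) g u v w (Suc j) = u" "put3 (Suc j) g u v w (Suc (Suc j)) = v"
      by (simp_all add: put3_def)
    then show "act (L (Suc j)) \<psi> (put3 (Suc j) g u v w) = (\<Sum>b<n. \<psi> (put3 (Suc j) (swap_labels j b u g) b v w))"
      and "act (\<sigma> (Suc (Suc j))) \<psi> (put3 (Suc j) g u v w) = \<psi> (put3 (Suc j) (swap_labels j u v g) v u w)"
      using L \<sigma> put3_in_words[OF that, of "Suc j"] j
      by (simp_all add: acts_as_L_def acts_as_\<sigma>_def swap_labels_put3)
  qed
  note rec = \<sigma>.simps(2)[of "Suc (Suc j)", simplified]
  have "act (\<sigma> (Suc (Suc (Suc j)))) \<phi> (put3 (Suc j) f x y z) =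
      \<phi> (swap_labels (Suc (Suc (Suc j))) y z (put3 (Suc j) f x y z))"
    using f lt j
    by (simp add: rec act_add act_diff act_uminus act_times act3 aL a\<sigma> swap_labels_put3 swap_labels_in_words put3_in_words
        transpose_def swap_labels_commute cong: sum.cong_simp if_cong)
  then show "act (\<sigma> (Suc (Suc (Suc j)))) \<phi> f =
      \<phi> (swap_labels (Suc (Suc (Suc j))) (f (Suc (Suc j))) (f (Suc (Suc (Suc j)))) f)"
    using put3_self[of "Suc j" f] by (simp only: xyz)
qed

lemma acts_as_L_and_\<sigma>:
  "Suc i \<le> K \<Longrightarrow> acts_as_L (Suc i) \<and> (Suc i < K \<longrightarrow> acts_as_\<sigma> (Suc i))"
proof (induction i)
  case 0
  have L: "acts_as_L (Suc 0)"
    unfolding acts_as_L_def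
  proof (intro allI ballI)
    fix \<phi> f assume f: "f \<in> words n K"
    have "swap_labels (Suc 0) b (f (Suc 0)) f = f(Suc 0 := b)" for b
      by (auto simp: swap_labels_def fun_eq_iff)
    then show "act (L (Suc 0)) \<phi> f = (\<Sum>b<n. \<phi> (swap_labels (Suc 0) b (f (Suc 0)) f))"
      using f 0 by (simp add: L.simps act_p)
  qed
  have "acts_as_\<sigma> (Suc 0)" if "Suc 0 < K"
    unfolding acts_as_\<sigma>_def
  proof (intro allI ballI)
    fix \<phi> f assume f: "f \<in> words n K"
    have "swap_labels (Suc (Suc 0)) (f (Suc 0)) (f (Suc (Suc 0))) f = f(Suc 0 := f (Suc 0 + 1), Suc 0 + 1 := f (Suc 0))"
      by (auto simp: swap_labels_def fun_eq_iff transpose_def)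
    then show "act (\<sigma> (Suc (Suc 0))) \<phi> f = \<phi> (swap_labels (Suc (Suc 0)) (f (Suc 0)) (f (Suc (Suc 0))) f)"
      using act_s[OF f, of "Suc 0" \<phi>] that by (simp add: \<sigma>.simps)
  qed
  with L show ?case by blast
next
  case (Suc i)
  then show ?case using acts_as_L_step[of i] acts_as_\<sigma>_step[of i] by simp
qed

text \<open>The same corrections as for $\sigma_{i+1}$; only the order of the letters at the last two positions
  differs.\<close>

lemma acts_as_\<sigma>_half_step:
  assumes L: "acts_as_L (Suc j)" and \<sigma>: "acts_as_\<sigma>_half (Suc j)" and j: "Suc (Suc j) < K"
  shows "acts_as_\<sigma>_half (Suc (Suc j))"
  unfolding acts_as_\<sigma>_half_def
proof (intro allI ballI)
  fix \<phi> f assume f: "f \<in> words n K"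
  define x y z where xyz: "x = f (Suc j)" "y = f (Suc (Suc j))" "z = f (Suc (Suc (Suc j)))"
  have lt: "x < n" "y < n" "z < n" using f j by (auto simp: xyz wordsD)
  note act3 = act_put3[where j = "Suc j"]
  have aL: "act (L (Suc j)) \<psi> (put3 (Suc j) g u v w) = (\<Sum>b<n. \<psi> (put3 (Suc j) (swap_labels j b u g) b v w))"
    and a\<sigma>: "act (\<sigma>_half (Suc j)) \<psi> (put3 (Suc j) g u v w) = \<psi> (put3 (Suc j) (swap_labels j u v g) u v w)"
    if "g \<in> words n K" "u < n" "v < n" "w < n" for \<psi> g u v w
  proof -
    have "put3 (Suc j) g u v w (Suc j) = u" "put3 (Suc j) g u v w (Suc (Suc j)) = v"
      by (simp_all add: put3_def)
    then show "act (L (Suc j)) \<psi> (put3 (Suc j) g u v w) = (\<Sum>b<n. \<psi> (put3 (Suc j) (swap_labels j b u g) b v w))"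
      and "act (\<sigma>_half (Suc j)) \<psi> (put3 (Suc j) g u v w) = \<psi> (put3 (Suc j) (swap_labels j u v g) u v w)"
      using L \<sigma> put3_in_words[OF that, of "Suc j"] j
      by (simp_all add: acts_as_L_def acts_as_\<sigma>_half_def swap_labels_put3)
  qed
  note rec = \<sigma>_half.simps(2)[of "Suc j", unfolded Let_def, simplified]
  have "act (\<sigma>_half (Suc (Suc j))) \<phi> (put3 (Suc j) f x y z) =
      \<phi> (swap_labels (Suc j) y z (put3 (Suc j) f x y z))"
    using f lt j
    by (simp add: rec act_add act_diff act_uminus act_times act3 aL a\<sigma> swap_labels_put3 swap_labels_in_words put3_in_words
        transpose_def swap_labels_commute cong: sum.cong_simp if_cong)
  then show "act (\<sigma>_half (Suc (Suc j))) \<phi> f =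
      \<phi> (swap_labels (Suc (Suc j) - 1) (f (Suc (Suc j))) (f (Suc (Suc (Suc j)))) f)"
    using put3_self[of "Suc j" f] by (simp add: xyz)
qed

lemma acts_as_\<sigma>_half: "Suc i < K \<Longrightarrow> acts_as_\<sigma>_half (Suc i)"
proof (induction i)
  case 0
  then show ?case by (simp add: acts_as_\<sigma>_half_def \<sigma>_half.simps act_id_elt)
next
  case (Suc i)
  then show ?case using acts_as_\<sigma>_half_step[of i] acts_as_L_and_\<sigma>[of i] by simp
qed

text \<open>Again $s_i L_{i-1/2} s_i$ gives the right exchanges in all positions but the $i$-th, which matters
  only for $b = x$ and for $x = y$, with $x = f_i$ and $y = f_{i+1}$. For $i = 0$ nothing is exchanged,
  and the $n$ summands cancel $n$ times the value.\<close>

lemma acts_as_L_half: "i < K \<Longrightarrow> acts_as_L_half i"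
proof (induction i)
  case 0
  then show ?case by (simp add: acts_as_L_half_def L_half.simps act_zero)
next
  case (Suc i)
  note i = \<open>Suc i < K\<close>
  show ?case
    unfolding acts_as_L_half_def
  proof (intro allI ballI)
    fix \<phi> :: "(nat \<Rightarrow> nat) \<Rightarrow> complex" and f assume f: "f \<in> words n K"
    define x y where xy: "x = f (Suc i)" "y = f (Suc (Suc i))"
    have lt: "x < n" "y < n" using f i by (auto simp: xy wordsD)
    note act2 = act_put2[where i = "Suc i"]
    have aL: "act (L (Suc i)) \<psi> (put2 (Suc i) g u v) = (\<Sum>b<n. \<psi> (put2 (Suc i) (swap_labels i b u g) b v))"
      and a\<sigma>: "act (\<sigma>_half (Suc i)) \<psi> (put2 (Suc i) g u v) = \<psi> (put2 (Suc i) (swap_labels i u v g) u v)"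
      and aLh: "act (L_half i) \<psi> (put2 (Suc i) g u v) =
        of_nat n * \<psi> (put2 (Suc i) g u v) - (\<Sum>b<n. \<psi> (put2 (Suc i) (swap_labels i b u g) u v))"
      if "g \<in> words n K" "u < n" "v < n" for \<psi> g u v
    proof -
      have "put2 (Suc i) g u v (Suc i) = u" "put2 (Suc i) g u v (Suc (Suc i)) = v"
        by (simp_all add: put2_def)
      then show "act (L (Suc i)) \<psi> (put2 (Suc i) g u v) = (\<Sum>b<n. \<psi> (put2 (Suc i) (swap_labels i b u g) b v))"
        and "act (\<sigma>_half (Suc i)) \<psi> (put2 (Suc i) g u v) = \<psi> (put2 (Suc i) (swap_labels i u v g) u v)"
        and "act (L_half i) \<psi> (put2 (Suc i) g u v) =
          of_nat n * \<psi> (put2 (Suc i) g u v) - (\<Sum>b<n. \<psi> (put2 (Suc i) (swap_labels i b u g) u v))"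
        using acts_as_L_and_\<sigma>[of i] acts_as_\<sigma>_half[of i] Suc put2_in_words[OF that, of "Suc i"]
        by (simp_all add: acts_as_L_def acts_as_\<sigma>_half_def acts_as_L_half_def swap_labels_put2)
    qed
    have w: "put2 (Suc i) f x y \<in> words n K" "put2 (Suc i) f y x \<in> words n K"
      using f lt i by (auto intro: put2_in_words)
    note rec = L_half.simps(2)[of i, unfolded Let_def, simplified]
    let ?G = "\<lambda>b. \<phi> (put2 (Suc i) (swap_labels i b y f) x y)"
      and ?F = "\<lambda>b. \<phi> (put2 (Suc i) (swap_labels i b y f) (transpose b y x) y)"
    have off: "(\<Sum>b<n. ?F b) = (\<Sum>b<n. ?G b) - ?G x + \<phi> (put2 (Suc i) (swap_labels i x y f) y y)" if "x \<noteq> y"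
    proof -
      have "(\<Sum>b<n. ?F b) = (\<Sum>b<n. ?G b + (if b = x then ?F x - ?G x else 0))"
        using that by (intro sum.cong) (auto simp: transpose_def)
      then show ?thesis using lt by (simp add: sum.distrib)
    qed
    have "act (L_half (Suc i)) \<phi> (put2 (Suc i) f x y) =
        of_nat n * \<phi> (put2 (Suc i) f x y) - (\<Sum>b<n. \<phi> (swap_labels (Suc i) b y (put2 (Suc i) f x y)))"
      using f lt i off swap_labels_commute[of i y x f]
      by (simp add: rec w act_add act_diff act_uminus act_times act2 aL a\<sigma> aLh swap_labels_put2 swap_labels_in_words
          put2_in_words cong: sum.cong_simp if_cong)
    then show "act (L_half (Suc i)) \<phi> f =
        of_nat n * \<phi> f - (\<Sum>b<n. \<phi> (swap_labels (Suc i) b (f (Suc (Suc i))) f))"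
      using put2_self[of "Suc i" f] by (simp only: xy)
  qed
qed

end

section \<open>Signed sums over two-letter labellings\<close>

lemma sum_Pow_insert:
  fixes g :: "'v set \<Rightarrow> complex"
  assumes "finite A" "x \<notin> A"
  shows "(\<Sum>I\<in>Pow (insert x A). g I) = (\<Sum>I\<in>Pow A. g I + g (insert x I))"
proof -
  have "(\<Sum>I\<in>Pow (insert x A). g I) = (\<Sum>I\<in>Pow A. g I) + (\<Sum>I\<in>insert x ` Pow A. g I)"
    unfolding Pow_insert using assms by (intro sum.union_disjoint) auto
  also have "(\<Sum>I\<in>insert x ` Pow A. g I) = (\<Sum>I\<in>Pow A. g (insert x I))"
    using assms(2) by (subst sum.reindex) (auto simp: inj_on_def)
  finally show ?thesis by (simp add: sum.distrib)
qed

text \<open>A subset of \<open>vertices S\<close> amounts to an independent choice, for each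
  \<open>l \<in> S\<close>, of a subset of the two vertices over \<open>l\<close>.\<close>

lemma sum_prod_over_edges:
  fixes F :: "nat \<Rightarrow> bool \<Rightarrow> bool \<Rightarrow> complex"
  assumes "finite S"
  shows "(\<Sum>I\<in>Pow (vertices S). \<Prod>l\<in>S. F l (Top l \<in> I) (Bot l \<in> I)) =
    (\<Prod>l\<in>S. F l True True + F l True False + F l False True + F l False False)"
  using assms
proof (induction S)
  case empty
  then show ?case by (simp add: vertices_def)
next
  case (insert l S)
  let ?P = "\<lambda>I. \<Prod>m\<in>S. F m (Top m \<in> I) (Bot m \<in> I)"
  have V: "vertices (insert l S) = insert (Top l) (insert (Bot l) (vertices S))"
    by (auto simp: vertices_def)
  have nin: "Top l \<notin> insert (Bot l) (vertices S)" "Bot l \<notin> vertices S"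
    using insert by (auto simp: vertices_def)
  have fin: "finite (vertices S)" "finite (insert (Bot l) (vertices S))" using insert by auto
  have ne: "m \<noteq> l" if "m \<in> S" for m using insert.hyps that by auto
  have "(\<Sum>I\<in>Pow (vertices (insert l S)). \<Prod>m\<in>insert l S. F m (Top m \<in> I) (Bot m \<in> I)) =
     (\<Sum>I\<in>Pow (vertices (insert l S)). F l (Top l \<in> I) (Bot l \<in> I) * ?P I)"
    using insert.hyps by simp
  also have "\<dots> = (\<Sum>I\<in>Pow (vertices S). F l (Top l \<in> I) (Bot l \<in> I) * ?P I
      + F l True (Bot l \<in> I) * ?P I + (F l (Top l \<in> I) True * ?P I + F l True True * ?P I))"
    unfolding V sum_Pow_insert[OF fin(2) nin(1)] sum_Pow_insert[OF fin(1) nin(2)]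
    by (intro sum.cong refl) (simp add: ne cong: prod.cong)
  also have "\<dots> = (\<Sum>I\<in>Pow (vertices S).
      (F l True True + F l True False + F l False True + F l False False) * ?P I)"
  proof (intro sum.cong refl)
    fix I assume "I \<in> Pow (vertices S)"
    then have "Top l \<notin> I" "Bot l \<notin> I" using nin by auto
    then show "F l (Top l \<in> I) (Bot l \<in> I) * ?P I
        + F l True (Bot l \<in> I) * ?P I + (F l (Top l \<in> I) True * ?P I + F l True True * ?P I) =
      (F l True True + F l True False + F l False True + F l False False) * ?P I"
      by (simp add: algebra_simps)
  qed
  finally show ?case
    unfolding sum_distrib_left[symmetric] insert.IH prod.insert[OF insert.hyps] .
qed

text \<open>The sets \<open>I\<close> occurring in $p_S$ (for \<open>R = {}\<close>) and in $\tilde p_S$ (for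
  \<open>R = {k + 1}\<close>), before the exceptional ones are removed.\<close>

definition sides :: "nat set \<Rightarrow> nat set \<Rightarrow> vertex set set" where
  "sides S R = {I. I \<subseteq> vertices S \<and> (\<forall>l\<in>R. Top l \<in> I \<longleftrightarrow> Bot l \<in> I)}"

lemma finite_sides [simp]: "finite S \<Longrightarrow> finite (sides S R)"
  unfolding sides_def by (rule finite_subset[of _ "Pow (vertices S)"]) auto

lemma eps_eq_prod:
  assumes "finite S" "I \<subseteq> vertices S"
  shows "eps I S = (\<Prod>l\<in>S. if Top l \<in> I \<longleftrightarrow> Bot l \<in> I then - 1 else 1)"
proof -
  have "{l \<in> S. Top l \<in> I \<longleftrightarrow> Bot l \<in> I} =
      {l \<in> S. {Top l, Bot l} \<subseteq> I} \<union> {l \<in> S. {Top l, Bot l} \<subseteq> vertices S - I}"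
    by (auto simp: vertices_def)
  also have "card \<dots> = card {l \<in> S. {Top l, Bot l} \<subseteq> I} + card {l \<in> S. {Top l, Bot l} \<subseteq> vertices S - I}"
    using assms(1) by (intro card_Un_disjoint) auto
  finally have "eps I S = (-1) ^ card {l \<in> S. Top l \<in> I \<longleftrightarrow> Bot l \<in> I}"
    by (simp add: eps_def)
  also have "\<dots> = (\<Prod>l\<in>S. if Top l \<in> I \<longleftrightarrow> Bot l \<in> I then - 1 else 1)"
    using assms(1) by (simp add: prod.If_cases Int_def)
  finally show ?thesis .
qed

lemma sum_sides_eps:
  fixes F :: "nat \<Rightarrow> bool \<Rightarrow> bool \<Rightarrow> complex"
  assumes S: "finite S" and R: "R \<subseteq> S"
  shows "(\<Sum>I\<in>sides S R. eps I S * (\<Prod>l\<in>S. F l (Top l \<in> I) (Bot l \<in> I))) =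
    (\<Prod>l\<in>S. (if l \<in> R then 0 else F l True False + F l False True) - F l True True - F l False False)"
proof -
  define G where "G l p q = (if p = q then - 1 else if l \<in> R then 0 else 1) * F l p q" for l p q
  have "(\<Sum>I\<in>sides S R. eps I S * (\<Prod>l\<in>S. F l (Top l \<in> I) (Bot l \<in> I))) =
      (\<Sum>I\<in>Pow (vertices S). \<Prod>l\<in>S. G l (Top l \<in> I) (Bot l \<in> I))"
  proof (rule sum.mono_neutral_cong_left)
    show "\<forall>I\<in>Pow (vertices S) - sides S R. (\<Prod>l\<in>S. G l (Top l \<in> I) (Bot l \<in> I)) = 0"
    proof
      fix I assume "I \<in> Pow (vertices S) - sides S R"
      then obtain l where "l \<in> R" "(Top l \<in> I) \<noteq> (Bot l \<in> I)" by (auto simp: sides_def)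
      then show "(\<Prod>l\<in>S. G l (Top l \<in> I) (Bot l \<in> I)) = 0"
        using S R by (intro prod_zero) (auto simp: G_def)
    qed
    fix I assume I: "I \<in> sides S R"
    then show "eps I S * (\<Prod>l\<in>S. F l (Top l \<in> I) (Bot l \<in> I)) = (\<Prod>l\<in>S. G l (Top l \<in> I) (Bot l \<in> I))"
      unfolding G_def prod.distrib
      by (intro arg_cong2[of _ _ _ _ "(*)"]) (auto simp: eps_eq_prod S sides_def intro!: prod.cong)
  qed (use S in \<open>auto simp: sides_def\<close>)
  also have "\<dots> = (\<Prod>l\<in>S. G l True True + G l True False + G l False True + G l False False)"
    by (rule sum_prod_over_edges[OF S])
  also have "\<dots> = (\<Prod>l\<in>S. (if l \<in> R then 0 else F l True False + F l False True) - F l True True - F l False False)"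
    by (intro prod.cong refl) (auto simp: G_def)
  finally show ?thesis .
qed

lemma sum_sides_eps_0:
  assumes "finite S" "R \<subset> S"
  shows "(\<Sum>I\<in>sides S R. eps I S) = 0"
proof -
  obtain m where "m \<in> S" "m \<notin> R" using assms by blast
  then show ?thesis
    using sum_sides_eps[of S R "\<lambda>_ _ _. 1"] assms
    by (auto intro!: prod_zero)
qed

text \<open>The contribution of position \<open>l\<close> to the expansion of a transposition: for
  \<open>R = {}\<close> and \<open>a \<noteq> b\<close> it is the difference of the indicators that the bottom
  label is the image of the top label under $(a\,b)$ and that it equals the top label
  (\<open>factor_transpose\<close>). For \<open>l \<in> R\<close> the labels are not allowed to differ.\<close>

definition factor :: "nat set \<Rightarrow> (vertex \<Rightarrow> nat) \<Rightarrow> nat \<Rightarrow> nat \<Rightarrow> nat \<Rightarrow> complex" where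
  "factor R v a b l =
    (if l \<in> R then 0 else of_bool (v (Top l) = a \<and> v (Bot l) = b) + of_bool (v (Top l) = b \<and> v (Bot l) = a))
    - of_bool (v (Top l) = a \<and> v (Bot l) = a) - of_bool (v (Top l) = b \<and> v (Bot l) = b)"

lemma prod_of_bool: "finite A \<Longrightarrow> (\<Prod>l\<in>A. of_bool (P l) :: complex) = of_bool (\<forall>l\<in>A. P l)"
  by (induction A rule: finite_induct) auto

lemma prod_factor:
  assumes "finite S" "R \<subseteq> S"
  shows "(\<Prod>l\<in>S. factor R v a b l) =
    (\<Sum>I\<in>sides S R. eps I S * of_bool ((\<forall>x\<in>I. v x = a) \<and> (\<forall>x\<in>vertices S - I. v x = b)))"
proof -
  let ?F = "\<lambda>l p q. of_bool (v (Top l) = (if p then a else b) \<and> v (Bot l) = (if q then a else b)) :: complex"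
  have "(\<Prod>l\<in>S. factor R v a b l) = (\<Sum>I\<in>sides S R. eps I S * (\<Prod>l\<in>S. ?F l (Top l \<in> I) (Bot l \<in> I)))"
    by (subst sum_sides_eps[OF assms, of ?F]) (intro prod.cong refl, auto simp: factor_def)
  also have "\<dots> = (\<Sum>I\<in>sides S R. eps I S * of_bool ((\<forall>x\<in>I. v x = a) \<and> (\<forall>x\<in>vertices S - I. v x = b)))"
  proof (intro sum.cong refl)
    fix I assume "I \<in> sides S R"
    then have I: "I \<subseteq> vertices S" by (simp add: sides_def)
    have "(\<forall>l\<in>S. v (Top l) = (if Top l \<in> I then a else b) \<and> v (Bot l) = (if Bot l \<in> I then a else b)) \<longleftrightarrow>
        (\<forall>x\<in>vertices S. v x = (if x \<in> I then a else b))"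
      by (auto simp: vertices_def)
    also have "\<dots> \<longleftrightarrow> (\<forall>x\<in>I. v x = a) \<and> (\<forall>x\<in>vertices S - I. v x = b)"
      using I by auto
    finally show "eps I S * (\<Prod>l\<in>S. ?F l (Top l \<in> I) (Bot l \<in> I)) =
        eps I S * of_bool ((\<forall>x\<in>I. v x = a) \<and> (\<forall>x\<in>vertices S - I. v x = b))"
      by (simp add: prod_of_bool assms(1))
  qed
  finally show ?thesis .
qed

lemma constant_on_blocks_singleton:
  "x \<in> A \<Longrightarrow> constant_on_blocks v {A} \<longleftrightarrow> (\<forall>z\<in>A. v z = v x)"
  unfolding constant_on_blocks_def by simp metis

lemma constant_on_blocks_pair:
  "constant_on_blocks v {A, B} \<longleftrightarrow> constant_on_blocks v {A} \<and> constant_on_blocks v {B}"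
  by (simp add: constant_on_blocks_def)

lemma sum_distinct_pairs_proper:
  assumes lt: "\<And>x. x \<in> V \<Longrightarrow> v x < n" and I: "I \<subseteq> V" "I \<noteq> {}" "I \<noteq> V"
  shows "(\<Sum>a<n. \<Sum>b<n. of_bool (a \<noteq> b) * of_bool ((\<forall>x\<in>I. v x = a) \<and> (\<forall>x\<in>V - I. v x = b))) =
    (of_bool (constant_on_blocks v {I, V - I}) - of_bool (constant_on_blocks v {V}) :: complex)"
proof -
  obtain x y where xy: "x \<in> I" "y \<in> V" "y \<notin> I" using I by blast
  have vxy: "v x < n" "v y < n" using lt xy I by auto
  let ?c = "v x \<noteq> v y \<and> constant_on_blocks v {I, V - I}"
  have c: "constant_on_blocks v {I, V - I} \<longleftrightarrow> (\<forall>z\<in>I. v z = v x) \<and> (\<forall>z\<in>V - I. v z = v y)"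
    using constant_on_blocks_singleton[of x I] constant_on_blocks_singleton[of y "V - I"] xy
    by (simp add: constant_on_blocks_pair)
  have "(\<forall>z\<in>I. v z = a) \<and> (\<forall>z\<in>V - I. v z = b) \<longleftrightarrow> a = v x \<and> b = v y \<and> constant_on_blocks v {I, V - I}" for a b
    unfolding c using xy by (metis DiffI)
  then have "(\<Sum>a<n. \<Sum>b<n. of_bool (a \<noteq> b) * of_bool ((\<forall>x\<in>I. v x = a) \<and> (\<forall>x\<in>V - I. v x = b))) =
      (\<Sum>a<n. \<Sum>b<n. if b = v y then of_bool (a = v x \<and> ?c) else 0 :: complex)"
    by (intro sum.cong refl) auto
  also have "\<dots> = (\<Sum>a<n. if a = v x then of_bool ?c else 0)"
    using vxy by (intro sum.cong refl) simp
  also have "\<dots> = of_bool ?c"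
    using vxy by simp
  also have "\<dots> = of_bool (constant_on_blocks v {I, V - I}) - of_bool (constant_on_blocks v {V})"
  proof -
    have "constant_on_blocks v {V} \<longleftrightarrow> v x = v y \<and> constant_on_blocks v {I, V - I}"
    proof
      assume l: "constant_on_blocks v {V}"
      then have "v z = v y" if "z \<in> V" for z
        using that constant_on_blocks_singleton[OF xy(2)] by blast
      then show "v x = v y \<and> constant_on_blocks v {I, V - I}"
        unfolding c using xy I(1) by (metis DiffD1 subsetD)
    next
      assume r: "v x = v y \<and> constant_on_blocks v {I, V - I}"
      then show "constant_on_blocks v {V}"
        unfolding c constant_on_blocks_singleton[OF xy(2)] by (metis DiffI)
    qed
    then show ?thesis by (cases "v x = v y") simp_all
  qed
  finally show ?thesis .
qed

lemma sum_distinct_pairs_all: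
  assumes lt: "\<And>x. x \<in> V \<Longrightarrow> v x < n" and V: "V \<noteq> {}"
  shows "(\<Sum>a<n. \<Sum>b<n. of_bool (a \<noteq> b) * of_bool (\<forall>x\<in>V. v x = a)) =
    ((of_nat n - 1) * of_bool (constant_on_blocks v {V}) :: complex)"
    and "(\<Sum>a<n. \<Sum>b<n. of_bool (a \<noteq> b) * of_bool (\<forall>x\<in>V. v x = b)) =
    ((of_nat n - 1) * of_bool (constant_on_blocks v {V}) :: complex)"
proof -
  obtain x where x: "x \<in> V" using V by blast
  have n: "(\<Sum>b<n. of_bool (a \<noteq> b)) = (of_nat n - 1 :: complex)"
    "(\<Sum>b<n. of_bool (b \<noteq> a)) = (of_nat n - 1 :: complex)" if "a < n" for a
  proof -
    have "(\<Sum>b<n. of_bool (a \<noteq> b)) = (\<Sum>b<n. 1 - (if b = a then 1 else 0) :: complex)"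
      by (intro sum.cong) auto
    also have "\<dots> = of_nat n - 1" using that by (subst sum_subtractf) simp
    finally show 1: "(\<Sum>b<n. of_bool (a \<noteq> b)) = (of_nat n - 1 :: complex)" .
    show "(\<Sum>b<n. of_bool (b \<noteq> a)) = (of_nat n - 1 :: complex)"
      unfolding 1[symmetric] by (intro sum.cong) auto
  qed
  have c: "(\<forall>z\<in>V. v z = a) \<longleftrightarrow> a = v x \<and> constant_on_blocks v {V}" for a
    unfolding constant_on_blocks_singleton[OF x] using x by metis
  have "(\<Sum>a<n. \<Sum>b<n. of_bool (a \<noteq> b) * of_bool (\<forall>x\<in>V. v x = a)) =
      (\<Sum>a<n. if a = v x then (\<Sum>b<n. of_bool (a \<noteq> b)) * of_bool (constant_on_blocks v {V}) else 0 :: complex)"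
    unfolding c by (intro sum.cong refl) (auto simp: sum_distrib_right)
  then show 1: "(\<Sum>a<n. \<Sum>b<n. of_bool (a \<noteq> b) * of_bool (\<forall>x\<in>V. v x = a)) =
    ((of_nat n - 1) * of_bool (constant_on_blocks v {V}) :: complex)"
    using lt[OF x] by (simp add: n del: sum_of_bool_eq)
  have "(\<Sum>a<n. \<Sum>b<n. of_bool (a \<noteq> b) * of_bool (\<forall>x\<in>V. v x = b)) =
     (\<Sum>b<n. \<Sum>a<n. of_bool (b \<noteq> a) * of_bool (\<forall>x\<in>V. v x = b) :: complex)"
    by (subst sum.swap) (intro sum.cong refl, auto)
  with 1 show "(\<Sum>a<n. \<Sum>b<n. of_bool (a \<noteq> b) * of_bool (\<forall>x\<in>V. v x = b)) =
    ((of_nat n - 1) * of_bool (constant_on_blocks v {V}) :: complex)" by simp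
qed

abbreviation proper_sides :: "nat set \<Rightarrow> nat set \<Rightarrow> vertex set set" where
  "proper_sides S R \<equiv> sides S R - {{}, vertices S}"

text \<open>The set \<open>I\<close> collects the vertices labelled \<open>a\<close>. If \<open>I\<close> and its complement
  are both nonempty, summing over \<open>a \<noteq> b\<close> leaves the labellings constant on both parts
  but not on their union, which are counted by $d_{I \subseteq S} - b_S$. In the two remaining cases
  the sum is $(n - 1) b_S$. All signs together cancel, so the terms $-b_S$ raise $n - 1$ to $n$.\<close>

lemma sum_pairs_prod_factor:
  assumes S: "finite S" and R: "R \<subset> S" and lt: "\<And>x. x \<in> vertices S \<Longrightarrow> v x < n"
  shows "(\<Sum>a<n. \<Sum>b<n. of_bool (a \<noteq> b) * (1 / 2 * (\<Prod>l\<in>S. factor R v a b l))) =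
    (\<Sum>I\<in>proper_sides S R. 1 / 2 * eps I S * of_bool (constant_on_blocks v {I, vertices S - I}))
    + of_nat n * (-1) ^ card S * of_bool (constant_on_blocks v {vertices S})"
proof -
  let ?V = "vertices S"
  let ?on = "\<lambda>I a b. of_bool ((\<forall>x\<in>I. v x = a) \<and> (\<forall>x\<in>?V - I. v x = b)) :: complex"
  define N where "N I = (\<Sum>a<n. \<Sum>b<n. of_bool (a \<noteq> b) * ?on I a b)" for I
  let ?c = "of_bool (constant_on_blocks v {?V}) :: complex"
  have all: "{l \<in> S. {Top l, Bot l} \<subseteq> ?V} = S" by (auto simp: vertices_def)
  have RS: "R \<subseteq> S" and ne: "?V \<noteq> {}" using R by (auto simp: vertices_def)
  have "(\<Sum>a<n. \<Sum>b<n. of_bool (a \<noteq> b) * (1 / 2 * (\<Prod>l\<in>S. factor R v a b l))) =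
      (\<Sum>a<n. \<Sum>b<n. \<Sum>I\<in>sides S R. 1 / 2 * eps I S * (of_bool (a \<noteq> b) * ?on I a b))"
    unfolding prod_factor[OF S RS] sum_distrib_left by (simp only: mult_ac)
  also have "\<dots> = (\<Sum>a<n. \<Sum>I\<in>sides S R. \<Sum>b<n. 1 / 2 * eps I S * (of_bool (a \<noteq> b) * ?on I a b))"
    by (intro sum.cong refl sum.swap)
  also have "\<dots> = (\<Sum>I\<in>sides S R. 1 / 2 * eps I S * N I)"
    unfolding N_def sum_distrib_left by (rule sum.swap)
  also have "\<dots> = (\<Sum>I\<in>proper_sides S R. 1 / 2 * eps I S * N I) + (\<Sum>I\<in>{{}, ?V}. 1 / 2 * eps I S * N I)"
    using S RS by (intro sum.subset_diff) (auto simp: sides_def vertices_def)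
  also have "(\<Sum>I\<in>{{}, ?V}. 1 / 2 * eps I S * N I) = (-1) ^ card S * (of_nat n - 1) * ?c"
  proof -
    have "eps {} S = (-1) ^ card S" "eps ?V S = (-1) ^ card S"
      using all by (simp_all add: eps_def)
    moreover have "N {} = (of_nat n - 1) * ?c" "N ?V = (of_nat n - 1) * ?c"
      using sum_distinct_pairs_all[of ?V v n, OF lt ne] by (simp_all add: N_def)
    ultimately show ?thesis using ne by simp
  qed
  also have "(\<Sum>I\<in>proper_sides S R. 1 / 2 * eps I S * N I) =
      (\<Sum>I\<in>proper_sides S R. 1 / 2 * eps I S * of_bool (constant_on_blocks v {I, ?V - I}))
      + (-1) ^ card S * ?c"
  proof -
    have "(\<Sum>I\<in>proper_sides S R. eps I S) + (\<Sum>I\<in>{{}, ?V}. eps I S) = (\<Sum>I\<in>sides S R. eps I S)"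
      using S RS by (intro sum.subset_diff[symmetric]) (auto simp: sides_def vertices_def)
    moreover have "(\<Sum>I\<in>{{}, ?V}. eps I S) = 2 * (-1) ^ card S"
      using ne all by (simp add: eps_def)
    ultimately have e: "(\<Sum>I\<in>proper_sides S R. eps I S) = - 2 * (-1) ^ card S"
      using sum_sides_eps_0[OF S R] by (simp add: eq_neg_iff_add_eq_0)
    have NI: "N I = of_bool (constant_on_blocks v {I, ?V - I}) - ?c" if "I \<in> proper_sides S R" for I
      unfolding N_def using that by (intro sum_distinct_pairs_proper lt) (auto simp: sides_def)
    have "(\<Sum>I\<in>proper_sides S R. 1 / 2 * eps I S * N I) =
      (\<Sum>I\<in>proper_sides S R. 1 / 2 * eps I S * of_bool (constant_on_blocks v {I, ?V - I})
         - 1 / 2 * ?c * eps I S)"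
    proof (intro sum.cong refl)
      fix I assume "I \<in> proper_sides S R"
      then show "1 / 2 * eps I S * N I =
          1 / 2 * eps I S * of_bool (constant_on_blocks v {I, ?V - I}) - 1 / 2 * ?c * eps I S"
        by (subst NI) (simp_all only: right_diff_distrib mult_ac)
    qed
    then show ?thesis by (simp only: sum_subtractf sum_distrib_left[symmetric] e) simp
  qed
  finally show ?thesis by (simp add: algebra_simps)
qed

section \<open>Diagrams in the expansion of a transposition\<close>

lemma compatible_b_diag:
  "compatible (b_diag K S) f h \<longleftrightarrow>
    constant_on_blocks (case_vertex f h) {vertices S} \<and> (\<forall>m\<in>{1..K} - S. f m = h m)"
  unfolding b_diag_def compatible_Un_verticals by (simp add: compatible_def)

lemma compatible_d_diag:
  "compatible (d_diag K I S) f h \<longleftrightarrow>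
    constant_on_blocks (case_vertex f h) {I, vertices S - I} \<and> (\<forall>m\<in>{1..K} - S. f m = h m)"
  unfolding d_diag_def compatible_Un_verticals by (simp add: compatible_def)

abbreviation b_entry :: "nat \<Rightarrow> (nat \<Rightarrow> nat) \<Rightarrow> (nat \<Rightarrow> nat) \<Rightarrow> nat set \<Rightarrow> complex" where
  "b_entry K f h S \<equiv> of_bool (compatible (b_diag K S) f h)"

abbreviation d_entry :: "nat \<Rightarrow> (nat \<Rightarrow> nat) \<Rightarrow> (nat \<Rightarrow> nat) \<Rightarrow> nat set \<Rightarrow> vertex set \<Rightarrow> complex" where
  "d_entry K f h S I \<equiv> 1 / 2 * eps I S * of_bool (compatible (d_diag K I S) f h)"

lemma b_entry_singleton:
  assumes "f \<in> words n K" "h \<in> words n K" "l \<in> {1..K}"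
  shows "compatible (b_diag K {l}) f h \<longleftrightarrow> h = f"
proof -
  have "compatible (b_diag K {l}) f h \<longleftrightarrow> f l = h l \<and> (\<forall>m\<in>{1..K} - {l}. f m = h m)"
    unfolding compatible_b_diag
    by (subst constant_on_blocks_singleton[of "Top l"]) (auto simp: vertices_def)
  also have "\<dots> \<longleftrightarrow> (\<forall>m\<in>{1..K}. f m = h m)" using assms(3) by blast
  also have "\<dots> \<longleftrightarrow> h = f" using words_eqI[OF assms(1,2)] by metis
  finally show ?thesis .
qed

text \<open>The sets \<open>I\<close> left out of $p_S$ and $\tilde p_S$. For them $d_{I \subseteq S}$ is
  $b_{S \setminus \{l\}}$, so their contribution changes the coefficients of the $b_T$.\<close>

definition excluded :: "nat set \<Rightarrow> nat set \<Rightarrow> vertex set set" where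
  "excluded S R = {I \<in> proper_sides S R. \<exists>l\<in>S - R. I = vertices {l} \<or> I = vertices S - vertices {l}}"

lemma vertices_eq_iff: "vertices S = vertices T \<longleftrightarrow> S = T"
  by (auto simp: vertices_def set_eq_iff)

lemma vertices_Diff: "vertices (S - T) = vertices S - vertices T"
  by (auto simp: vertices_def)

lemma d_entry_excluded:
  assumes S: "finite S" "S \<subseteq> {1..K}" and l: "l \<in> S" and I: "I = vertices {l} \<or> I = vertices (S - {l})"
    and card: "card S \<ge> 2"
  shows "d_entry K f h S I = 1 / 2 * (-1) ^ card S * b_entry K f h (S - {l})"
proof -
  let ?v = "case_vertex f h"
  have e1: "{m \<in> S. {Top m, Bot m} \<subseteq> vertices {l}} = {l}"
    "{m \<in> S. {Top m, Bot m} \<subseteq> vertices S - vertices {l}} = S - {l}"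
    "{m \<in> S. {Top m, Bot m} \<subseteq> vertices (S - {l})} = S - {l}"
    "{m \<in> S. {Top m, Bot m} \<subseteq> vertices S - vertices (S - {l})} = {l}"
    using l by (auto simp: vertices_def)
  have c: "card S = Suc (card (S - {l}))" using card_Suc_Diff1[OF S(1) l] by simp
  have eps: "eps I S = (-1) ^ card S"
    using I unfolding eps_def by (elim disjE) (simp_all only: e1, simp_all add: c)
  have "{I, vertices S - I} = {vertices {l}, vertices (S - {l})}"
  proof -
    have "vertices S - vertices {l} = vertices (S - {l})" "vertices S - vertices (S - {l}) = vertices {l}"
      using l by (auto simp: vertices_def)
    then show ?thesis using I by auto
  qed
  moreover have "(\<forall>m\<in>{1..K} - (S - {l}). f m = h m) \<longleftrightarrow>
      constant_on_blocks ?v {vertices {l}} \<and> (\<forall>m\<in>{1..K} - S. f m = h m)"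
  proof -
    have "constant_on_blocks ?v {vertices {l}} \<longleftrightarrow> f l = h l"
      by (subst constant_on_blocks_singleton[of "Top l"]) (auto simp: vertices_def)
    then show ?thesis using l S by blast
  qed
  ultimately have "compatible (d_diag K I S) f h \<longleftrightarrow> compatible (b_diag K (S - {l})) f h"
    unfolding compatible_d_diag compatible_b_diag by (auto simp: constant_on_blocks_pair)
  then show ?thesis by (simp add: eps)
qed

lemma sum_excluded_generic:
  assumes S: "finite S" "S \<subseteq> {1..K}" and R: "R \<subset> S" and big: "card S \<ge> 3 \<or> card S \<ge> 2 \<and> R \<noteq> {}"
  shows "(\<Sum>I\<in>excluded S R. d_entry K f h S I) = (\<Sum>l\<in>S - R. (-1) ^ card S * b_entry K f h (S - {l}))"
proof -
  let ?A = "(\<lambda>l. vertices {l}) ` (S - R)" and ?B = "(\<lambda>l. vertices (S - {l})) ` (S - R)"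
  have ne: "S \<noteq> {l}" for l using big by auto
  have "excluded S R = ?A \<union> ?B"
  proof (rule set_eqI)
    fix I
    have "I \<in> proper_sides S R" if "l \<in> S - R" "I = vertices {l} \<or> I = vertices (S - {l})" for l
    proof -
      have "vertices {l} \<noteq> vertices S" "vertices {l} \<noteq> {}" using ne[of l] by (auto simp: vertices_eq_iff vertices_def)
      moreover have "vertices (S - {l}) \<noteq> {}" "vertices (S - {l}) \<noteq> vertices S"
        using ne[of l] that by (auto simp: vertices_eq_iff) (auto simp: vertices_def)
      moreover have "vertices {l} \<in> sides S R" "vertices (S - {l}) \<in> sides S R"
        using that R by (auto simp: sides_def vertices_def)
      ultimately show ?thesis using that(2) by auto
    qed
    then show "I \<in> excluded S R \<longleftrightarrow> I \<in> ?A \<union> ?B"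
      unfolding excluded_def by (auto simp: vertices_Diff)
  qed
  moreover have "?A \<inter> ?B = {}"
  proof (rule ccontr)
    assume "?A \<inter> ?B \<noteq> {}"
    then obtain I where I: "I \<in> ?A" "I \<in> ?B" by blast
    from I(1) obtain l where l: "I = vertices {l}" "l \<in> S - R" by (rule imageE)
    from I(2) obtain m where m: "I = vertices (S - {m})" "m \<in> S - R" by (rule imageE)
    have lm: "l \<in> S - R" "m \<in> S - R" "{l} = S - {m}"
      using l m vertices_eq_iff[of "{l}" "S - {m}"] by simp_all
    then have "S = {l, m}" by blast
    then have "card S \<le> 2" "R = {}" using lm R by (auto simp: card_insert_if)
    then show False using big by auto
  qed
  ultimately have "(\<Sum>I\<in>excluded S R. d_entry K f h S I) =
      (\<Sum>I\<in>?A. d_entry K f h S I) + (\<Sum>I\<in>?B. d_entry K f h S I)"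
    using S by (simp add: sum.union_disjoint)
  also have "(\<Sum>I\<in>?A. d_entry K f h S I) = (\<Sum>l\<in>S - R. d_entry K f h S (vertices {l}))"
    by (subst sum.reindex) (auto simp: inj_on_def vertices_eq_iff)
  also have "\<dots> = (\<Sum>l\<in>S - R. 1 / 2 * (-1) ^ card S * b_entry K f h (S - {l}))"
    by (intro sum.cong refl d_entry_excluded S) (use big in auto)
  also have "(\<Sum>I\<in>?B. d_entry K f h S I) = (\<Sum>l\<in>S - R. d_entry K f h S (vertices (S - {l})))"
    by (subst sum.reindex) (auto simp: inj_on_def vertices_eq_iff)
  also have "\<dots> = (\<Sum>l\<in>S - R. 1 / 2 * (-1) ^ card S * b_entry K f h (S - {l}))"
    by (intro sum.cong refl d_entry_excluded S) (use big in auto)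
  finally show ?thesis
    by (simp add: sum.distrib[symmetric] del: sum_of_bool_mult_eq sum_mult_of_bool_eq)
qed

text \<open>For a set of two elements and \<open>R = {}\<close>, the block over one element is the complement of
  the block over the other, so there are only half as many excluded sets as in the general case. This
  produces the summand $\binom{k}{2}$ of $Z_k$.\<close>

lemma sum_excluded_pair:
  assumes S: "S \<subseteq> {1..K}" "card S = 2" and f: "f \<in> words n K" and h: "h \<in> words n K"
  shows "(\<Sum>I\<in>excluded S {}. d_entry K f h S I) = of_bool (h = f)"
proof -
  obtain l m where lm: "S = {l, m}" "l \<noteq> m" using S(2) by (meson card_2_iff)
  have d: "S - {l} = {m}" "S - {m} = {l}" using lm by auto
  have fin: "finite S" using lm by simp
  have "excluded S {} = {vertices {l}, vertices {m}}"
  proof -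
    have "vertices {l} \<in> proper_sides S {}" "vertices {m} \<in> proper_sides S {}"
      using lm by (auto simp: sides_def vertices_def)
    then show ?thesis
      unfolding excluded_def vertices_Diff[symmetric] using lm d by auto
  qed
  moreover have "vertices {l} \<noteq> vertices {m}" using lm by (simp add: vertices_eq_iff)
  ultimately have "(\<Sum>I\<in>excluded S {}. d_entry K f h S I) =
      d_entry K f h S (vertices {l}) + d_entry K f h S (vertices {m})" by simp
  also have "d_entry K f h S (vertices {l}) = 1 / 2 * of_bool (h = f)"
    using d_entry_excluded[of S K l "vertices {l}" f h] S lm d fin b_entry_singleton[OF f h, of m] by simp
  also have "d_entry K f h S (vertices {m}) = 1 / 2 * of_bool (h = f)"
    using d_entry_excluded[of S K m "vertices {m}" f h] S lm d fin b_entry_singleton[OF f h, of l] by simp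
  finally show ?thesis by simp
qed

text \<open>A set \<open>T\<close> arises by removing one element in as many ways as there are elements outside
  \<open>T\<close>.\<close>

lemma sum_remove_element:
  fixes g :: "nat set \<Rightarrow> complex"
  assumes A: "finite A" and R: "R \<subseteq> A"
  shows "(\<Sum>S | R \<subseteq> S \<and> S \<subseteq> A \<and> Suc m \<le> card S. \<Sum>l\<in>S - R. g (S - {l})) =
    (\<Sum>T | R \<subseteq> T \<and> T \<subseteq> A \<and> m \<le> card T. (of_nat (card A) - of_nat (card T)) * g T)"
proof -
  have fin: "finite S" if "S \<subseteq> A" for S using that A by (rule finite_subset)
  have finF: "finite {S. R \<subseteq> S \<and> S \<subseteq> A \<and> k \<le> card S}" for k
    by (rule finite_subset[of _ "Pow A"]) (use A in auto)
  have "(\<Sum>S | R \<subseteq> S \<and> S \<subseteq> A \<and> Suc m \<le> card S. \<Sum>l\<in>S - R. g (S - {l})) =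
      (\<Sum>(S, l)\<in>(SIGMA S:{S. R \<subseteq> S \<and> S \<subseteq> A \<and> Suc m \<le> card S}. S - R). g (S - {l}))"
    using fin finF by (subst sum.Sigma) auto
  also have "\<dots> = (\<Sum>(T, l)\<in>(SIGMA T:{T. R \<subseteq> T \<and> T \<subseteq> A \<and> m \<le> card T}. A - T). g T)"
    by (rule sum.reindex_bij_witness[where i = "\<lambda>(T, l). (insert l T, l)" and j = "\<lambda>(S, l). (S - {l}, l)"])
       (use R in \<open>auto simp: insert_absorb card_Diff_singleton fin dest: fin\<close>)
  also have "\<dots> = (\<Sum>T | R \<subseteq> T \<and> T \<subseteq> A \<and> m \<le> card T. \<Sum>l\<in>A - T. g T)"
    using A finF by (subst sum.Sigma) auto
  also have "\<dots> = (\<Sum>T | R \<subseteq> T \<and> T \<subseteq> A \<and> m \<le> card T. (of_nat (card A) - of_nat (card T)) * g T)"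
  proof (intro sum.cong refl)
    fix T assume "T \<in> {T. R \<subseteq> T \<and> T \<subseteq> A \<and> m \<le> card T}"
    then have "T \<subseteq> A" by simp
    then show "(\<Sum>l\<in>A - T. g T) = (of_nat (card A) - of_nat (card T)) * g T"
      using A by (simp add: card_Diff_subset fin card_mono of_nat_diff)
  qed
  finally show ?thesis .
qed

lemma factor_transpose:
  assumes "a \<noteq> b"
  shows "factor {} (case_vertex f h) a b l = of_bool (h l = transpose a b (f l)) - of_bool (h l = f l)"
  using assms by (auto simp: factor_def transpose_def)

lemma prod_transpose_expand:
  assumes "finite A" "a \<noteq> b"
  shows "of_bool (\<forall>l\<in>A. h l = transpose a b (f l)) =
    (\<Sum>S\<in>Pow A. (\<Prod>l\<in>S. factor {} (case_vertex f h) a b l) * of_bool (\<forall>m\<in>A - S. f m = h m))"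
proof -
  have "of_bool (\<forall>l\<in>A. h l = transpose a b (f l)) =
      (\<Prod>l\<in>A. factor {} (case_vertex f h) a b l + of_bool (h l = f l))"
    using assms by (simp add: prod_of_bool[symmetric] factor_transpose)
  also have "\<dots> = (\<Sum>S\<in>Pow A. (\<Prod>l\<in>S. factor {} (case_vertex f h) a b l) * (\<Prod>l\<in>A - S. of_bool (h l = f l)))"
    using assms by (simp add: prod_add)
  also have "\<dots> = (\<Sum>S\<in>Pow A. (\<Prod>l\<in>S. factor {} (case_vertex f h) a b l) * of_bool (\<forall>m\<in>A - S. f m = h m))"
    using assms by (intro sum.cong refl) (auto simp: prod_of_bool)
  finally show ?thesis .
qed

lemma swap_labels_eq_iff:
  assumes "f \<in> words n K" "h \<in> words n K" "k \<le> K" "a < n" "b < n"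
  shows "h = swap_labels k a b f \<longleftrightarrow> (\<forall>l\<in>{1..k}. h l = transpose a b (f l)) \<and> (\<forall>m\<in>{1..K} - {1..k}. f m = h m)"
proof -
  have "h = swap_labels k a b f \<longleftrightarrow> (\<forall>l\<in>{1..K}. h l = swap_labels k a b f l)"
    using words_eqI[OF assms(2) swap_labels_in_words[OF assms(1,4,5,3)]] by metis
  also have "\<dots> \<longleftrightarrow> (\<forall>l\<in>{1..k}. h l = transpose a b (f l)) \<and> (\<forall>m\<in>{1..K} - {1..k}. f m = h m)"
    using assms(3) by (auto simp: swap_labels_def)
  finally show ?thesis .
qed

section \<open>The matrix of $Z_k$\<close>

abbreviation lk :: "(diagram \<Rightarrow>\<^sub>0 complex) \<Rightarrow> diagram \<Rightarrow> complex" where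
  "lk \<equiv> Poly_Mapping.lookup"

lemma entry_add: "entry K (lk (x + y)) f h = entry K (lk x) f h + entry K (lk y) f h"
  by (simp add: entry_def lookup_add distrib_right sum.distrib)

lemma entry_diff: "entry K (lk (x - y)) f h = entry K (lk x) f h - entry K (lk y) f h"
  by (simp add: entry_def lookup_minus left_diff_distrib sum_subtractf)

lemma entry_zero: "entry K (\<lambda>_. 0) f h = 0"
  by (simp add: entry_def)

lemma entry_sum: "entry K (lk (\<Sum>i\<in>A. x i)) f h = (\<Sum>i\<in>A. entry K (lk (x i)) f h)"
  by (induction A rule: infinite_finite_induct) (simp_all add: entry_add entry_zero)

lemma entry_single:
  assumes "\<rho> \<in> diagrams K"
  shows "entry K (lk (Poly_Mapping.single \<rho> a)) f h = a * of_bool (compatible \<rho> f h)"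
proof -
  have "entry K (lk (Poly_Mapping.single \<rho> a)) f h =
      (\<Sum>\<tau>\<in>diagrams K. if \<tau> = \<rho> then a * of_bool (compatible \<rho> f h) else 0)"
    unfolding entry_def by (rule sum.cong) (auto simp: lookup_single when_def)
  then show ?thesis using assms by simp
qed

lemma vertices_single: "vertices {l} = {Top l, Bot l}"
  by (auto simp: vertices_def)

lemma p_set_eq:
  "p_set K S = (\<Sum>I\<in>proper_sides S {} - excluded S {}. Poly_Mapping.single (d_diag K I S) (1 / 2 * eps I S))"
  unfolding p_set_def
  by (rule sum.cong) (auto simp: excluded_def sides_def vertices_single)

lemma p_tilde_eq:
  assumes "r \<in> S"
  shows "p_tilde K r S =
    (\<Sum>I\<in>proper_sides S {r} - excluded S {r}. Poly_Mapping.single (d_diag K I S) (1 / 2 * eps I S))"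
proof -
  have "Top r \<in> vertices S" "Bot r \<in> vertices S" using assms by (auto simp: vertices_def)
  then show ?thesis
    unfolding p_tilde_def
    by (intro sum.cong) (auto simp: excluded_def sides_def vertices_single)
qed

lemma entry_allowed:
  assumes S: "S \<subseteq> {1..K}"
  shows "entry K (lk (\<Sum>I\<in>proper_sides S R - excluded S R. Poly_Mapping.single (d_diag K I S) (1 / 2 * eps I S))) f h =
    (\<Sum>I\<in>proper_sides S R. d_entry K f h S I) - (\<Sum>I\<in>excluded S R. d_entry K f h S I)"
proof -
  have fin: "finite S" using S by (rule finite_subset) simp
  have "entry K (lk (\<Sum>I\<in>proper_sides S R - excluded S R. Poly_Mapping.single (d_diag K I S) (1 / 2 * eps I S))) f h =
      (\<Sum>I\<in>proper_sides S R - excluded S R. d_entry K f h S I)"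
    unfolding entry_sum
    by (intro sum.cong refl entry_single d_diag_in_diagrams S) (auto simp: sides_def)
  also have "\<dots> = (\<Sum>I\<in>proper_sides S R. d_entry K f h S I) - (\<Sum>I\<in>excluded S R. d_entry K f h S I)"
    using fin by (intro sum_diff) (auto simp: excluded_def)
  finally show ?thesis .
qed

lemma entry_p_set:
  assumes "S \<subseteq> {1..K}"
  shows "entry K (lk (p_set K S)) f h =
    (\<Sum>I\<in>proper_sides S {}. d_entry K f h S I) - (\<Sum>I\<in>excluded S {}. d_entry K f h S I)"
  unfolding p_set_eq by (rule entry_allowed[OF assms])

lemma entry_p_tilde:
  assumes "S \<subseteq> {1..K}" "r \<in> S"
  shows "entry K (lk (p_tilde K r S)) f h =
    (\<Sum>I\<in>proper_sides S {r}. d_entry K f h S I) - (\<Sum>I\<in>excluded S {r}. d_entry K f h S I)"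
  unfolding p_tilde_eq[OF assms(2)] by (rule entry_allowed[OF assms(1)])

lemma full_expansion:
  assumes S: "S \<subseteq> {1..K}" and R: "R \<subset> S" and f: "f \<in> words n K" and h: "h \<in> words n K"
  shows "(\<Sum>a<n. \<Sum>b<n. of_bool (a \<noteq> b) * (1 / 2 * (\<Prod>l\<in>S. factor R (case_vertex f h) a b l)))
      * of_bool (\<forall>m\<in>{1..K} - S. f m = h m) =
    (\<Sum>I\<in>proper_sides S R. d_entry K f h S I) + of_nat n * (-1) ^ card S * b_entry K f h S"
proof -
  have fin: "finite S" using S by (rule finite_subset) simp
  have lt: "case_vertex f h x < n" if "x \<in> vertices S" for x
    using that S f h by (auto simp: vertices_def wordsD)
  show ?thesis
    by (subst sum_pairs_prod_factor[OF fin R, of "case_vertex f h" n], erule lt)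
       (simp only: distrib_right sum_distrib_right compatible_d_diag compatible_b_diag of_bool_conj mult.assoc)
qed

lemma sum_split_card:
  fixes X :: "nat set \<Rightarrow> complex"
  assumes "finite A"
  shows "(\<Sum>S | R \<subseteq> S \<and> S \<subseteq> A \<and> m \<le> card S. X S) =
    (\<Sum>S | R \<subseteq> S \<and> S \<subseteq> A \<and> card S = m. X S) + (\<Sum>S | R \<subseteq> S \<and> S \<subseteq> A \<and> Suc m \<le> card S. X S)"
proof -
  have "{S. R \<subseteq> S \<and> S \<subseteq> A \<and> m \<le> card S} =
      {S. R \<subseteq> S \<and> S \<subseteq> A \<and> card S = m} \<union> {S. R \<subseteq> S \<and> S \<subseteq> A \<and> Suc m \<le> card S}"
    by auto
  moreover have "finite {S. R \<subseteq> S \<and> S \<subseteq> A \<and> Q S}" for Q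
    by (rule finite_subset[of _ "Pow A"]) (use assms in auto)
  ultimately show ?thesis by (simp only:) (intro sum.union_disjoint, auto)
qed

lemma swap_labels_expand:
  assumes f: "f \<in> words n K" and h: "h \<in> words n K" and k: "k \<le> K" and ab: "a < n" "b < n" "a \<noteq> b"
  shows "of_bool (h = swap_labels k a b f) =
    (\<Sum>S\<in>Pow {1..k}. (\<Prod>l\<in>S. factor {} (case_vertex f h) a b l) * of_bool (\<forall>m\<in>{1..K} - S. f m = h m))"
proof -
  have "of_bool (h = swap_labels k a b f) =
      (\<Sum>S\<in>Pow {1..k}. (\<Prod>l\<in>S. factor {} (case_vertex f h) a b l) * of_bool (\<forall>m\<in>{1..k} - S. f m = h m))
      * of_bool (\<forall>m\<in>{1..K} - {1..k}. f m = h m)"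
    unfolding swap_labels_eq_iff[OF f h k ab(1,2)] of_bool_conj prod_transpose_expand[OF finite_atLeastAtMost ab(3)] ..
  also have "\<dots> = (\<Sum>S\<in>Pow {1..k}. (\<Prod>l\<in>S. factor {} (case_vertex f h) a b l) * of_bool (\<forall>m\<in>{1..K} - S. f m = h m))"
    unfolding sum_distrib_right
  proof (intro sum.cong refl)
    fix S assume "S \<in> Pow {1..k}"
    then have "{1..K} - S = ({1..k} - S) \<union> ({1..K} - {1..k})" using k by auto
    then show "(\<Prod>l\<in>S. factor {} (case_vertex f h) a b l) * of_bool (\<forall>m\<in>{1..k} - S. f m = h m)
        * of_bool (\<forall>m\<in>{1..K} - {1..k}. f m = h m) =
      (\<Prod>l\<in>S. factor {} (case_vertex f h) a b l) * of_bool (\<forall>m\<in>{1..K} - S. f m = h m)"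
      by (simp only: ball_Un of_bool_conj mult.assoc)
  qed
  finally show ?thesis .
qed

lemma sum_pairs_of_bool:
  "(\<Sum>a<n. \<Sum>b<n. of_bool (a \<noteq> b) * (1 / 2)) = (of_nat n * (of_nat n - 1) / 2 :: complex)"
proof -
  have inner: "(\<Sum>b<n. of_bool (a \<noteq> b) * (1 / 2)) = ((of_nat n - 1) / 2 :: complex)" if "a < n" for a
  proof -
    have "(\<Sum>b<n. of_bool (a \<noteq> b) * (1 / 2)) = (\<Sum>b<n. 1 / 2 - (if b = a then 1 / 2 else 0) :: complex)"
      by (intro sum.cong) auto
    then show ?thesis using that by (simp add: sum_subtractf diff_divide_distrib)
  qed
  have "(\<Sum>a<n. \<Sum>b<n. of_bool (a \<noteq> b) * (1 / 2)) = (\<Sum>a<n. (of_nat n - 1) / 2 :: complex)"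
    by (intro sum.cong refl inner) simp
  then show ?thesis by simp
qed

lemma expand_over_subsets:
  assumes f: "f \<in> words n K" and h: "h \<in> words n K" and k: "k \<le> K"
  shows "(\<Sum>a<n. \<Sum>b<n. of_bool (a \<noteq> b) * (1 / 2 * of_bool (h = swap_labels k a b f))) =
    (\<Sum>S\<in>Pow {1..k}. (\<Sum>a<n. \<Sum>b<n. of_bool (a \<noteq> b) * (1 / 2 * (\<Prod>l\<in>S. factor {} (case_vertex f h) a b l)))
      * of_bool (\<forall>m\<in>{1..K} - S. f m = h m))"
proof -
  let ?P = "\<lambda>S a b. \<Prod>l\<in>S. factor {} (case_vertex f h) a b l"
  let ?off = "\<lambda>S. of_bool (\<forall>m\<in>{1..K} - S. f m = h m) :: complex"
  have "(\<Sum>a<n. \<Sum>b<n. of_bool (a \<noteq> b) * (1 / 2 * of_bool (h = swap_labels k a b f))) =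
      (\<Sum>a<n. \<Sum>b<n. \<Sum>S\<in>Pow {1..k}. of_bool (a \<noteq> b) * (1 / 2 * ?P S a b) * ?off S)"
  proof (intro sum.cong refl)
    fix a b assume "a \<in> {..<n}" "b \<in> {..<n}"
    then show "of_bool (a \<noteq> b) * (1 / 2 * of_bool (h = swap_labels k a b f)) =
        (\<Sum>S\<in>Pow {1..k}. of_bool (a \<noteq> b) * (1 / 2 * ?P S a b) * ?off S)"
      by (cases "a = b") (simp, subst swap_labels_expand[OF f h k], simp_all add: sum_distrib_left mult.assoc del: sum_mult_of_bool_eq sum_of_bool_mult_eq)
  qed
  also have "\<dots> = (\<Sum>a<n. \<Sum>S\<in>Pow {1..k}. \<Sum>b<n. of_bool (a \<noteq> b) * (1 / 2 * ?P S a b) * ?off S)"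
    by (intro sum.cong refl sum.swap)
  also have "\<dots> = (\<Sum>S\<in>Pow {1..k}. \<Sum>a<n. \<Sum>b<n. of_bool (a \<noteq> b) * (1 / 2 * ?P S a b) * ?off S)"
    by (rule sum.swap)
  finally show ?thesis by (simp only: sum_distrib_right)
qed

lemma coefficient_split:
  fixes u k c s b :: complex
  shows "(u - k + c) * s * b = (k - c) * (- (s * b)) + u * s * b"
  by (simp add: algebra_simps)

text \<open>The expansion of the transpositions contains $n (-1)^{|S|} b_S$ for every nonempty $S$ and,
  through the excluded sets, $(-1)^{|S|} b_{S \setminus \{l\}}$ for every $l \in S$ if
  $|S| \ge 3$. Collecting the latter by
  $T = S \setminus \{l\}$ gives $-(k - |T|) (-1)^{|T|} b_T$, whence the coefficient
  $n - k + |T|$. The sets $S$ with one element give the scalar $-nk$, and the empty one $\binom{n}{2}$.\<close>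

lemma entry_HR_Z:
  assumes f: "f \<in> words n K" and h: "h \<in> words n K" and k: "k \<le> K"
  shows "entry K (lk (HR_Z n K k)) f h =
    (\<Sum>a<n. \<Sum>b<n. of_bool (a \<noteq> b) * (1 / 2 * of_bool (h = swap_labels k a b f)))
    + (of_nat n * of_nat k - of_nat n * (of_nat n - 1) / 2) * of_bool (h = f)"
proof -
  let ?A = "{1..k}" and ?\<delta> = "of_bool (h = f) :: complex"
  let ?b = "b_entry K f h"
  \<comment> \<open>The condition \<open>{} \<subseteq> S\<close> gives the sums the form of
      \<open>sum_remove_element\<close> for \<open>R = {}\<close>.\<close>
  define Fam where "Fam m = {S. {} \<subseteq> S \<and> S \<subseteq> ?A \<and> m \<le> card S}" for m
  have sub: "S \<subseteq> {1..K}" if "S \<subseteq> ?A" for S using that k by auto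
  have FamD: "S \<subseteq> {1..K}" "finite S" "1 \<le> m \<Longrightarrow> S \<noteq> {}" "m \<le> card S" if "S \<in> Fam m" for S m
    using that k unfolding Fam_def by (auto intro: finite_subset[OF _ finite_atLeastAtMost])
  have exact: "(\<Sum>S | {} \<subseteq> S \<and> S \<subseteq> ?A \<and> card S = m. X S) = of_nat (k choose m) * c"
    if "\<And>S. S \<subseteq> ?A \<Longrightarrow> card S = m \<Longrightarrow> X S = c" for X :: "nat set \<Rightarrow> complex" and m c
  proof -
    have "(\<Sum>S | {} \<subseteq> S \<and> S \<subseteq> ?A \<and> card S = m. X S) = (\<Sum>S | S \<subseteq> ?A \<and> card S = m. c)"
      using that by (intro sum.cong) auto
    then show ?thesis using n_subsets[of ?A m] by simp
  qed
  note split = sum_split_card[where A = ?A and R = "{}", OF finite_atLeastAtMost]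
  have single: "?b S = ?\<delta>" if "S \<subseteq> ?A" "card S = 1" for S
  proof -
    from that(2) obtain l where "S = {l}" by (rule card_1_singletonE)
    then show ?thesis using b_entry_singleton[OF f h, of l] sub[OF that(1)] by simp
  qed
  let ?E = "\<lambda>S. \<Sum>I\<in>excluded S {}. d_entry K f h S I"
  have ex1: "(\<Sum>S\<in>Fam 1. ?E S) = (\<Sum>S\<in>Fam 2. ?E S)"
  proof -
    have "?E S = 0" if "S \<subseteq> ?A" "card S = 1" for S
    proof -
      from that(2) obtain l where "S = {l}" by (rule card_1_singletonE)
      then have "excluded S {} = {}" by (auto simp: excluded_def)
      then show ?thesis by simp
    qed
    then show ?thesis
      using split[of ?E 1] exact[of 1 ?E 0] by (simp add: Fam_def numeral_2_eq_2)
  qed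
  have ex2: "(\<Sum>S\<in>Fam 2. ?E S) = of_nat (k choose 2) * ?\<delta> + (\<Sum>S\<in>Fam 3. ?E S)"
    using split[of ?E 2] exact[of 2 ?E ?\<delta>] sum_excluded_pair[OF sub _ f h]
    by (simp add: Fam_def eval_nat_numeral)
  have ex3: "(\<Sum>S\<in>Fam 3. ?E S) = (\<Sum>T\<in>Fam 2. (of_nat k - of_nat (card T)) * (- ((-1) ^ card T * ?b T)))"
  proof -
    have "(\<Sum>S\<in>Fam 3. ?E S) = (\<Sum>S\<in>Fam 3. \<Sum>l\<in>S - {}. - ((-1) ^ card (S - {l}) * ?b (S - {l})))"
    proof (intro sum.cong refl)
      fix S assume S: "S \<in> Fam 3"
      have "(-1) ^ card S = - ((-1) ^ card (S - {l}) :: complex)" if "l \<in> S" for l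
        using card_Suc_Diff1[OF FamD(2)[OF S] that] by (metis power_Suc mult_minus1)
      moreover have "?E S = (\<Sum>l\<in>S - {}. (-1) ^ card S * ?b (S - {l}))"
        using FamD[OF S] by (intro sum_excluded_generic) auto
      ultimately show "?E S = (\<Sum>l\<in>S - {}. - ((-1) ^ card (S - {l}) * ?b (S - {l})))"
        by (simp cong: sum.cong)
    qed
    then show ?thesis
      using sum_remove_element[of ?A "{}" "\<lambda>T. - ((-1) ^ card T * ?b T)" 2]
      unfolding Fam_def by (simp add: numeral_eq_Suc)
  qed
  have b1: "(\<Sum>S\<in>Fam 1. of_nat n * (-1) ^ card S * ?b S) =
      - of_nat n * of_nat k * ?\<delta> + (\<Sum>S\<in>Fam 2. of_nat n * (-1) ^ card S * ?b S)"
    using split[of "\<lambda>S. of_nat n * (-1) ^ card S * ?b S" 1]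
      exact[of 1 "\<lambda>S. of_nat n * (-1) ^ card S * ?b S" "- of_nat n * ?\<delta>"] single
    by (simp add: Fam_def numeral_2_eq_2)
  have Pow: "Pow ?A = insert {} (Fam 1)" "{} \<notin> Fam 1" "finite (Fam 1)"
  proof -
    have "1 \<le> card S \<longleftrightarrow> S \<noteq> {}" if "S \<subseteq> ?A" for S
      using that finite_subset[OF that] by (auto simp: Suc_le_eq card_gt_0_iff)
    then show "Pow ?A = insert {} (Fam 1)" by (auto simp: Fam_def)
    show "finite (Fam 1)" unfolding Fam_def by (rule finite_subset[of _ "Pow ?A"]) auto
  qed (simp add: Fam_def)
  have Fne: "S \<subseteq> {1..K}" "{} \<subset> S" if "S \<in> Fam 1" for S
    using FamD(1,3)[OF that] by auto
  have id: "(\<forall>m\<in>{1..K} - {}. f m = h m) \<longleftrightarrow> h = f"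
    using words_eqI[OF f h] by auto
  have "(\<Sum>a<n. \<Sum>b<n. of_bool (a \<noteq> b) * (1 / 2 * of_bool (h = swap_labels k a b f))) =
      of_nat n * (of_nat n - 1) / 2 * ?\<delta> +
      (\<Sum>S\<in>Fam 1. (\<Sum>I\<in>proper_sides S {}. d_entry K f h S I) + of_nat n * (-1) ^ card S * ?b S)"
    unfolding expand_over_subsets[OF f h k] Pow(1) sum.insert[OF Pow(3,2)] id prod.empty mult_1_right
      sum_pairs_of_bool
    by (intro arg_cong2[of _ _ _ _ "(+)"] refl sum.cong full_expansion f h Fne)
  also have "(\<Sum>S\<in>Fam 1. (\<Sum>I\<in>proper_sides S {}. d_entry K f h S I) + of_nat n * (-1) ^ card S * ?b S) =
      (\<Sum>S\<in>Fam 1. entry K (lk (p_set K S)) f h) + (\<Sum>S\<in>Fam 1. ?E S)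
      + (\<Sum>S\<in>Fam 1. of_nat n * (-1) ^ card S * ?b S)"
    unfolding sum.distrib[symmetric]
    by (intro sum.cong refl, subst entry_p_set[OF FamD(1)], assumption, simp only: diff_add_cancel)
  finally have main: "(\<Sum>a<n. \<Sum>b<n. of_bool (a \<noteq> b) * (1 / 2 * of_bool (h = swap_labels k a b f))) =
      of_nat n * (of_nat n - 1) / 2 * ?\<delta> + (\<Sum>S\<in>Fam 1. entry K (lk (p_set K S)) f h)
      + of_nat (k choose 2) * ?\<delta> - of_nat n * of_nat k * ?\<delta>
      + (\<Sum>T\<in>Fam 2. (of_nat k - of_nat (card T)) * (- ((-1) ^ card T * ?b T)))
      + (\<Sum>S\<in>Fam 2. of_nat n * (-1) ^ card S * ?b S)"
    unfolding ex1 ex2 ex3 b1 by simp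
  have "entry K (lk (HR_Z n K k)) f h = of_nat (k choose 2) * ?\<delta> + (\<Sum>S\<in>Fam 1. entry K (lk (p_set K S)) f h)
      + (\<Sum>S\<in>Fam 2. (of_nat n - of_nat k + of_nat (card S)) * (-1) ^ card S * ?b S)"
  proof -
    have F: "{S. S \<subseteq> ?A \<and> card S \<ge> 1} = Fam 1" "{S. S \<subseteq> ?A \<and> card S \<ge> 2} = Fam 2"
      by (auto simp: Fam_def)
    have "b_diag K S \<in> diagrams K" if "S \<in> Fam 2" for S
      using FamD[OF that] by (intro b_diag_in_diagrams) auto
    then show ?thesis
      unfolding HR_Z_def F
      by (simp add: entry_add entry_sum entry_single compatible_id_diag[OF f h] cong: sum.cong)
  qed
  also have "(\<Sum>S\<in>Fam 2. (of_nat n - of_nat k + of_nat (card S)) * (-1) ^ card S * ?b S) =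
      (\<Sum>T\<in>Fam 2. (of_nat k - of_nat (card T)) * (- ((-1) ^ card T * ?b T)))
      + (\<Sum>S\<in>Fam 2. of_nat n * (-1) ^ card S * ?b S)"
    unfolding sum.distrib[symmetric] by (intro sum.cong refl coefficient_split)
  finally show ?thesis unfolding main by (simp add: algebra_simps)
qed

section \<open>The matrices of $M_{k+1/2}$ and $M_{k+1}$\<close>

text \<open>The factor $1/2$ turns the sum over ordered pairs into one over unordered pairs, of which only those
  containing \<open>y\<close> contribute.\<close>

lemma sum_pairs_through:
  fixes w :: "nat \<Rightarrow> nat \<Rightarrow> complex"
  assumes y: "y < n" and sym: "\<And>a b. w a b = w b a" and zero: "\<And>a b. a \<noteq> y \<Longrightarrow> b \<noteq> y \<Longrightarrow> a \<noteq> b \<Longrightarrow> w a b = 0"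
  shows "(\<Sum>a<n. \<Sum>b<n. of_bool (a \<noteq> b) * (1 / 2 * w a b)) = (\<Sum>b<n. of_bool (b \<noteq> y) * w b y)"
proof -
  let ?g = "\<lambda>c. of_bool (c \<noteq> y) * w c y / 2"
  have "of_bool (a \<noteq> b) * (1 / 2 * w a b) = (if b = y then ?g a else 0) + (if a = y then ?g b else 0)" for a b
    using sym[of b y] zero[of a b] by auto
  then have "(\<Sum>a<n. \<Sum>b<n. of_bool (a \<noteq> b) * (1 / 2 * w a b)) =
      (\<Sum>a<n. \<Sum>b<n. if b = y then ?g a else 0) + (\<Sum>a<n. \<Sum>b<n. if a = y then ?g b else 0)"
    by (simp only: sum.distrib)
  also have "(\<Sum>a<n. \<Sum>b<n. if b = y then ?g a else 0) = (\<Sum>a<n. ?g a)"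
    using y by simp
  also have "(\<Sum>a<n. \<Sum>b<n. if a = y then ?g b else 0) = (\<Sum>b<n. ?g b)"
    using y by (subst sum.swap) simp
  also have "(\<Sum>b<n. ?g b) + (\<Sum>b<n. ?g b) = (\<Sum>b<n. of_bool (b \<noteq> y) * w b y)"
    unfolding sum.distrib[symmetric] by (intro sum.cong refl) simp
  finally show ?thesis .
qed

lemma HR_M_half_eq:
  "HR_M_half n K k = Poly_Mapping.single (id_diag K) (of_nat k)
     + (\<Sum>S | {k + 1} \<subseteq> S \<and> S \<subseteq> {1..k + 1} \<and> 2 \<le> card S.
          p_tilde K (k + 1) S
          + Poly_Mapping.single (b_diag K S)
              ((of_nat n - of_nat (k + 1) + of_nat (card S)) * (-1) ^ card S))"
proof -
  have "{S. S \<subseteq> {1..k + 1} \<and> k + 1 \<in> S \<and> card S \<ge> 2} = {S. {k + 1} \<subseteq> S \<and> S \<subseteq> {1..k + 1} \<and> 2 \<le> card S}"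
    by auto
  then show ?thesis unfolding HR_M_half_def HR_Z_half_def by simp
qed

text \<open>Position \<open>k + 1\<close> belongs to every \<open>S\<close> here, and its factor is
  minus the indicator that both labels there equal the same one of the letters \<open>a\<close>,
  \<open>b\<close>. Thus only transpositions moving the letter \<open>f (k + 1)\<close> survive, and they act on
  the first \<open>k\<close> positions only.\<close>

lemma expand_over_subsets_through:
  assumes f: "f \<in> words n K" and h: "h \<in> words n K" and k: "k + 1 \<le> K"
  shows "(\<Sum>S | {k + 1} \<subseteq> S \<and> S \<subseteq> {1..k + 1} \<and> 1 \<le> card S.
      (\<Sum>a<n. \<Sum>b<n. of_bool (a \<noteq> b) * (1 / 2 * (\<Prod>l\<in>S. factor {k + 1} (case_vertex f h) a b l)))
      * of_bool (\<forall>m\<in>{1..K} - S. f m = h m)) =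
    - (\<Sum>b<n. of_bool (b \<noteq> f (k + 1)) * of_bool (h = swap_labels k b (f (k + 1)) f))"
proof -
  let ?r = "k + 1" and ?y = "f (k + 1)"
  let ?v = "case_vertex f h"
  let ?P = "\<lambda>S a b. \<Prod>l\<in>S. factor {?r} ?v a b l"
  let ?off = "\<lambda>S. of_bool (\<forall>m\<in>{1..K} - S. f m = h m) :: complex"
  have y: "?y < n" using f k by (intro wordsD) auto
  have nin: "?r \<notin> S" if "S \<in> Pow {1..k}" for S using that by auto
  have fam: "{S. {?r} \<subseteq> S \<and> S \<subseteq> {1..?r} \<and> 1 \<le> card S} = insert ?r ` Pow {1..k}"
  proof (rule set_eqI)
    fix S
    show "S \<in> {S. {?r} \<subseteq> S \<and> S \<subseteq> {1..?r} \<and> 1 \<le> card S} \<longleftrightarrow> S \<in> insert ?r ` Pow {1..k}"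
    proof
      assume "S \<in> {S. {?r} \<subseteq> S \<and> S \<subseteq> {1..?r} \<and> 1 \<le> card S}"
      then have S: "?r \<in> S" "S \<subseteq> {1..?r}" by auto
      then have "S = insert ?r (S - {?r})" "S - {?r} \<in> Pow {1..k}"
        by (auto simp: le_Suc_eq)
      then show "S \<in> insert ?r ` Pow {1..k}" by (rule image_eqI)
    next
      assume "S \<in> insert ?r ` Pow {1..k}"
      then obtain T where T: "S = insert ?r T" "T \<subseteq> {1..k}" by auto
      then have "finite T" by (auto intro: finite_subset[OF _ finite_atLeastAtMost])
      then show "S \<in> {S. {?r} \<subseteq> S \<and> S \<subseteq> {1..?r} \<and> 1 \<le> card S}"
        using T by (auto simp: card_insert_if)
    qed
  qed
  have inj: "inj_on (insert ?r) (Pow {1..k})"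
    using nin by (intro inj_onI) (metis insert_ident)
  define D :: "nat \<Rightarrow> nat \<Rightarrow> complex" where "D a b = of_bool (h = swap_labels k a b f)" for a b
  have inner: "(\<Sum>S\<in>Pow {1..k}. ?P (insert ?r S) a b * ?off (insert ?r S)) = - (of_bool (a = ?y) + of_bool (b = ?y)) * D a b"
    if ab: "a < n" "b < n" "a \<noteq> b" for a b
  proof -
    let ?\<phi> = "factor {?r} ?v a b ?r"
    have P: "?P (insert ?r S) a b = ?\<phi> * (\<Prod>l\<in>S. factor {} ?v a b l)" if S: "S \<in> Pow {1..k}" for S
    proof -
      have "finite S" using S by (auto intro: finite_subset[OF _ finite_atLeastAtMost])
      then have "?P (insert ?r S) a b = ?\<phi> * ?P S a b"
        using nin[OF S] by (rule prod.insert)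
      also have "?P S a b = (\<Prod>l\<in>S. factor {} ?v a b l)"
      proof (intro prod.cong refl)
        fix l assume "l \<in> S"
        then have "l \<notin> {?r}" using nin[OF S] by blast
        then show "factor {?r} ?v a b l = factor {} ?v a b l"
          unfolding factor_def by (simp only: if_False empty_iff)
      qed
      finally show ?thesis .
    qed
    have \<phi>: "?\<phi> = - of_bool (?y = a \<and> h ?r = a) - of_bool (?y = b \<and> h ?r = b)"
      by (simp add: factor_def)
    have off: "?\<phi> * ?off (insert ?r S) = ?\<phi> * ?off S" if S: "S \<in> Pow {1..k}" for S
    proof (cases "?y = h ?r")
      case True
      have "?r \<in> {1..K} - S" using nin[OF S] k by simp
      then have "{1..K} - S = insert ?r ({1..K} - insert ?r S)" by blast
      then have "(\<forall>m\<in>{1..K} - S. f m = h m) \<longleftrightarrow>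
          f ?r = h ?r \<and> (\<forall>m\<in>{1..K} - insert ?r S. f m = h m)"
        by (simp only: ball_simps)
      then show ?thesis using True by (simp only: simp_thms)
    next
      case False
      have "(?y = c \<and> h ?r = c) = False" for c using False by metis
      note no = this[of a] this[of b]
      have "?\<phi> = 0" unfolding \<phi> no by (simp only: of_bool_eq minus_zero diff_zero)
      then show ?thesis by (simp only: mult_zero_left)
    qed
    have "(\<Sum>S\<in>Pow {1..k}. ?P (insert ?r S) a b * ?off (insert ?r S)) =
        (\<Sum>S\<in>Pow {1..k}. ?\<phi> * ((\<Prod>l\<in>S. factor {} ?v a b l) * ?off S))"
    proof (intro sum.cong refl)
      fix S assume S: "S \<in> Pow {1..k}"
      show "?P (insert ?r S) a b * ?off (insert ?r S) = ?\<phi> * ((\<Prod>l\<in>S. factor {} ?v a b l) * ?off S)"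
        unfolding P[OF S] mult.assoc mult.left_commute[of "\<Prod>l\<in>S. factor {} ?v a b l", symmetric]
        by (simp only: mult.left_commute[of ?\<phi>] off[OF S])
    qed
    also have "\<dots> = ?\<phi> * D a b"
      unfolding sum_distrib_left[symmetric] D_def using k ab by (subst swap_labels_expand[OF f h]) auto
    also have "\<dots> = - (of_bool (a = ?y) + of_bool (b = ?y)) * D a b"
    proof (cases "h = swap_labels k a b f")
      case True
      then have "h ?r = swap_labels k a b f ?r" by (rule arg_cong)
      then have "h ?r = ?y" by (simp add: swap_labels_def)
      then have "of_bool (?y = c \<and> h ?r = c) = (of_bool (c = ?y) :: complex)" for c
        by (cases "c = ?y") simp_all
      then show ?thesis unfolding \<phi> by (simp only: minus_add_distrib diff_conv_add_uminus)
    next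
      case False
      then show ?thesis by (simp add: D_def)
    qed
    finally show ?thesis .
  qed
  have "(\<Sum>S | {?r} \<subseteq> S \<and> S \<subseteq> {1..?r} \<and> 1 \<le> card S.
      (\<Sum>a<n. \<Sum>b<n. of_bool (a \<noteq> b) * (1 / 2 * ?P S a b)) * ?off S) =
      (\<Sum>S\<in>Pow {1..k}. \<Sum>a<n. \<Sum>b<n. of_bool (a \<noteq> b) * (1 / 2 * (?P (insert ?r S) a b * ?off (insert ?r S))))"
    unfolding fam sum.reindex[OF inj] o_def sum_distrib_right by (simp only: mult.assoc)
  also have "\<dots> = (\<Sum>a<n. \<Sum>S\<in>Pow {1..k}. \<Sum>b<n. of_bool (a \<noteq> b) * (1 / 2 * (?P (insert ?r S) a b * ?off (insert ?r S))))"
    by (rule sum.swap)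
  also have "\<dots> = (\<Sum>a<n. \<Sum>b<n. \<Sum>S\<in>Pow {1..k}. of_bool (a \<noteq> b) * (1 / 2 * (?P (insert ?r S) a b * ?off (insert ?r S))))"
    by (intro sum.cong refl sum.swap)
  also have "\<dots> = (\<Sum>a<n. \<Sum>b<n. of_bool (a \<noteq> b) * (1 / 2 * (- (of_bool (a = ?y) + of_bool (b = ?y)) * D a b)))"
  proof (intro sum.cong refl)
    fix a b assume "a \<in> {..<n}" "b \<in> {..<n}"
    then have ab: "a < n" "b < n" by simp_all
    show "(\<Sum>S\<in>Pow {1..k}. of_bool (a \<noteq> b) * (1 / 2 * (?P (insert ?r S) a b * ?off (insert ?r S)))) =
        of_bool (a \<noteq> b) * (1 / 2 * (- (of_bool (a = ?y) + of_bool (b = ?y)) * D a b))"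
      unfolding sum_distrib_left[symmetric] by (cases "a = b") (simp only: of_bool_eq mult_zero_left simp_thms, subst inner[OF ab], assumption, rule refl)
  qed
  also have "\<dots> = (\<Sum>b<n. of_bool (b \<noteq> ?y) * (- (of_bool (b = ?y) + of_bool (?y = ?y)) * D b ?y))"
    by (rule sum_pairs_through[OF y]) (auto simp: D_def swap_labels_commute add.commute)
  also have "\<dots> = - (\<Sum>b<n. of_bool (b \<noteq> ?y) * D b ?y)"
    unfolding sum_negf[symmetric] by (intro sum.cong refl) auto
  finally show ?thesis by (simp only: D_def)
qed

text \<open>The coefficients arise as for $Z_k$, with all sets containing $k + 1$ and with $k + 1$ never removed.
  Here $T = \{k + 1\}$ is obtained from the $k$ sets with two elements; as $b_T$ is the identity, it gives
  the scalar $k$. The set $S = \{k + 1\}$ gives $-(n - 1)$.\<close>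

lemma entry_HR_M_half:
  assumes f: "f \<in> words n K" and h: "h \<in> words n K" and k: "k + 1 \<le> K"
  shows "entry K (lk (HR_M_half n K k)) f h =
    of_nat n * of_bool (h = f) - (\<Sum>b<n. of_bool (h = swap_labels k b (f (k + 1)) f))"
proof -
  let ?r = "k + 1" and ?y = "f (k + 1)" and ?\<delta> = "of_bool (h = f) :: complex"
  let ?A = "{1..?r}"
  let ?b = "b_entry K f h"
  have y: "?y < n" using f k by (intro wordsD) auto
  define Fam where "Fam m = {S. {?r} \<subseteq> S \<and> S \<subseteq> ?A \<and> m \<le> card S}" for m
  have FamD: "S \<subseteq> {1..K}" "finite S" "?r \<in> S" "m \<le> card S" if "S \<in> Fam m" for S m
    using that k unfolding Fam_def by (auto intro: finite_subset[OF _ finite_atLeastAtMost])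
  have finFam: "finite (Fam m)" for m
    unfolding Fam_def by (rule finite_subset[of _ "Pow ?A"]) auto
  have Fam1: "Fam 1 = insert {?r} (Fam 2)" "{?r} \<notin> Fam 2"
  proof -
    have "S = {?r}" if "?r \<in> S" "card S = 1" for S
      using that by (metis card_1_singletonE singletonD)
    moreover have "card S = 1 \<or> 2 \<le> card S" if "1 \<le> card S" for S :: "nat set" using that by auto
    ultimately show "Fam 1 = insert {?r} (Fam 2)" by (auto simp: Fam_def)
  qed (simp add: Fam_def)
  have br: "?b {?r} = ?\<delta>" using b_entry_singleton[OF f h, of ?r] k by simp
  have pr: "{?r} \<subset> S" if "S \<in> Fam 2" for S
    using FamD(3,4)[OF that] by (auto simp: psubset_eq)
  let ?E = "\<lambda>S. \<Sum>I\<in>excluded S {?r}. d_entry K f h S I"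
  let ?X = "\<lambda>S. (\<Sum>a<n. \<Sum>b<n. of_bool (a \<noteq> b) * (1 / 2 * (\<Prod>l\<in>S. factor {?r} (case_vertex f h) a b l)))
      * of_bool (\<forall>m\<in>{1..K} - S. f m = h m)"
  have X1: "?X {?r} = - (of_nat n - 1) * ?\<delta>"
  proof -
    let ?v = "case_vertex f h"
    have V: "(\<forall>x\<in>vertices {?r}. ?v x = a) \<longleftrightarrow> f ?r = a \<and> h ?r = a" for a
      by (auto simp: vertices_def)
    have lt: "?v x < n" if "x \<in> vertices {?r}" for x
      using that f h k by (auto simp: vertices_def wordsD)
    note all = sum_distinct_pairs_all[of "vertices {?r}" ?v n, OF lt, unfolded V]
    have "(\<Sum>a<n. \<Sum>b<n. of_bool (a \<noteq> b) * (1 / 2 * (\<Prod>l\<in>{?r}. factor {?r} ?v a b l))) =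
        (\<Sum>a<n. \<Sum>b<n. - (1 / 2) * (of_bool (a \<noteq> b) * of_bool (f ?r = a \<and> h ?r = a))
          + - (1 / 2) * (of_bool (a \<noteq> b) * of_bool (f ?r = b \<and> h ?r = b)))"
      by (intro sum.cong refl) (simp add: factor_def algebra_simps)
    also have "\<dots> = - (1 / 2) * ((of_nat n - 1) * of_bool (constant_on_blocks ?v {vertices {?r}}))
        + - (1 / 2) * ((of_nat n - 1) * of_bool (constant_on_blocks ?v {vertices {?r}}))"
      unfolding sum.distrib sum_distrib_left[symmetric]
      by (subst all(1), simp, simp add: vertices_def, subst all(2), simp, simp add: vertices_def, rule refl)
    finally have "?X {?r} = - (of_nat n - 1) * ?b {?r}"
      unfolding compatible_b_diag of_bool_conj by (simp add: algebra_simps)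
    then show ?thesis by (simp only: br)
  qed
  have ex: "(\<Sum>S\<in>Fam 2. ?E S) = of_nat k * ?\<delta> +
      (\<Sum>T\<in>Fam 2. (of_nat ?r - of_nat (card T)) * (- ((-1) ^ card T * ?b T)))"
  proof -
    have "(\<Sum>S\<in>Fam 2. ?E S) = (\<Sum>S\<in>Fam 2. \<Sum>l\<in>S - {?r}. - ((-1) ^ card (S - {l}) * ?b (S - {l})))"
    proof (intro sum.cong refl)
      fix S assume S: "S \<in> Fam 2"
      have sign: "(-1) ^ card S = - ((-1) ^ card (S - {l}) :: complex)" if "l \<in> S" for l
        using card_Suc_Diff1[OF FamD(2)[OF S] that] by (metis power_Suc mult_minus1)
      have "?E S = (\<Sum>l\<in>S - {?r}. (-1) ^ card S * ?b (S - {l}))"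
        using FamD[OF S] pr[OF S] by (intro sum_excluded_generic) auto
      also have "\<dots> = (\<Sum>l\<in>S - {?r}. - ((-1) ^ card (S - {l}) * ?b (S - {l})))"
      proof (intro sum.cong refl)
        fix l assume "l \<in> S - {?r}"
        then have "l \<in> S" by blast
        from sign[OF this]
        show "(-1) ^ card S * ?b (S - {l}) = - ((-1) ^ card (S - {l}) * ?b (S - {l}))"
          by (simp only: mult_minus_left)
      qed
      finally show "?E S = (\<Sum>l\<in>S - {?r}. - ((-1) ^ card (S - {l}) * ?b (S - {l})))" .
    qed
    also have "\<dots> = (\<Sum>T\<in>Fam 1. (of_nat ?r - of_nat (card T)) * (- ((-1) ^ card T * ?b T)))"
      using sum_remove_element[of ?A "{?r}" "\<lambda>T. - ((-1) ^ card T * ?b T)" 1]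
      unfolding Fam_def by (simp add: numeral_2_eq_2)
    also have "\<dots> = of_nat k * ?\<delta> +
      (\<Sum>T\<in>Fam 2. (of_nat ?r - of_nat (card T)) * (- ((-1) ^ card T * ?b T)))"
      unfolding Fam1(1) sum.insert[OF finFam Fam1(2)] br by simp
    finally show ?thesis .
  qed
  have "- (\<Sum>b<n. of_bool (b \<noteq> ?y) * of_bool (h = swap_labels k b ?y f)) = (\<Sum>S\<in>Fam 1. ?X S)"
    using expand_over_subsets_through[OF f h k] unfolding Fam_def ..
  also have "\<dots> = - (of_nat n - 1) * ?\<delta> + (\<Sum>S\<in>Fam 2. ?X S)"
    unfolding Fam1(1) sum.insert[OF finFam Fam1(2)] X1 ..
  also have "(\<Sum>S\<in>Fam 2. ?X S) =
      (\<Sum>S\<in>Fam 2. (\<Sum>I\<in>proper_sides S {?r}. d_entry K f h S I) + of_nat n * (-1) ^ card S * ?b S)"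
    by (intro sum.cong refl full_expansion f h FamD(1) pr)
  also have "\<dots> = (\<Sum>S\<in>Fam 2. entry K (lk (p_tilde K ?r S)) f h) + (\<Sum>S\<in>Fam 2. ?E S)
      + (\<Sum>S\<in>Fam 2. of_nat n * (-1) ^ card S * ?b S)"
    unfolding sum.distrib[symmetric]
    by (intro sum.cong refl, subst entry_p_tilde[OF FamD(1) FamD(3)], assumption+, simp only: diff_add_cancel)
  finally have main: "- (\<Sum>b<n. of_bool (b \<noteq> ?y) * of_bool (h = swap_labels k b ?y f)) =
      - (of_nat n - 1) * ?\<delta> + ((\<Sum>S\<in>Fam 2. entry K (lk (p_tilde K ?r S)) f h)
      + (of_nat k * ?\<delta> + (\<Sum>T\<in>Fam 2. (of_nat ?r - of_nat (card T)) * (- ((-1) ^ card T * ?b T))))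
      + (\<Sum>S\<in>Fam 2. of_nat n * (-1) ^ card S * ?b S))"
    unfolding ex .
  have "entry K (lk (HR_M_half n K k)) f h = of_nat k * ?\<delta> +
      ((\<Sum>S\<in>Fam 2. entry K (lk (p_tilde K ?r S)) f h)
      + (\<Sum>S\<in>Fam 2. (of_nat n - of_nat ?r + of_nat (card S)) * (-1) ^ card S * ?b S))"
  proof -
    have "b_diag K S \<in> diagrams K" if "S \<in> Fam 2" for S
      using FamD[OF that] by (intro b_diag_in_diagrams) auto
    then show ?thesis
      unfolding HR_M_half_eq Fam_def[symmetric]
      by (simp add: entry_add entry_sum entry_single compatible_id_diag[OF f h] sum.distrib cong: sum.cong)
  qed
  also have "(\<Sum>S\<in>Fam 2. (of_nat n - of_nat ?r + of_nat (card S)) * (-1) ^ card S * ?b S) =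
      (\<Sum>T\<in>Fam 2. (of_nat ?r - of_nat (card T)) * (- ((-1) ^ card T * ?b T)))
      + (\<Sum>S\<in>Fam 2. of_nat n * (-1) ^ card S * ?b S)"
    unfolding sum.distrib[symmetric] by (intro sum.cong refl coefficient_split)
  finally have "entry K (lk (HR_M_half n K k)) f h = (of_nat n - 1) * ?\<delta>
      - (\<Sum>b<n. of_bool (b \<noteq> ?y) * of_bool (h = swap_labels k b ?y f))"
    using main by (simp add: algebra_simps)
  moreover have "(\<Sum>b<n. of_bool (h = swap_labels k b ?y f)) =
      ?\<delta> + (\<Sum>b<n. of_bool (b \<noteq> ?y) * of_bool (h = swap_labels k b ?y f) :: complex)"
  proof -
    have "(\<Sum>b<n. of_bool (h = swap_labels k b ?y f)) =
      (\<Sum>b<n. (if b = ?y then ?\<delta> else 0) + of_bool (b \<noteq> ?y) * of_bool (h = swap_labels k b ?y f) :: complex)"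
      by (intro sum.cong refl) auto
    then show ?thesis using y by (simp add: sum.distrib del: sum_of_bool_mult_eq sum_mult_of_bool_eq sum_of_bool_eq)
  qed
  ultimately show ?thesis by (simp add: algebra_simps del: sum_of_bool_mult_eq sum_mult_of_bool_eq sum_of_bool_eq)
qed

text \<open>The sums over transpositions belonging to $Z_{k+1}$ and $Z_k$ differ only in those moving the last
  letter; for $Z_k$ they are cancelled by the sum contained in $M_{k+1/2}$.\<close>

lemma entry_HR_M:
  assumes f: "f \<in> words n K" and h: "h \<in> words n K" and k: "k + 1 \<le> K"
  shows "entry K (lk (HR_M n K (k + 1))) f h = (\<Sum>b<n. of_bool (h = swap_labels (k + 1) b (f (k + 1)) f))"
proof -
  let ?y = "f (k + 1)" and ?\<delta> = "of_bool (h = f) :: complex"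
  have y: "?y < n" using f k by (intro wordsD) auto
  define D :: "nat \<Rightarrow> nat \<Rightarrow> nat \<Rightarrow> complex" where "D m a b = of_bool (h = swap_labels m a b f)" for m a b
  have Dsame: "D m a a = ?\<delta>" for m a by (simp add: D_def)
  define T where "T m = (\<Sum>a<n. \<Sum>b<n. of_bool (a \<noteq> b) * (1 / 2 * D m a b))" for m
  have "T (k + 1) - T k = (\<Sum>a<n. \<Sum>b<n. of_bool (a \<noteq> b) * (1 / 2 * (D (k + 1) a b - D k a b)))"
    unfolding T_def sum_subtractf[symmetric] by (simp only: right_diff_distrib)
  also have "\<dots> = (\<Sum>b<n. of_bool (b \<noteq> ?y) * (D (k + 1) b ?y - D k b ?y))"
  proof (rule sum_pairs_through[OF y])
    show "D (k + 1) a b - D k a b = D (k + 1) b a - D k b a" for a b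
      by (simp add: D_def swap_labels_commute)
    fix a b assume "a \<noteq> ?y" "b \<noteq> ?y"
    then have "swap_labels (k + 1) a b f = swap_labels k a b f"
      by (auto simp: swap_labels_def fun_eq_iff le_Suc_eq)
    then show "D (k + 1) a b - D k a b = 0" by (simp add: D_def)
  qed
  also have "\<dots> = (\<Sum>b<n. D (k + 1) b ?y - D k b ?y)"
    by (intro sum.cong refl) (auto simp: Dsame)
  finally have T: "T (k + 1) - T k = (\<Sum>b<n. D (k + 1) b ?y) - (\<Sum>b<n. D k b ?y)"
    by (simp only: sum_subtractf)
  have "HR_M n K (k + 1) = HR_Z n K (k + 1) - (HR_Z n K k + HR_M_half n K k)"
    by (simp add: HR_M_def HR_M_half_def)
  then have "entry K (lk (HR_M n K (k + 1))) f h =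
      entry K (lk (HR_Z n K (k + 1))) f h
        - (entry K (lk (HR_Z n K k)) f h + entry K (lk (HR_M_half n K k)) f h)"
    by (simp only: entry_add entry_diff)
  also have "entry K (lk (HR_Z n K (k + 1))) f h =
      T (k + 1) + (of_nat n * of_nat (k + 1) - of_nat n * (of_nat n - 1) / 2) * ?\<delta>"
    unfolding T_def D_def by (rule entry_HR_Z[OF f h k])
  also have "entry K (lk (HR_Z n K k)) f h =
      T k + (of_nat n * of_nat k - of_nat n * (of_nat n - 1) / 2) * ?\<delta>"
    unfolding T_def D_def by (rule entry_HR_Z[OF f h]) (use k in simp)
  also have "entry K (lk (HR_M_half n K k)) f h = of_nat n * ?\<delta> - (\<Sum>b<n. D k b ?y)"
    unfolding D_def by (rule entry_HR_M_half[OF f h k])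
  finally have "entry K (lk (HR_M n K (k + 1))) f h = (T (k + 1) - T k) + (\<Sum>b<n. D k b ?y)"
    by (simp add: algebra_simps)
  then show ?thesis unfolding T D_def by simp
qed

section \<open>Matrices determine coefficients\<close>

lemma card_partition_le:
  assumes "partition_on A P" "finite A"
  shows "card P \<le> card A"
proof (rule card_inj_on_le)
  let ?r = "\<lambda>B. SOME x. x \<in> B"
  have r: "?r B \<in> B" if "B \<in> P" for B
    using partition_onD3[OF assms(1)] that by (metis some_in_eq)
  show "?r ` P \<subseteq> A" using r partition_onD1[OF assms(1)] by blast
  show "inj_on ?r P"
  proof (rule inj_onI)
    fix B C assume BC: "B \<in> P" "C \<in> P" "?r B = ?r C"
    then have "?r B \<in> B \<inter> C" using r[of B] r[of C] by simp
    then show "B = C" using partition_onD2[OF assms(1)] BC(1,2) by (auto simp: disjoint_def)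
  qed
qed fact

lemma card_diagram_le:
  assumes "\<rho> \<in> diagrams K"
  shows "card \<rho> \<le> 2 * K"
proof -
  have "card \<rho> \<le> card (vertices {1..K})"
    using assms by (intro card_partition_le) (auto simp: diagrams_def)
  also have "\<dots> \<le> card (Top ` {1..K}) + card (Bot ` {1..K})"
    unfolding vertices_def by (rule card_Un_le)
  also have "\<dots> \<le> 2 * K"
    using card_image_le[of "{1..K}" Top] card_image_le[of "{1..K}" Bot] by simp
  finally show ?thesis .
qed

text \<open>Label the blocks of the diagram by distinct letters: a second diagram then fits iff each of its
  blocks lies in one of these blocks.\<close>

lemma separating_words:
  assumes \<rho>: "\<rho> \<in> diagrams K" and n: "2 * K \<le> n"
  obtains f h where "f \<in> words n K" "h \<in> words n K"
    "\<forall>\<tau>\<in>diagrams K. compatible \<tau> f h \<longleftrightarrow> (\<forall>B\<in>\<tau>. \<exists>C\<in>\<rho>. B \<subseteq> C)"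
proof -
  have part: "partition_on (vertices {1..K}) \<rho>" using \<rho> by (simp add: diagrams_def)
  have U: "\<Union>\<rho> = vertices {1..K}" using partition_onD1[OF part] by simp
  have fin: "finite \<rho>" using finite_elements[OF _ part] by simp
  have uniq: "B = C" if "B \<in> \<rho>" "C \<in> \<rho>" "x \<in> B" "x \<in> C" for B C x
    using partition_onD2[OF part] that by (auto simp: disjoint_def)
  have "card \<rho> \<le> card {..<n}" using card_diagram_le[OF \<rho>] n by simp
  then obtain g where g: "g ` \<rho> \<subseteq> {..<n}" "inj_on g \<rho>"
    using card_le_inj[OF fin, of "{..<n}"] by auto
  define blk where "blk x = (THE B. B \<in> \<rho> \<and> x \<in> B)" for x
  have blk: "blk x = B" if "B \<in> \<rho>" "x \<in> B" for B x
    unfolding blk_def using that uniq by (intro the_equality) blast+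
  define v where "v x = g (blk x)" for x
  have blk_in: "blk x \<in> \<rho>" "x \<in> blk x" if "x \<in> vertices {1..K}" for x
  proof -
    have "x \<in> \<Union>\<rho>" using that by (simp only: U)
    then obtain B where B: "B \<in> \<rho>" "x \<in> B" by (elim UnionE)
    then show "blk x \<in> \<rho>" "x \<in> blk x" by (simp_all only: blk[OF B])
  qed
  have v: "v x = v y \<longleftrightarrow> blk x = blk y" if "x \<in> vertices {1..K}" "y \<in> vertices {1..K}" for x y
    unfolding v_def by (rule inj_on_eq_iff[OF g(2) blk_in(1)[OF that(1)] blk_in(1)[OF that(2)]])
  have v_less: "v x < n" if "x \<in> vertices {1..K}" for x
    using g(1) blk_in(1)[OF that] by (auto simp: v_def)
  define f where "f = (\<lambda>i\<in>{1..K}. v (Top i))"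
  define h where "h = (\<lambda>i\<in>{1..K}. v (Bot i))"
  have fh: "case_vertex f h x = v x" if "x \<in> vertices {1..K}" for x
    using that by (auto simp: vertices_def f_def h_def)
  have words: "f \<in> words n K" "h \<in> words n K"
    using v_less by (auto simp: words_def f_def h_def vertices_def)
  have "compatible \<tau> f h \<longleftrightarrow> (\<forall>B\<in>\<tau>. \<exists>C\<in>\<rho>. B \<subseteq> C)" if \<tau>: "\<tau> \<in> diagrams K" for \<tau>
  proof -
    have sub: "B \<subseteq> vertices {1..K}" and ne: "B \<noteq> {}" if "B \<in> \<tau>" for B
      using \<tau> that by (auto simp: diagrams_def dest: partition_onD1 partition_onD3)
    show ?thesis
    proof
      assume c: "compatible \<tau> f h"
      show "\<forall>B\<in>\<tau>. \<exists>C\<in>\<rho>. B \<subseteq> C"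
      proof
        fix B assume B: "B \<in> \<tau>"
        obtain x where x: "x \<in> B" using ne[OF B] by blast
        have xV: "x \<in> vertices {1..K}" using x sub[OF B] by blast
        have "B \<subseteq> blk x"
        proof
          fix y assume y: "y \<in> B"
          have yV: "y \<in> vertices {1..K}" using y sub[OF B] by blast
          have "v x = v y"
            using constant_on_blocksD[OF c[unfolded compatible_def] B x y] fh[OF xV] fh[OF yV] by simp
          then have "blk x = blk y" using v[OF xV yV] by simp
          then show "y \<in> blk x" using blk_in(2)[OF yV] by simp
        qed
        then show "\<exists>C\<in>\<rho>. B \<subseteq> C" using blk_in(1)[OF xV] by blast
      qed
    next
      assume r: "\<forall>B\<in>\<tau>. \<exists>C\<in>\<rho>. B \<subseteq> C"
      show "compatible \<tau> f h"
        unfolding compatible_def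
      proof (rule constant_on_blocksI)
        fix B x y assume B: "B \<in> \<tau>" "x \<in> B" "y \<in> B"
        then obtain C where C: "C \<in> \<rho>" "B \<subseteq> C" using r by blast
        have "x \<in> C" "y \<in> C" using B C by auto
        then have "blk x = C" "blk y = C" using blk[OF C(1)] by auto
        moreover have "x \<in> vertices {1..K}" "y \<in> vertices {1..K}" using B sub[OF B(1)] by auto
        ultimately show "case_vertex f h x = case_vertex f h y" by (simp add: fh v)
      qed
    qed
  qed
  then show thesis using that[OF words] by blast
qed

lemma refinement_with_few_blocks:
  assumes \<tau>: "partition_on A \<tau>" and \<rho>: "partition_on A \<rho>" and fin: "finite A"
    and ref: "\<forall>B\<in>\<tau>. \<exists>C\<in>\<rho>. B \<subseteq> C" and card: "card \<tau> \<le> card \<rho>"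
  shows "\<tau> = \<rho>"
proof -
  have finp: "finite \<tau>" "finite \<rho>" using finite_elements[OF fin] \<tau> \<rho> by auto
  from ref obtain F where F: "\<And>B. B \<in> \<tau> \<Longrightarrow> F B \<in> \<rho> \<and> B \<subseteq> F B" by metis
  have uniq: "B = C" if "B \<in> \<rho>" "C \<in> \<rho>" "x \<in> B" "x \<in> C" for B C x
    using partition_onD2[OF \<rho>] that by (auto simp: disjoint_def)
  have hit: "\<exists>B\<in>\<tau>. x \<in> B \<and> F B = C" if "C \<in> \<rho>" "x \<in> C" for C x
  proof -
    have "x \<in> A" using that partition_onD1[OF \<rho>] by blast
    then obtain B where B: "B \<in> \<tau>" "x \<in> B" using partition_onD1[OF \<tau>] by blast
    then have "F B = C" using F[OF B(1)] that uniq by blast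
    then show ?thesis using B by blast
  qed
  have "\<rho> \<subseteq> F ` \<tau>"
  proof
    fix C assume C: "C \<in> \<rho>"
    then obtain x where "x \<in> C" using partition_onD3[OF \<rho>] by (metis ex_in_conv)
    then show "C \<in> F ` \<tau>" using hit[OF C] by blast
  qed
  then have "card \<rho> \<le> card (F ` \<tau>)" using finp by (intro card_mono) auto
  then have "card (F ` \<tau>) = card \<tau>" using card card_image_le[OF finp(1), of F] by linarith
  then have inj: "inj_on F \<tau>" using finp(1) by (simp add: eq_card_imp_inj_on)
  have "\<rho> \<subseteq> \<tau>"
  proof
    fix C assume C: "C \<in> \<rho>"
    then obtain B where B: "B \<in> \<tau>" "F B = C" using \<open>\<rho> \<subseteq> F ` \<tau>\<close> by blast
    have "C \<subseteq> B"
    proof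
      fix x assume "x \<in> C"
      then obtain B' where B': "B' \<in> \<tau>" "x \<in> B'" "F B' = C" using hit[OF C] by blast
      then have "B' = B" using inj B by (auto dest: inj_onD)
      then show "x \<in> B" using B'(2) by simp
    qed
    then have "B = C" using F[OF B(1)] B(2) by auto
    then show "C \<in> \<tau>" using B by simp
  qed
  then show ?thesis using card_subset_eq[OF finp(1)] card card_mono[OF finp(1)] by (metis le_antisym)
qed

text \<open>Among the diagrams where the coefficients differ, take one with the most blocks and label its blocks
  by distinct letters. Every other diagram that fits is a proper refinement, hence has more blocks, and
  so has equal coefficients. The two entries therefore differ.\<close>

lemma coefficients_determined_by_entries:
  assumes n: "2 * K \<le> n"
    and eq: "\<And>f h. f \<in> words n K \<Longrightarrow> h \<in> words n K \<Longrightarrow> entry K c f h = entry K d f h"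
    and \<rho>: "\<rho> \<in> diagrams K"
  shows "c \<rho> = d \<rho>"
proof (rule ccontr)
  define E where "E = {\<tau> \<in> diagrams K. c \<tau> \<noteq> d \<tau>}"
  assume "c \<rho> \<noteq> d \<rho>"
  then have "E \<noteq> {}" using \<rho> by (auto simp: E_def)
  moreover have finE: "finite E" by (simp add: E_def)
  ultimately have "Max (card ` E) \<in> card ` E" by (intro Max_in) auto
  then obtain \<rho>0 where \<rho>0: "\<rho>0 \<in> E" and "Max (card ` E) = card \<rho>0" by (rule imageE)
  then have max: "card \<tau> \<le> card \<rho>0" if "\<tau> \<in> E" for \<tau>
    using Max_ge[of "card ` E" "card \<tau>"] finE that by simp
  have D: "\<rho>0 \<in> diagrams K" using \<rho>0 by (simp add: E_def)
  obtain f h where fh: "f \<in> words n K" "h \<in> words n K"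
    and all: "\<forall>\<tau>\<in>diagrams K. compatible \<tau> f h \<longleftrightarrow> (\<forall>B\<in>\<tau>. \<exists>C\<in>\<rho>0. B \<subseteq> C)"
    by (rule separating_words[OF D n])
  note comp = bspec[OF all]
  have "(\<Sum>\<tau>\<in>diagrams K. (c \<tau> - d \<tau>) * of_bool (compatible \<tau> f h)) =
      (\<Sum>\<tau>\<in>diagrams K. if \<tau> = \<rho>0 then c \<rho>0 - d \<rho>0 else 0)"
  proof (intro sum.cong refl)
    fix \<tau> assume \<tau>: "\<tau> \<in> diagrams K"
    show "(c \<tau> - d \<tau>) * of_bool (compatible \<tau> f h) = (if \<tau> = \<rho>0 then c \<rho>0 - d \<rho>0 else 0)"
    proof (cases "c \<tau> = d \<tau> \<or> \<not> compatible \<tau> f h")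
      case True
      moreover have "compatible \<rho>0 f h" using comp[OF D] by blast
      ultimately show ?thesis using \<rho>0 by (auto simp: E_def)
    next
      case False
      then have "\<tau> = \<rho>0"
        using \<tau> D comp[OF \<tau>] max[of \<tau>]
        by (intro refinement_with_few_blocks[of "vertices {1..K}"]) (auto simp: E_def diagrams_def)
      then show ?thesis using False by simp
    qed
  qed
  also have "\<dots> = c \<rho>0 - d \<rho>0" using D by simp
  finally have "entry K c f h - entry K d f h = c \<rho>0 - d \<rho>0"
    by (simp only: entry_def sum_subtractf[symmetric] left_diff_distrib)
  then show False using eq[OF fh] \<rho>0 by (simp add: E_def)
qed

section \<open>Coefficients as polynomials in $n$\<close>

definition polynomial_in_n :: "(nat \<Rightarrow> complex) \<Rightarrow> bool" where
  "polynomial_in_n g \<longleftrightarrow> (\<exists>q. \<forall>n. g n = poly q (of_nat n))"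

lemma polynomial_in_n_const: "polynomial_in_n (\<lambda>_. c)"
  unfolding polynomial_in_n_def by (rule exI[of _ "[:c:]"]) simp

lemma polynomial_in_n_linear: "polynomial_in_n (\<lambda>n. (of_nat n - a + b) * c)"
  unfolding polynomial_in_n_def by (rule exI[of _ "[:(b - a) * c, c:]"]) (simp add: algebra_simps)

lemma polynomial_in_n_add: "polynomial_in_n g \<Longrightarrow> polynomial_in_n h \<Longrightarrow> polynomial_in_n (\<lambda>n. g n + h n)"
  unfolding polynomial_in_n_def by (metis poly_add)

lemma polynomial_in_n_diff: "polynomial_in_n g \<Longrightarrow> polynomial_in_n h \<Longrightarrow> polynomial_in_n (\<lambda>n. g n - h n)"
  unfolding polynomial_in_n_def by (metis poly_diff)

lemma polynomial_in_n_sum: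
  "(\<And>i. i \<in> A \<Longrightarrow> polynomial_in_n (g i)) \<Longrightarrow> polynomial_in_n (\<lambda>n. \<Sum>i\<in>A. g i n)"
  by (induction A rule: infinite_finite_induct) (simp_all add: polynomial_in_n_const polynomial_in_n_add)

lemma polynomial_in_n_single:
  assumes "polynomial_in_n g"
  shows "polynomial_in_n (\<lambda>n. lk (Poly_Mapping.single \<tau> (g n)) \<rho>)"
  using assms by (cases "\<tau> = \<rho>") (simp_all add: lookup_single when_def polynomial_in_n_const)

lemma polynomial_in_n_HR_Z: "polynomial_in_n (\<lambda>n. lk (HR_Z n K k) \<rho>)"
  unfolding HR_Z_def lookup_add lookup_sum
  by (intro polynomial_in_n_add polynomial_in_n_sum polynomial_in_n_single polynomial_in_n_linear
      polynomial_in_n_const)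

lemma polynomial_in_n_HR_M_half: "polynomial_in_n (\<lambda>n. lk (HR_M_half n K k) \<rho>)"
  unfolding HR_M_half_def HR_Z_half_def lookup_add lookup_sum lookup_minus
  by (intro polynomial_in_n_add polynomial_in_n_diff polynomial_in_n_sum polynomial_in_n_single
      polynomial_in_n_linear polynomial_in_n_const polynomial_in_n_HR_Z)

lemma polynomial_in_n_HR_M: "polynomial_in_n (\<lambda>n. lk (HR_M n K k) \<rho>)"
  unfolding HR_M_def HR_Z_half_def lookup_add lookup_sum lookup_minus
  by (intro polynomial_in_n_add polynomial_in_n_diff polynomial_in_n_sum polynomial_in_n_single
      polynomial_in_n_linear polynomial_in_n_const polynomial_in_n_HR_Z)

text \<open>The difference of the two polynomials has infinitely many roots.\<close>

lemma polynomial_in_n_eqI: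
  assumes "polynomial_in_n g" "polynomial_in_n h" and eq: "\<And>n. N \<le> n \<Longrightarrow> g n = h n"
  shows "g n = h n"
proof -
  obtain p q where p: "\<And>n. g n = poly p (of_nat n)" and q: "\<And>n. h n = poly q (of_nat n)"
    using assms(1,2) unfolding polynomial_in_n_def by auto
  have "(of_nat ` {N..} :: complex set) \<subseteq> {x. poly (p - q) x = 0}"
    using eq by (auto simp: p[symmetric] q[symmetric])
  moreover have "infinite (of_nat ` {N..} :: complex set)"
  proof
    assume "finite (of_nat ` {N..} :: complex set)"
    then have "finite {N..}" by (rule finite_imageD) (simp add: inj_on_def)
    then show False by (simp add: infinite_Ici)
  qed
  ultimately have "infinite {x. poly (p - q) x = 0}" using finite_subset by blast
  then have "p - q = 0" using poly_roots_finite by blast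
  then show ?thesis by (simp add: p q)
qed

section \<open>The comparison\<close>

lemma lookup_single_outside:
  "\<rho> \<notin> diagrams K \<Longrightarrow> \<tau> \<in> diagrams K \<Longrightarrow> lk (Poly_Mapping.single \<tau> a) \<rho> = 0"
  by (auto simp: lookup_single when_def)

lemma lookup_p_set_outside:
  assumes "\<rho> \<notin> diagrams K" "S \<subseteq> {1..K}"
  shows "lk (p_set K S) \<rho> = 0"
  unfolding p_set_def lookup_sum
  using assms by (intro sum.neutral ballI lookup_single_outside[OF assms(1)] d_diag_in_diagrams) auto

lemma lookup_p_tilde_outside:
  assumes "\<rho> \<notin> diagrams K" "S \<subseteq> {1..K}"
  shows "lk (p_tilde K r S) \<rho> = 0"
  unfolding p_tilde_def lookup_sum
  using assms by (intro sum.neutral ballI lookup_single_outside[OF assms(1)] d_diag_in_diagrams) auto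

lemma lookup_b_diag_outside:
  assumes "\<rho> \<notin> diagrams K" "S \<subseteq> {1..K}" "2 \<le> card S"
  shows "lk (Poly_Mapping.single (b_diag K S) a) \<rho> = 0"
  using assms by (intro lookup_single_outside[OF assms(1)] b_diag_in_diagrams) auto

lemma lookup_HR_Z_outside:
  assumes \<rho>: "\<rho> \<notin> diagrams K" and k: "k \<le> K"
  shows "lk (HR_Z n K k) \<rho> = 0"
proof -
  have sub: "S \<subseteq> {1..K}" if "S \<subseteq> {1..k}" for S using that k by auto
  show ?thesis
    unfolding HR_Z_def lookup_add lookup_sum
    by (simp add: lookup_single_outside[OF \<rho>] lookup_p_set_outside[OF \<rho> sub] lookup_b_diag_outside[OF \<rho> sub])
qed

lemma lookup_HR_M_half_outside:
  assumes \<rho>: "\<rho> \<notin> diagrams K" and k: "k + 1 \<le> K"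
  shows "lk (HR_M_half n K k) \<rho> = 0"
proof -
  have sub: "S \<subseteq> {1..K}" if "S \<subseteq> {1..k + 1}" for S using that k by auto
  show ?thesis
    unfolding HR_M_half_def HR_Z_half_def lookup_minus lookup_add lookup_sum
    using lookup_p_tilde_outside[OF \<rho> sub] lookup_b_diag_outside[OF \<rho> sub]
    by (simp add: lookup_single_outside[OF \<rho>])
qed

lemma lookup_HR_M_outside:
  assumes \<rho>: "\<rho> \<notin> diagrams K" and k: "k + 1 \<le> K"
  shows "lk (HR_M n K (k + 1)) \<rho> = 0"
proof -
  have "HR_M n K (k + 1) = HR_Z n K (k + 1) - (HR_Z n K k + HR_M_half n K k)"
    by (simp add: HR_M_def HR_M_half_def)
  then show ?thesis
    using lookup_HR_Z_outside[OF \<rho>, of _ n] lookup_HR_M_half_outside[OF \<rho> k] k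
    by (simp add: lookup_minus lookup_add)
qed

lemma poly_of_int_of_nat: "poly (map_poly of_int q) (of_nat n) = (of_int (poly q (int n)) :: complex)"
  by (induction q) (simp_all add: map_poly_pCons)

lemma lookup_specialize:
  "lk (specialize n x) \<rho> = of_int (poly (Poly_Mapping.lookup x \<rho>) (int n))"
  by (simp add: specialize_def Poly_Mapping.map.rep_eq poly_of_int_of_nat when_def)

lemma polynomial_in_n_specialize: "polynomial_in_n (\<lambda>n. lk (specialize n x) \<rho>)"
  unfolding polynomial_in_n_def lookup_specialize
  by (rule exI[of _ "map_poly of_int (Poly_Mapping.lookup x \<rho>)"]) (simp add: poly_of_int_of_nat)

lemma tensor_action_specialize:
  "tensor_action ([:0, 1:] :: int poly) n (\<lambda>q. of_int (poly q (int n)))"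
  by unfold_locales simp_all

context tensor_action
begin

lemma lookup_\<sigma>_outside:
  assumes \<rho>: "\<rho> \<notin> diagrams K" and i: "i < K"
  shows "Poly_Mapping.lookup (\<sigma> (Suc i)) \<rho> = 0"
proof -
  have "Poly_Mapping.lookup id_elt \<rho> = 0"
    using \<rho> by (auto simp: id_elt_def lookup_single when_def)
  moreover have "Poly_Mapping.lookup (s 1) \<rho> = 0" if "1 < K"
    using \<rho> s_diag_in_diagrams[of 1 K] that by (auto simp: s_def lookup_single when_def)
  ultimately show ?thesis
    using i by (simp add: \<sigma>.simps lookup_add lookup_minus lookup_times_outside[OF \<rho>])
qed

lemma lookup_L_outside:
  assumes \<rho>: "\<rho> \<notin> diagrams K" and i: "i < K"
  shows "Poly_Mapping.lookup (L (Suc i)) \<rho> = 0"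
proof -
  have "Poly_Mapping.lookup (p 1) \<rho> = 0"
    using \<rho> p_diag_in_diagrams[of 1 K] i by (auto simp: p_def lookup_single when_def)
  then show ?thesis
    by (simp add: L.simps lookup_add lookup_minus lookup_times_outside[OF \<rho>] lookup_\<sigma>_outside[OF \<rho> i])
qed

lemma lookup_L_half_outside:
  assumes \<rho>: "\<rho> \<notin> diagrams K"
  shows "Poly_Mapping.lookup (L_half i) \<rho> = 0"
proof (cases i)
  case (Suc j)
  have "Poly_Mapping.lookup id_elt \<rho> = 0"
    using \<rho> by (auto simp: id_elt_def lookup_single when_def)
  then have "Poly_Mapping.lookup (\<sigma>_half (Suc j)) \<rho> = 0"
    by (simp add: \<sigma>_half.simps Let_def lookup_add lookup_minus lookup_times_outside[OF \<rho>])
  then show ?thesis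
    by (simp add: Suc L_half.simps Let_def lookup_add lookup_minus lookup_times_outside[OF \<rho>])
qed (simp add: L_half.simps)

lemma mat_L:
  assumes f: "f \<in> words n K" and h: "h \<in> words n K" and i: "i < K"
  shows "mat (L (Suc i)) f h = (\<Sum>b<n. of_bool (h = swap_labels (Suc i) b (f (Suc i)) f))"
proof -
  have "acts_as_L (Suc i)" using acts_as_L_and_\<sigma>[of i] i by simp
  then have "mat (L (Suc i)) f h = (\<Sum>b<n. of_bool (swap_labels (Suc i) b (f (Suc i)) f = h))"
    using f unfolding acts_as_L_def act_indicator[OF h, symmetric] by blast
  then show ?thesis by (simp only: eq_commute)
qed

lemma mat_L_half:
  assumes f: "f \<in> words n K" and h: "h \<in> words n K" and i: "i < K"
  shows "mat (L_half i) f h = of_nat n * of_bool (h = f) - (\<Sum>b<n. of_bool (h = swap_labels i b (f (Suc i)) f))"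
proof -
  have "mat (L_half i) f h = of_nat n * of_bool (f = h) - (\<Sum>b<n. of_bool (swap_labels i b (f (Suc i)) f = h))"
    using f acts_as_L_half[OF i] unfolding acts_as_L_half_def act_indicator[OF h, symmetric] by blast
  then show ?thesis by (simp only: eq_commute)
qed

end

text \<open>The representation on words in \<open>m\<close> letters compares the two sides for large \<open>m\<close>,
  and polynomiality transfers the result to the given \<open>n\<close>.\<close>

lemma HR_eq_specialize:
  assumes pol: "polynomial_in_n (\<lambda>n. lk (HR n) \<rho>)"
    and out: "\<And>m. \<rho> \<notin> diagrams K \<Longrightarrow> lk (HR m) \<rho> = 0" "\<rho> \<notin> diagrams K \<Longrightarrow> Poly_Mapping.lookup x \<rho> = 0"
    and eq: "\<And>m f h. f \<in> words m K \<Longrightarrow> h \<in> words m K \<Longrightarrow>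
      entry K (lk (HR m)) f h = entry K (\<lambda>\<tau>. of_int (poly (Poly_Mapping.lookup x \<tau>) (int m))) f h"
  shows "lk (HR n) \<rho> = lk (specialize n x) \<rho>"
proof (rule polynomial_in_n_eqI[OF pol polynomial_in_n_specialize, of "2 * K"])
  fix m assume m: "2 * K \<le> m"
  show "lk (HR m) \<rho> = lk (specialize m x) \<rho>"
  proof (cases "\<rho> \<in> diagrams K")
    case True
    then show ?thesis
      by (intro coefficients_determined_by_entries[OF m]) (simp_all only: eq lookup_specialize)
  next
    case False
    then show ?thesis by (simp add: out lookup_specialize)
  qed
qed

theorem theorem5p5:
  fixes n k :: nat
  assumes "n \<ge> 1" and "k \<ge> 1"
  shows "HR_M_half n (k + 1) k =
           specialize n (partition_algebra.L_half (k + 1) [:0, 1:] k)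
       \<and> HR_M n (k + 1) (k + 1) =
           specialize n (partition_algebra.L (k + 1) [:0, 1:] (k + 1))"
proof -
  let ?K = "k + 1" and ?z = "[:0, 1:] :: int poly"
  let ?ev = "\<lambda>m q. of_int (poly q (int m)) :: complex"
  have act: "tensor_action ?z m (?ev m)" for m by (rule tensor_action_specialize)
  have "lk (HR_M_half n ?K k) \<rho> = lk (specialize n (partition_algebra.L_half ?K ?z k)) \<rho>" for \<rho>
  proof (rule HR_eq_specialize)
    fix m f h assume fh: "f \<in> words m ?K" "h \<in> words m ?K"
    interpret tensor_action ?K ?z m "?ev m" by (rule act)
    show "entry ?K (lk (HR_M_half m ?K k)) f h =
        entry ?K (\<lambda>\<tau>. ?ev m (Poly_Mapping.lookup (L_half k) \<tau>)) f h"
      unfolding mat_def[symmetric]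
      by (simp only: mat_L_half[OF fh less_add_one] entry_HR_M_half[OF fh order_refl] Suc_eq_plus1)
  next
    assume \<rho>: "\<rho> \<notin> diagrams ?K"
    \<comment> \<open>The support does not depend on the number of letters, so any number will do.\<close>
    interpret tensor_action ?K ?z 1 "?ev 1" by (rule act)
    show "Poly_Mapping.lookup (L_half k) \<rho> = 0" by (rule lookup_L_half_outside[OF \<rho>])
  qed (simp_all add: polynomial_in_n_HR_M_half lookup_HR_M_half_outside)
  moreover have "lk (HR_M n ?K ?K) \<rho> = lk (specialize n (partition_algebra.L ?K ?z ?K)) \<rho>" for \<rho>
  proof (rule HR_eq_specialize)
    fix m f h assume fh: "f \<in> words m ?K" "h \<in> words m ?K"
    interpret tensor_action ?K ?z m "?ev m" by (rule act)
    show "entry ?K (lk (HR_M m ?K ?K)) f h =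
        entry ?K (\<lambda>\<tau>. ?ev m (Poly_Mapping.lookup (L ?K) \<tau>)) f h"
      unfolding mat_def[symmetric]
      by (simp only: mat_L[OF fh less_add_one, unfolded Suc_eq_plus1] entry_HR_M[OF fh order_refl])
  next
    assume \<rho>: "\<rho> \<notin> diagrams ?K"
    interpret tensor_action ?K ?z 1 "?ev 1" by (rule act)
    show "Poly_Mapping.lookup (L ?K) \<rho> = 0" using lookup_L_outside[OF \<rho>, of k] by simp
  next
    fix m assume "\<rho> \<notin> diagrams ?K"
    then show "lk (HR_M m ?K ?K) \<rho> = 0" by (rule lookup_HR_M_outside) simp
  qed (rule polynomial_in_n_HR_M)
  ultimately show ?thesis by (simp add: poly_mapping_eq_iff fun_eq_iff)
qed

end
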